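(* Let $T$ be a Calderón--Zygmund operator on $\mathbb{R}^n$, let $b\in BMO$ and let $w\in A_\infty$. Then there is a constant $c=c_{n,T}$, depending only on $n$ and $T$, such that for $0<p<\infty$ and every function $f$ (in the domain of $[b,T]$), $$\|[b,T]f\|_{L^p(w)}\le c\,\|b\|_{BMO}\,\max\{1,p^2\}\,[w]_{A_\infty}^2\,\|M^2f\|_{L^p(w)}.$$
   Context: Calderón--Zygmund operators are understood in the usual sense (linear operators bounded on $L^2(\mathbb{R}^n)$ associated with a standard kernel). The commutator is $[b,T]f=b\,Tf-T(bf)$. A weight is a non-negative measurable function $w$ on $\mathbb{R}^n$; $\|f\|_{L^p(w)}=\left(\int_{\mathbb{R}^n}|f|^p\,w\,dx\right)^{1/p}$ for $0<p<\infty$ and $w(E)=\int_E w\,dx$. Cubes are denoted by $Q$. The Hardy--Littlewood maximal operator is $Mf(x)=\sup_{Q\ni x}\frac{1}{|Q|}\int_Q|f(y)|\,dy$, the supremum being over all cubes containing $x$, and $M^2=M\circ M$. For $1<p<\infty$, $p'$ is defined by $\frac1p+\frac1{p'}=1$ and $w\in A_p$ means $\sup_Q\left(\frac{1}{|Q|}\int_Q w\right)\left(\frac{1}{|Q|}\int_Q w^{1-p'}\right)^{p-1}<\infty$; $A_\infty=\bigcup_{p>1}A_p$. The (Wilson) $A_\infty$ constant is $[w]_{A_\infty}=\sup_Q\frac{1}{w(Q)}\int_Q M(w\chi_Q)\,dx$. *)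

theory Defs
  imports "HOL-Analysis.Analysis"
begin

definition cubes :: "(real^'n) set set" where
  "cubes = {cbox a (a + vec l) | a l. 0 < l}"

text \<open>Real powers on \<open>[0,\<infinity>]\<close>. For negative exponents the value at \<open>0\<close> is \<open>\<infinity>\<close>,
  in contrast to \<^term>\<open>(0::real) powr a = 0\<close>; this matters in the \<open>A\<^sub>p\<close> condition for
  weights vanishing on a set of positive measure.\<close>

definition ennreal_powr :: "ennreal \<Rightarrow> real \<Rightarrow> ennreal" where
  "ennreal_powr x a =
     (if a = 0 then 1
      else if x = 0 then (if a < 0 then \<infinity> else 0)
      else if x = \<infinity> then (if a < 0 then 0 else \<infinity>)
      else ennreal (enn2real x powr a))"

definition average :: "(real^'n) set \<Rightarrow> (real^'n \<Rightarrow> ennreal) \<Rightarrow> ennreal" where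
  "average Q g = (\<integral>\<^sup>+x\<in>Q. g x \<partial>lebesgue) / emeasure lebesgue Q"

text \<open>Functions enter the maximal operator through their absolute value; it acts on
  \<open>[0,\<infinity>]\<close>-valued functions so that it can be iterated.\<close>

definition hl_maximal :: "(real^'n \<Rightarrow> ennreal) \<Rightarrow> real^'n \<Rightarrow> ennreal" where
  "hl_maximal g x = (SUP Q\<in>{Q \<in> cubes. x \<in> Q}. average Q g)"

definition weight :: "(real^'n \<Rightarrow> real) \<Rightarrow> bool" where
  "weight w \<longleftrightarrow> w \<in> borel_measurable lebesgue \<and> (\<forall>x. 0 \<le> w x)"

definition weighted_Lp_norm :: "real \<Rightarrow> (real^'n \<Rightarrow> real) \<Rightarrow> (real^'n \<Rightarrow> ennreal) \<Rightarrow> ennreal" where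
  "weighted_Lp_norm p w g =
     ennreal_powr (\<integral>\<^sup>+x. ennreal_powr (g x) p * ennreal (w x) \<partial>lebesgue) (1 / p)"

text \<open>The conjugate exponent: \<open>1/p + 1/p' = 1\<close>.\<close>

definition conjugate_exponent :: "real \<Rightarrow> real" where
  "conjugate_exponent p = p / (p - 1)"

definition Muckenhoupt_A :: "real \<Rightarrow> (real^'n \<Rightarrow> real) set" where
  "Muckenhoupt_A p = {w. weight w \<and>
     (SUP Q\<in>cubes. average Q (\<lambda>x. ennreal (w x)) *
        ennreal_powr (average Q (\<lambda>x. ennreal_powr (ennreal (w x)) (1 - conjugate_exponent p))) (p - 1))
     < \<infinity>}"

definition Muckenhoupt_A_infinity :: "(real^'n \<Rightarrow> real) set" where
  "Muckenhoupt_A_infinity = (\<Union>p\<in>{1<..}. Muckenhoupt_A p)"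

definition A_infinity_constant :: "(real^'n \<Rightarrow> real) \<Rightarrow> ennreal" where
  "A_infinity_constant w =
     (SUP Q\<in>cubes. (\<integral>\<^sup>+x\<in>Q. hl_maximal (\<lambda>y. ennreal (w y) * indicator Q y) x \<partial>lebesgue)
                    / (\<integral>\<^sup>+x\<in>Q. ennreal (w x) \<partial>lebesgue))"

definition mean_value :: "(real^'n) set \<Rightarrow> (real^'n \<Rightarrow> complex) \<Rightarrow> complex" where
  "mean_value Q b = (LINT x:Q|lebesgue. b x) / complex_of_real (measure lebesgue Q)"

definition BMO_norm :: "(real^'n \<Rightarrow> complex) \<Rightarrow> ennreal" where
  "BMO_norm b = (SUP Q\<in>cubes. average Q (\<lambda>x. ennreal (norm (b x - mean_value Q b))))"

definition BMO :: "(real^'n \<Rightarrow> complex) set" where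
  "BMO = {b. b \<in> borel_measurable lebesgue \<and>
     (\<forall>Q\<in>cubes. set_integrable lebesgue Q b) \<and> BMO_norm b < \<infinity>}"

definition L2 :: "(real^'n \<Rightarrow> complex) set" where
  "L2 = {f. f \<in> borel_measurable lebesgue \<and> integrable lebesgue (\<lambda>x. (norm (f x))\<^sup>2)}"

definition L2_norm :: "(real^'n \<Rightarrow> complex) \<Rightarrow> real" where
  "L2_norm f = sqrt (LINT x|lebesgue. (norm (f x))\<^sup>2)"

text \<open>Functions stand for their almost-everywhere classes, so linearity is required only
  almost everywhere. Together with the norm bound this makes the class of \<open>T f\<close> depend only
  on the class of \<open>f\<close>. The values of \<open>T\<close> outside \<open>L2\<close> are irrelevant.\<close>

definition bounded_linear_on_L2 ::
  "((real^'n \<Rightarrow> complex) \<Rightarrow> (real^'n \<Rightarrow> complex)) \<Rightarrow> bool" where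
  "bounded_linear_on_L2 T \<longleftrightarrow>
     (\<forall>f\<in>L2. T f \<in> L2) \<and>
     (\<forall>f\<in>L2. \<forall>g\<in>L2. AE x in lebesgue. T (\<lambda>y. f y + g y) x = T f x + T g x) \<and>
     (\<forall>f\<in>L2. \<forall>c. AE x in lebesgue. T (\<lambda>y. c * f y) x = c * T f x) \<and>
     (\<exists>B. \<forall>f\<in>L2. L2_norm (T f) \<le> B * L2_norm f)"

text \<open>Size and Hoelder regularity conditions off the diagonal; the values \<open>K x x\<close> are irrelevant.\<close>

definition standard_kernel :: "(real^'n \<Rightarrow> real^'n \<Rightarrow> complex) \<Rightarrow> bool" where
  "standard_kernel K \<longleftrightarrow> (\<exists>C \<delta>. 0 < \<delta> \<and> \<delta> \<le> 1 \<and>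
     (\<forall>x y. x \<noteq> y \<longrightarrow> norm (K x y) \<le> C / dist x y ^ CARD('n)) \<and>
     (\<forall>x x' y. 2 * dist x x' < dist x y \<longrightarrow>
        norm (K x y - K x' y) \<le> C * dist x x' powr \<delta> / dist x y powr (real CARD('n) + \<delta>)) \<and>
     (\<forall>x y y'. 2 * dist y y' < dist x y \<longrightarrow>
        norm (K x y - K x y') \<le> C * dist y y' powr \<delta> / dist x y powr (real CARD('n) + \<delta>)))"

definition support :: "(real^'n \<Rightarrow> complex) \<Rightarrow> (real^'n) set" where
  "support f = closure {x. f x \<noteq> 0}"

definition associated_kernel ::
  "((real^'n \<Rightarrow> complex) \<Rightarrow> (real^'n \<Rightarrow> complex)) \<Rightarrow> (real^'n \<Rightarrow> real^'n \<Rightarrow> complex) \<Rightarrow> bool" where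
  "associated_kernel T K \<longleftrightarrow>
     (\<forall>f\<in>L2. compact (support f) \<longrightarrow>
        (AE x in lebesgue. x \<notin> support f \<longrightarrow> T f x = (LINT y|lebesgue. K x y * f y)))"

definition Calderon_Zygmund_operator ::
  "((real^'n \<Rightarrow> complex) \<Rightarrow> (real^'n \<Rightarrow> complex)) \<Rightarrow> bool" where
  "Calderon_Zygmund_operator T \<longleftrightarrow>
     bounded_linear_on_L2 T \<and> (\<exists>K. standard_kernel K \<and> associated_kernel T K)"

definition commutator ::
  "(real^'n \<Rightarrow> complex) \<Rightarrow> ((real^'n \<Rightarrow> complex) \<Rightarrow> (real^'n \<Rightarrow> complex)) \<Rightarrow>
   (real^'n \<Rightarrow> complex) \<Rightarrow> real^'n \<Rightarrow> complex" where
  "commutator b T f = (\<lambda>x. b x * T f x - T (\<lambda>y. b y * f y) x)"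

text \<open>As \<open>T\<close> acts on \<open>L2\<close>, both terms of \<open>b T f - T (b f)\<close> make sense exactly when
  \<open>f\<close> and \<open>b f\<close> belong to \<open>L2\<close>. For \<open>b\<close> in \<^term>\<open>BMO\<close> this includes all bounded measurable functions with
  bounded support.\<close>

definition commutator_domain :: "(real^'n \<Rightarrow> complex) \<Rightarrow> (real^'n \<Rightarrow> complex) set" where
  "commutator_domain b = {f \<in> L2. (\<lambda>x. b x * f x) \<in> L2}"

end

theory Submission
  imports Defs
begin

text \<open>Why the inequality holds. Write \<open>v = T f\<close>, \<open>u = T (b f)\<close> and let \<open>\<beta>\<^sub>Q\<close> be the mean of \<open>b\<close> over a
cube \<open>Q\<close>. On every cube the commutator is \<open>(b - \<beta>\<^sub>Q) v - (u - \<beta>\<^sub>Q v)\<close>, and \<open>u - \<beta>\<^sub>Q v\<close> is the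
image of \<open>(b - \<beta>\<^sub>Q) f\<close>. So it suffices to know how much an image \<open>T h\<close> can oscillate on \<open>Q\<close>: outside
a small fraction of \<open>Q\<close> it stays close to one number, up to a multiple of a geometrically weighted sum
of the averages of \<open>|h|\<close> over cubes concentric with \<open>Q\<close> (\<open>local_oscillation\<close>). The part of \<open>h\<close> near \<open>Q\<close>
is handled by the weak type (1,1) bound (\<open>weak_type\<close>), the part far away by the smoothness of the kernel.
For \<open>h = f\<close> these averages are at most \<open>M\<^sup>2 f\<close>, and for \<open>h = (b - \<beta>\<^sub>Q) f\<close> at most
\<open>\<parallel>b\<parallel> M\<^sup>2 f\<close> up to a constant (\<open>tail_average_BMO\<close>).

Stopping at the exceptional points, and repeating, gives nested cubes \<open>R = Q\<^sub>0 \<supseteq> Q\<^sub>1 \<supseteq> \<dots>\<close>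
around almost every point; the cubes of the next generation fill at most half of each cube
(\<open>sparse_chain_exists\<close>). Following the changes of the numbers attached to consecutive cubes bounds the
commutator by a double sum \<open>\<Sum>\<^sub>k \<Sum>\<^sub>j\<^sub>\<le>\<^sub>k a\<^sub>j\<close> along the chain, where \<open>a\<^sub>j\<close> is nondecreasing and at most
\<open>\<parallel>b\<parallel> M\<^sup>2 f\<close> up to a constant (\<open>commutator_sparse_domination\<close>). The inner sum controls \<open>\<parallel>b\<parallel> |v|\<close>
and the outer one accumulates the jumps of \<open>b\<close>.

The weight enters only through the definition of its constant. As at least half of each cube \<open>P\<close> of the
chain is not covered by later cubes, the weights \<open>w(P)\<close> of all \<open>P \<subseteq> Q\<close> add up to at most
\<open>2 \<integral>\<^sub>Q M(w \<chi>\<^sub>Q) \<le> 2 [w] w(Q)\<close> (\<open>carleson_maximal\<close>). Summation by parts then shows that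
replacing a nondecreasing sequence by its partial sums along the chain multiplies the norm in \<open>L\<^sup>p(w)\<close>
by at most \<open>8 [w] max {1, p}\<close>, for every \<open>p > 0\<close> (\<open>cumulative_weighted_bound\<close>). Two such sums give the
factor \<open>[w]\<^sup>2 max {1, p\<^sup>2}\<close>. Truncating \<open>f\<close> to large cubes and Fatou's lemma pass to general \<open>f\<close>
(\<open>commutator_weighted\<close>).\<close>

section \<open>Dyadic cubes and stopping\<close>

text \<open>Half-open cubes are Borel sets, and rewriting their Lebesgue measure into Borel measure would
split every statement below into two normal forms.\<close>

declare emeasure_completion [simp del] measure_completion [simp del]

text \<open>A cube is recorded as the pair of its lower corner and its side. Half-open cubes form partitions;
the closed cube of the same pair, which has the same measure, is the one that occurs in averages.\<close>

type_synonym 'n node = "(real^'n) \<times> real"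

definition hcube :: "'n node \<Rightarrow> (real^'n) set" where
  "hcube Q = {x. \<forall>i. fst Q $ i \<le> x $ i \<and> x $ i < fst Q $ i + snd Q}"

lemma hcube_borel: "hcube Q \<in> sets borel"
proof -
  have "hcube Q = (\<Inter>i. {x. fst Q $ i \<le> x $ i} \<inter> {x. x $ i < fst Q $ i + snd Q})"
    by (auto simp: hcube_def)
  also have "\<dots> \<in> sets borel" by (measurable) 
  finally show ?thesis .
qed

lemma hcube_lebesgue [measurable]: "hcube Q \<in> sets lebesgue"
  by (rule sets_completionI_sets) (simp add: hcube_borel)

lemma emeasure_cbox_cube:
  fixes a :: "real^'n"
  assumes "0 \<le> l"
  shows "emeasure lebesgue (cbox a (a + vec l)) = ennreal (l ^ CARD('n))"
    and "emeasure lebesgue (box a (a + vec l)) = ennreal (l ^ CARD('n))"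
proof -
  have ne: "cbox a (a + vec l) \<noteq> {}" using assms by (auto simp: interval_ne_empty_cart)
  have c: "measure lborel (cbox a (a + vec l)) = l ^ CARD('n)"
    using content_cbox_cart[OF ne] by simp
  have "emeasure lborel (cbox a (a + vec l)) = ennreal (l ^ CARD('n))"
    using c emeasure_eq_ennreal_measure[of lborel "cbox a (a + vec l)"] emeasure_lborel_cbox_finite[of a "a + vec l"] by simp
  then show "emeasure lebesgue (cbox a (a + vec l)) = ennreal (l ^ CARD('n))" by (simp add: emeasure_completion)
  have "measure lborel (box a (a + vec l)) = measure lborel (cbox a (a + vec l))"
    by (simp add: measure_lborel_box_eq measure_lborel_cbox_eq)
  then show "emeasure lebesgue (box a (a + vec l)) = ennreal (l ^ CARD('n))"
    using c emeasure_eq_ennreal_measure[of lborel "box a (a + vec l)"] emeasure_lborel_box_finite[of a "a + vec l"] by (simp add: emeasure_completion)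
qed

lemma box_subset_hcube: "box (fst Q) (fst Q + vec (snd Q)) \<subseteq> hcube Q"
  by (auto simp: hcube_def mem_box_cart less_imp_le)

lemma hcube_subset_cbox: "hcube Q \<subseteq> cbox (fst Q) (fst Q + vec (snd Q))"
  by (auto simp: hcube_def mem_box_cart less_imp_le)

lemma emeasure_hcube:
  fixes Q :: "'n::finite node"
  assumes "0 \<le> snd Q"
  shows "emeasure lebesgue (hcube Q) = ennreal (snd Q ^ CARD('n))"
proof (rule antisym)
  show "emeasure lebesgue (hcube Q) \<le> ennreal (snd Q ^ CARD('n))"
    using emeasure_mono[OF hcube_subset_cbox, of Q lebesgue] emeasure_cbox_cube(1)[OF assms, of "fst Q"] by simp
  show "ennreal (snd Q ^ CARD('n)) \<le> emeasure lebesgue (hcube Q)"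
    using emeasure_mono[OF box_subset_hcube, of Q lebesgue] emeasure_cbox_cube(2)[OF assms, of "fst Q"] by simp
qed

definition closed_cube :: "'n::finite node \<Rightarrow> (real^'n) set" where
  "closed_cube Q = cbox (fst Q) (fst Q + vec (snd Q))"

lemma closed_cube_in_cubes: "0 < snd Q \<Longrightarrow> closed_cube Q \<in> cubes"
  by (auto simp: closed_cube_def cubes_def)

lemma AE_hcube_closed:
  fixes Q :: "'n::finite node"
  assumes "0 \<le> snd Q"
  shows "AE x in lebesgue. indicator (closed_cube Q) x = (indicator (hcube Q) x :: 'a::zero_neq_one)"
proof -
  have "emeasure lebesgue (closed_cube Q - hcube Q) = 0"
    using emeasure_cbox_cube(1)[OF assms, of "fst Q"] emeasure_hcube[OF assms] hcube_subset_cbox[of Q]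
    by (subst emeasure_Diff) (auto simp: closed_cube_def)
  then have "closed_cube Q - hcube Q \<in> null_sets lebesgue"
    by (intro null_setsI sets.Diff hcube_lebesgue) (auto simp: closed_cube_def)
  from AE_not_in[OF this] show ?thesis
    by eventually_elim (use hcube_subset_cbox[of Q] in \<open>auto simp: indicator_def closed_cube_def\<close>)
qed

lemma nn_integral_closed_cube:
  fixes Q :: "'n::finite node"
  assumes "0 \<le> snd Q"
  shows "(\<integral>\<^sup>+x\<in>closed_cube Q. g x \<partial>lebesgue) = (\<integral>\<^sup>+x\<in>hcube Q. g x \<partial>lebesgue)"
  by (rule nn_integral_cong_AE) (use AE_hcube_closed[OF assms, where 'a=ennreal] in \<open>auto elim!: eventually_mono\<close>)

lemma average_closed_cube:
  fixes Q :: "'n::finite node"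
  assumes "0 \<le> snd Q"
  shows "average (closed_cube Q) g = (\<integral>\<^sup>+x\<in>hcube Q. g x \<partial>lebesgue) / ennreal (snd Q ^ CARD('n))"
  unfolding average_def nn_integral_closed_cube[OF assms]
  using emeasure_cbox_cube(1)[OF assms, of "fst Q"] by (simp add: closed_cube_def)

text \<open>The cube of generation \<open>k\<close> in the dyadic grid of \<open>Q\<close> that contains \<open>x\<close>, found by rounding the
coordinates. Indexing the grid by points makes the tree structure a statement about rounding.\<close>

definition dyadic :: "'n::finite node \<Rightarrow> nat \<Rightarrow> real^'n \<Rightarrow> 'n node" where
  "dyadic Q k x = ((\<chi> i. fst Q $ i + snd Q / 2^k * real_of_int \<lfloor>(x $ i - fst Q $ i) * 2^k / snd Q\<rfloor>), snd Q / 2^k)"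

lemma snd_dyadic [simp]: "snd (dyadic Q k x) = snd Q / 2^k"
  by (simp add: dyadic_def)

lemma mem_hcube_dyadic_iff:
  assumes "0 < snd Q"
  shows "y \<in> hcube (dyadic Q k x) \<longleftrightarrow>
    (\<forall>i. \<lfloor>(y $ i - fst Q $ i) * 2^k / snd Q\<rfloor> = \<lfloor>(x $ i - fst Q $ i) * 2^k / snd Q\<rfloor>)"
proof -
  have "(fst Q $ i + snd Q / 2^k * real_of_int m \<le> y $ i \<and> y $ i < fst Q $ i + snd Q / 2^k * real_of_int m + snd Q/2^k)
     \<longleftrightarrow> \<lfloor>(y $ i - fst Q $ i) * 2^k / snd Q\<rfloor> = m" for i and m :: int
    using assms by (simp add: floor_eq_iff field_simps)
  then show ?thesis by (simp add: hcube_def dyadic_def)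
qed

lemma dyadic_mem: "0 < snd Q \<Longrightarrow> x \<in> hcube (dyadic Q k x)"
  by (simp add: mem_hcube_dyadic_iff)

text \<open>Rounding to a coarser grid factors through rounding to a finer one, so points of one small
cube have the same ancestors.\<close>

lemma dyadic_eq:
  fixes Q :: "'n::finite node"
  assumes "0 < snd Q" "y \<in> hcube (dyadic Q k x)" "j \<le> k"
  shows "dyadic Q j y = dyadic Q j x"
proof -
  have "\<lfloor>(y $ i - fst Q $ i) * 2^j / snd Q\<rfloor> = \<lfloor>(x $ i - fst Q $ i) * 2^j / snd Q\<rfloor>" for i
  proof -
    have *: "\<lfloor>(z $ i - fst Q $ i) * 2^j / snd Q\<rfloor> = \<lfloor>(z $ i - fst Q $ i) * 2^k / snd Q\<rfloor> div 2^(k-j)" for z :: "real^'n"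
    proof -
      have "(2::real)^k = 2^j * 2^(k-j)" using assms(3) by (simp flip: power_add)
      then have "(z $ i - fst Q $ i) * 2^j / snd Q = (z $ i - fst Q $ i) * 2^k / snd Q / real_of_int (2^(k-j))"
        by simp
      then show ?thesis by (simp only: floor_divide_real_eq_div zero_le_power zero_le_numeral)
    qed
    show ?thesis using assms(2) by (simp add: * mem_hcube_dyadic_iff[OF assms(1)])
  qed
  then show ?thesis by (simp add: dyadic_def)
qed

lemma dyadic_subset:
  fixes Q :: "'n::finite node"
  assumes "0 < snd Q" "j \<le> k"
  shows "hcube (dyadic Q k x) \<subseteq> hcube (dyadic Q j x)"
proof
  fix y assume "y \<in> hcube (dyadic Q k x)"
  from dyadic_eq[OF assms(1) this assms(2)] dyadic_mem[OF assms(1), of y j]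
  show "y \<in> hcube (dyadic Q j x)" by simp
qed

lemma dyadic_0:
  assumes "0 < snd Q" "x \<in> hcube Q"
  shows "dyadic Q 0 x = Q"
proof -
  have "\<lfloor>(x $ i - fst Q $ i) / snd Q\<rfloor> = 0" for i
    using assms by (auto simp: hcube_def floor_eq_iff field_simps)
  then show ?thesis by (simp add: dyadic_def prod_eq_iff vec_eq_iff)
qed

lemma countable_dyadic:
  fixes Q :: "'n::finite node"
  shows "countable {dyadic Q k x | k x. True}"
proof -
  have "{dyadic Q k x | k x. True} \<subseteq> (\<lambda>(k, m :: int^'n). ((\<chi> i. fst Q $ i + snd Q / 2^k * real_of_int (m $ i)), snd Q / 2^k)) ` UNIV"
  proof
    fix P assume "P \<in> {dyadic Q k x | k x. True}"
    then obtain k and x :: "real^'n" where P: "P = dyadic Q k x" by blast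
    show "P \<in> range (\<lambda>(k, m :: int^'n). ((\<chi> i. fst Q $ i + snd Q / 2^k * real_of_int (m $ i)), snd Q / 2^k))"
      by (rule image_eqI[where x="(k, \<chi> i. \<lfloor>(x $ i - fst Q $ i) * 2^k / snd Q\<rfloor>)"]) (auto simp: dyadic_def P)
  qed
  then show ?thesis by (rule countable_subset) auto
qed

lemma dist_hcube:
  fixes x y :: "real^'n"
  assumes "x \<in> hcube Q" "y \<in> hcube Q"
  shows "dist x y \<le> real CARD('n) * snd Q"
proof -
  have "norm (x - y) \<le> (\<Sum>i\<in>UNIV. \<bar>(x - y) $ i\<bar>)" by (rule norm_le_l1_cart)
  also have "\<dots> \<le> (\<Sum>i\<in>(UNIV::'n set). snd Q)"
  proof (rule sum_mono)
    fix i :: 'n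
    have "fst Q $ i \<le> x $ i \<and> x $ i < fst Q $ i + snd Q" "fst Q $ i \<le> y $ i \<and> y $ i < fst Q $ i + snd Q"
      using assms by (auto simp: hcube_def)
    then show "\<bar>(x - y) $ i\<bar> \<le> snd Q" by (simp add: abs_le_iff)
  qed
  finally show ?thesis by (simp add: dist_norm)
qed

lemma dyadic_in_open:
  fixes x :: "real^'n"
  assumes "0 < snd Q" "open U" "x \<in> U"
  shows "\<exists>k. hcube (dyadic Q k x) \<subseteq> U"
proof -
  obtain e where e: "0 < e" "ball x e \<subseteq> U" using assms(2,3) open_contains_ball by blast
  have "\<exists>k. (1/2)^k < e / (real CARD('n) * snd Q)"
    using e assms by (intro real_arch_pow_inv) auto
  then obtain k where k: "(1/2)^k < e / (real CARD('n) * snd Q)" by blast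
  have "hcube (dyadic Q k x) \<subseteq> ball x e"
  proof
    fix y assume "y \<in> hcube (dyadic Q k x)"
    then have "dist x y \<le> real CARD('n) * (snd Q / 2^k)"
      using dist_hcube[OF dyadic_mem[OF assms(1)], of y k x] by simp
    also have "\<dots> < e" using k assms(1) e(1) by (simp add: field_simps power_one_over)
    finally show "y \<in> ball x e" by simp
  qed
  with e show ?thesis by blast
qed

text \<open>A point is selected if some dyadic cube around it satisfies \<open>\<Phi>\<close>. The first generation at which
this happens belongs to the largest such cube, and these largest cubes partition the selected points.\<close>

definition selected :: "('n::finite node \<Rightarrow> bool) \<Rightarrow> 'n node \<Rightarrow> real^'n \<Rightarrow> bool" where
  "selected \<Phi> Q x \<longleftrightarrow> x \<in> hcube Q \<and> (\<exists>k. \<Phi> (dyadic Q k x))"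

definition maximal_cube :: "('n::finite node \<Rightarrow> bool) \<Rightarrow> 'n node \<Rightarrow> real^'n \<Rightarrow> 'n node" where
  "maximal_cube \<Phi> Q x = dyadic Q (LEAST k. \<Phi> (dyadic Q k x)) x"

lemma maximal_cube_satisfies: "selected \<Phi> Q x \<Longrightarrow> \<Phi> (maximal_cube \<Phi> Q x)"
  unfolding selected_def maximal_cube_def by (metis (mono_tags, lifting) LeastI_ex)

lemma maximal_cube_mem: "0 < snd Q \<Longrightarrow> x \<in> hcube (maximal_cube \<Phi> Q x)"
  by (simp add: maximal_cube_def dyadic_mem)

lemma maximal_cube_subset: "0 < snd Q \<Longrightarrow> x \<in> hcube Q \<Longrightarrow> hcube (maximal_cube \<Phi> Q x) \<subseteq> hcube Q"
  unfolding maximal_cube_def by (metis dyadic_0 dyadic_subset le0)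

text \<open>All points of the cube share its ancestors, so their first generations agree as well. This gives
the disjointness of the maximal cubes.\<close>

lemma maximal_cube_eq:
  assumes "0 < snd Q" "selected \<Phi> Q x" "y \<in> hcube (maximal_cube \<Phi> Q x)"
  shows "selected \<Phi> Q y \<and> maximal_cube \<Phi> Q y = maximal_cube \<Phi> Q x"
proof -
  define k where "k = (LEAST k. \<Phi> (dyadic Q k x))"
  have Pk: "\<Phi> (dyadic Q k x)" using maximal_cube_satisfies[OF assms(2)] by (simp add: k_def maximal_cube_def)
  have eq: "dyadic Q j y = dyadic Q j x" if "j \<le> k" for j
    using dyadic_eq[OF assms(1) _ that] assms(3) by (simp add: maximal_cube_def k_def)
  have "(LEAST j. \<Phi> (dyadic Q j y)) = k"
  proof (rule Least_equality)
    show "\<Phi> (dyadic Q k y)" using Pk eq by simp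
    fix j assume "\<Phi> (dyadic Q j y)"
    show "k \<le> j"
    proof (rule ccontr)
      assume "\<not> k \<le> j"
      then have "\<Phi> (dyadic Q j x)" using eq[of j] \<open>\<Phi> (dyadic Q j y)\<close> by simp
      then have "k \<le> j" unfolding k_def by (rule Least_le)
      then show False using \<open>\<not> k \<le> j\<close> by simp
    qed
  qed
  moreover have "y \<in> hcube Q" using maximal_cube_subset[OF assms(1)] assms(2,3) by (auto simp: selected_def)
  ultimately show ?thesis using Pk eq[of k] by (auto simp: maximal_cube_def selected_def simp flip: k_def intro!: exI[of _ k])
qed

text \<open>By maximality the dyadic parent fails \<open>\<Phi>\<close>; this is what bounds averages over a stopping cube
from above.\<close>

lemma maximal_cube_parent:
  assumes "0 < snd Q" "selected \<Phi> Q x" "\<not> \<Phi> Q"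
  obtains P where "\<not> \<Phi> P" "hcube (maximal_cube \<Phi> Q x) \<subseteq> hcube P" "snd P = 2 * snd (maximal_cube \<Phi> Q x)"
proof -
  define k where "k = (LEAST k. \<Phi> (dyadic Q k x))"
  have Pk: "\<Phi> (dyadic Q k x)" using maximal_cube_satisfies[OF assms(2)] by (simp add: k_def maximal_cube_def)
  have x: "x \<in> hcube Q" using assms(2) by (simp add: selected_def)
  have "k \<noteq> 0" using Pk assms(3) dyadic_0[OF assms(1) x] by metis
  then obtain j where j: "k = Suc j" by (cases k) auto
  have "\<not> \<Phi> (dyadic Q j x)" using not_less_Least[of j "\<lambda>k. \<Phi> (dyadic Q k x)"] j by (simp add: k_def)
  moreover have "hcube (dyadic Q k x) \<subseteq> hcube (dyadic Q j x)" using dyadic_subset[OF assms(1)] j by auto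
  ultimately show ?thesis using that[of "dyadic Q j x"] j by (simp add: maximal_cube_def k_def[symmetric])
qed

definition maximal_cubes :: "('n::finite node \<Rightarrow> bool) \<Rightarrow> 'n node \<Rightarrow> 'n node set" where
  "maximal_cubes \<Phi> Q = maximal_cube \<Phi> Q ` {x. selected \<Phi> Q x}"

lemma countable_maximal_cubes: "countable (maximal_cubes \<Phi> Q)"
  by (rule countable_subset[OF _ countable_dyadic[of Q]]) (auto simp: maximal_cube_def maximal_cubes_def)

text \<open>Inequalities between integrals over countably many disjoint sets add up. Passing to densities turns
this into countable additivity of a measure.\<close>

lemma nn_integral_UN_mono:
  fixes f g :: "'a \<Rightarrow> ennreal"
  assumes I: "countable I" and X: "\<And>i. i \<in> I \<Longrightarrow> X i \<in> sets M" and d: "disjoint_family_on X I"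
    and f: "f \<in> borel_measurable M" and g: "g \<in> borel_measurable M"
    and le: "\<And>i. i \<in> I \<Longrightarrow> (\<integral>\<^sup>+x\<in>X i. f x \<partial>M) \<le> (\<integral>\<^sup>+x\<in>X i. g x \<partial>M)"
  shows "(\<integral>\<^sup>+x\<in>(\<Union>i\<in>I. X i). f x \<partial>M) \<le> (\<integral>\<^sup>+x\<in>(\<Union>i\<in>I. X i). g x \<partial>M)"
proof -
  have U: "(\<Union>i\<in>I. X i) \<in> sets M" using I X by (intro sets.countable_UN') auto
  have *: "(\<integral>\<^sup>+x\<in>(\<Union>i\<in>I. X i). h x \<partial>M) = (\<integral>\<^sup>+i. (\<integral>\<^sup>+x\<in>X i. h x \<partial>M) \<partial>count_space I)"
    if h: "h \<in> borel_measurable M" for h :: "'a \<Rightarrow> ennreal"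
  proof -
    have "(\<integral>\<^sup>+x\<in>(\<Union>i\<in>I. X i). h x \<partial>M) = emeasure (density M h) (\<Union>i\<in>I. X i)"
      using h U by (simp add: emeasure_density)
    also have "\<dots> = (\<integral>\<^sup>+i. emeasure (density M h) (X i) \<partial>count_space I)"
      using X I d by (intro emeasure_UN_countable) auto
    also have "\<dots> = (\<integral>\<^sup>+i. (\<integral>\<^sup>+x\<in>X i. h x \<partial>M) \<partial>count_space I)"
      using h X by (intro nn_integral_cong) (simp add: emeasure_density)
    finally show ?thesis .
  qed
  show ?thesis unfolding *[OF f] *[OF g]
    by (rule nn_integral_mono) (use le in simp)
qed

section \<open>Sparse chains of cubes\<close>

lemma maximal_cubesE:
  assumes "P \<in> maximal_cubes \<Phi> Q"
  obtains x where "selected \<Phi> Q x" "P = maximal_cube \<Phi> Q x"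
  using assms by (auto simp: maximal_cubes_def)

lemma selected_eq_Union:
  fixes Q :: "'n::finite node"
  assumes "0 < snd Q"
  shows "{x. selected \<Phi> Q x} = (\<Union>P\<in>maximal_cubes \<Phi> Q. hcube P)"
proof (intro set_eqI iffI)
  fix x assume "x \<in> {x. selected \<Phi> Q x}"
  then have "maximal_cube \<Phi> Q x \<in> maximal_cubes \<Phi> Q" by (auto simp: maximal_cubes_def)
  then show "x \<in> (\<Union>P\<in>maximal_cubes \<Phi> Q. hcube P)"
    by (rule UN_I) (rule maximal_cube_mem[OF assms])
next
  fix x assume "x \<in> (\<Union>P\<in>maximal_cubes \<Phi> Q. hcube P)"
  then obtain P where P: "P \<in> maximal_cubes \<Phi> Q" "x \<in> hcube P" by (rule UN_E)
  from P(1) obtain z where "selected \<Phi> Q z" "P = maximal_cube \<Phi> Q z" by (rule maximal_cubesE)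
  with P(2) show "x \<in> {x. selected \<Phi> Q x}" using maximal_cube_eq[OF assms, of \<Phi> z x] by simp
qed

lemma disjoint_maximal_cubes:
  fixes Q :: "'n::finite node"
  assumes "0 < snd Q"
  shows "disjoint_family_on hcube (maximal_cubes \<Phi> Q)"
  unfolding disjoint_family_on_def
proof (intro ballI impI)
  fix P P' assume P: "P \<in> maximal_cubes \<Phi> Q" "P' \<in> maximal_cubes \<Phi> Q" "P \<noteq> P'"
  obtain x where x: "selected \<Phi> Q x" "P = maximal_cube \<Phi> Q x" using P(1) by (rule maximal_cubesE)
  obtain x' where x': "selected \<Phi> Q x'" "P' = maximal_cube \<Phi> Q x'" using P(2) by (rule maximal_cubesE)
  show "hcube P \<inter> hcube P' = {}"
  proof (rule ccontr)
    assume "hcube P \<inter> hcube P' \<noteq> {}"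
    then obtain y where y: "y \<in> hcube P" "y \<in> hcube P'" by blast
    have "maximal_cube \<Phi> Q y = P" "maximal_cube \<Phi> Q y = P'"
      using maximal_cube_eq[OF assms x(1), of y] maximal_cube_eq[OF assms x'(1), of y] x(2) x'(2) y by simp_all
    then show False using P(3) by simp
  qed
qed

lemma selected_measurable [measurable]:
  assumes "0 < snd Q"
  shows "{x. selected \<Phi> Q x} \<in> sets lebesgue"
  unfolding selected_eq_Union[OF assms] by (intro sets.countable_UN' countable_maximal_cubes) auto

lemma maximal_cubes_snd_pos: "0 < snd Q \<Longrightarrow> P \<in> maximal_cubes \<Phi> Q \<Longrightarrow> 0 < snd P"
  by (auto simp: maximal_cube_def maximal_cubes_def)

lemma emeasure_selected_le:
  assumes Q: "0 < snd Q" and g: "g \<in> borel_measurable lebesgue"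
    and le: "\<And>P. \<Phi> P \<Longrightarrow> 0 < snd P \<Longrightarrow> emeasure lebesgue (hcube P) \<le> (\<integral>\<^sup>+x\<in>hcube P. g x \<partial>lebesgue)"
  shows "emeasure lebesgue {x. selected \<Phi> Q x} \<le> (\<integral>\<^sup>+x\<in>{x. selected \<Phi> Q x}. g x \<partial>lebesgue)"
proof -
  have "(\<integral>\<^sup>+x\<in>{x. selected \<Phi> Q x}. 1 \<partial>lebesgue) \<le> (\<integral>\<^sup>+x\<in>{x. selected \<Phi> Q x}. g x \<partial>lebesgue)"
    unfolding selected_eq_Union[OF Q]
  proof (rule nn_integral_UN_mono[OF countable_maximal_cubes _ disjoint_maximal_cubes[OF Q] _ g])
    fix P assume P: "P \<in> maximal_cubes \<Phi> Q"
    then show "(\<integral>\<^sup>+x\<in>hcube P. 1 \<partial>lebesgue) \<le> (\<integral>\<^sup>+x\<in>hcube P. g x \<partial>lebesgue)"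
      using le[of P] maximal_cubes_snd_pos[OF Q P] maximal_cube_satisfies[of \<Phi> Q] by (auto elim!: maximal_cubesE)
  qed auto
  then show ?thesis using Q by simp
qed

text \<open>A sparse family of cubes, described from the points: \<open>ch k x\<close> is the cube of generation \<open>k\<close> around
\<open>x\<close>, or nothing if the chain of \<open>x\<close> has stopped before. The last assumption is sparseness: the next
generation fills at most half of each cube.\<close>

locale sparse_chain =
  fixes R :: "'n::finite node" and ch :: "nat \<Rightarrow> real^'n \<Rightarrow> 'n node option"
  assumes root: "ch 0 x = (if x \<in> hcube R then Some R else None)"
    and stopped: "ch k x = None \<Longrightarrow> ch (Suc k) x = None"
    and member: "ch k x = Some Q \<Longrightarrow> 0 < snd Q \<and> x \<in> hcube Q \<and> (\<forall>y\<in>hcube Q. ch k y = Some Q)"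
    and nested: "ch k x = Some Q \<Longrightarrow> ch (Suc k) x = Some P \<Longrightarrow> hcube P \<subseteq> hcube Q"
    and countable_nodes: "countable {Q. \<exists>x. ch k x = Some Q}"
    and half: "ch k x = Some Q \<Longrightarrow>
      2 * emeasure lebesgue (hcube Q \<inter> {y. ch (Suc k) y \<noteq> None}) \<le> emeasure lebesgue (hcube Q)"

text \<open>Stopping again inside each stopping cube, with a criterion that may depend on that cube.\<close>

primrec iterate_child :: "('n::finite node \<Rightarrow> real^'n \<Rightarrow> 'n node option) \<Rightarrow> 'n node \<Rightarrow> nat \<Rightarrow> real^'n \<Rightarrow> 'n node option" where
  "iterate_child child R 0 x = (if x \<in> hcube R then Some R else None)"
| "iterate_child child R (Suc k) x = (case iterate_child child R k x of None \<Rightarrow> None | Some Q \<Rightarrow> child Q x)"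

lemma measure_hcube:
  fixes Q :: "'n::finite node"
  shows "0 \<le> snd Q \<Longrightarrow> measure lebesgue (hcube Q) = snd Q ^ CARD('n)"
  by (simp add: emeasure_hcube measure_def)

lemma hcube_lmeasurable [simp]:
  fixes Q :: "'n::finite node"
  shows "0 \<le> snd Q \<Longrightarrow> hcube Q \<in> lmeasurable"
  by (rule fmeasurableI) (auto simp: emeasure_hcube)

text \<open>Sparse chains adapted to exceptional sets. Each set \<open>Bad Q\<close> is enlarged to an open set \<open>U Q\<close>, still
small, and the children of \<open>Q\<close> are its maximal dyadic subcubes \<open>P\<close> in which \<open>U Q\<close> has density above
\<open>2 powr -(n+2)\<close>. As \<open>U Q\<close> is open, every bad point lies in a small cube inside \<open>U Q\<close> and so in a child. By
maximality the density of \<open>U Q\<close> in a child is at most \<open>2\<^sup>n\<close> times the threshold, that is \<open>1/4\<close>; as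
\<open>Bad P\<close> is small in \<open>P\<close> too, some point of \<open>P\<close> is good both for \<open>Q\<close> and for \<open>P\<close>. Such a point allows
quantities attached to \<open>Q\<close> and \<open>P\<close> to be compared.\<close>

lemma sparse_chain_exists:
  fixes R :: "'n::finite node" and Bad :: "'n node \<Rightarrow> (real^'n) set"
  assumes R: "0 < snd R"
    and meas: "\<And>Q. 0 < snd Q \<Longrightarrow> Bad Q \<in> sets lebesgue"
    and sub: "\<And>Q. 0 < snd Q \<Longrightarrow> Bad Q \<subseteq> hcube Q"
    and small: "\<And>Q. 0 < snd Q \<Longrightarrow>
      measure lebesgue (Bad Q) \<le> measure lebesgue (hcube Q) / 2 ^ (CARD('n) + 4)"
  obtains ch where "sparse_chain R ch"
    and "\<And>k x Q. ch k x = Some Q \<Longrightarrow> ch (Suc k) x = None \<Longrightarrow> x \<notin> Bad Q"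
    and "\<And>k x Q P. ch k x = Some Q \<Longrightarrow> ch (Suc k) x = Some P \<Longrightarrow> \<exists>y\<in>hcube P. y \<notin> Bad Q \<and> y \<notin> Bad P"
proof -
  define n where "n = CARD('n)"
  let ?\<mu> = "measure (lebesgue :: (real^'n) measure)"
  have pos: "?\<mu> (hcube Q) > 0" if "0 < snd Q" for Q :: "'n node"
    using that by (simp add: measure_hcube)
  have "\<exists>U. open U \<and> Bad Q \<subseteq> U \<and> U \<in> lmeasurable \<and> ?\<mu> U \<le> ?\<mu> (hcube Q) / 2 ^ (n + 3)" if Q: "0 < snd Q" for Q
  proof -
    define e where "e = ?\<mu> (hcube Q) / 2 ^ (n + 4)"
    have "e > 0" using pos[OF Q] by (simp add: e_def)
    then obtain U where U: "open U" "Bad Q \<subseteq> U" "U - Bad Q \<in> lmeasurable" "emeasure lebesgue (U - Bad Q) < ennreal e"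
      using sets_lebesgue_outer_open[OF meas[OF Q]] by blast
    have B: "Bad Q \<in> lmeasurable"
      using Q by (intro fmeasurableI2[OF hcube_lmeasurable sub meas]) auto
    have "U = Bad Q \<union> (U - Bad Q)" using U by auto
    then have UL: "U \<in> lmeasurable" using B U(3) by (metis fmeasurable.Un)
    have "?\<mu> U = ?\<mu> (Bad Q) + ?\<mu> (U - Bad Q)"
      using measurable_measure_Diff[OF UL fmeasurableD[OF B] U(2)] by simp
    moreover have "?\<mu> (U - Bad Q) \<le> e"
      using U(3,4) \<open>e > 0\<close> by (simp add: emeasure_eq_measure2 ennreal_less_iff)
    moreover have "?\<mu> (Bad Q) \<le> e" using small[OF Q] by (simp add: e_def n_def)
    moreover have "e + e = ?\<mu> (hcube Q) / 2 ^ (n + 3)" by (simp add: e_def power_add)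
    ultimately show ?thesis using U UL by auto
  qed
  then obtain U where U: "\<And>Q. 0 < snd Q \<Longrightarrow> open (U Q)" "\<And>Q. 0 < snd Q \<Longrightarrow> Bad Q \<subseteq> U Q"
    "\<And>Q. 0 < snd Q \<Longrightarrow> U Q \<in> lmeasurable"
    "\<And>Q. 0 < snd Q \<Longrightarrow> ?\<mu> (U Q) \<le> ?\<mu> (hcube Q) / 2 ^ (n + 3)" by metis
  define \<Phi> where "\<Phi> Q P \<longleftrightarrow> ?\<mu> (hcube P \<inter> U Q) > ?\<mu> (hcube P) / 2 ^ (n + 2)" for Q P
  define child where "child Q x = (if selected (\<Phi> Q) Q x then Some (maximal_cube (\<Phi> Q) Q x) else None)" for Q x
  define ch where "ch = iterate_child child R"
  have nroot: "\<not> \<Phi> Q Q" if Q: "0 < snd Q" for Q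
  proof -
    have "?\<mu> (hcube Q \<inter> U Q) \<le> ?\<mu> (U Q)" using U(3)[OF Q] by (intro measure_mono_fmeasurable) auto
    also have "\<dots> \<le> ?\<mu> (hcube Q) / 2 ^ (n + 3)" by (rule U(4)[OF Q])
    also have "\<dots> \<le> ?\<mu> (hcube Q) / 2 ^ (n + 2)" using pos[OF Q] by (intro divide_left_mono) (auto simp: power_add)
    finally show ?thesis by (simp add: \<Phi>_def)
  qed
  have mem: "0 < snd Q \<and> x \<in> hcube Q \<and> (\<forall>y\<in>hcube Q. ch k y = Some Q)" if "ch k x = Some Q" for k x Q
    using that
  proof (induction k arbitrary: x Q)
    case 0 then show ?case using R by (auto simp: ch_def split: if_splits)
  next
    case (Suc k)
    from Suc.prems obtain P where P: "ch k x = Some P" "child P x = Some Q" by (auto simp: ch_def split: option.splits)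
    from Suc.IH[OF P(1)] have IH: "0 < snd P" "\<And>y. y \<in> hcube P \<Longrightarrow> ch k y = Some P" by auto
    have sel: "selected (\<Phi> P) P x" and Qeq: "Q = maximal_cube (\<Phi> P) P x"
      using P(2) by (auto simp: child_def split: if_splits)
    have sub: "hcube Q \<subseteq> hcube P" using maximal_cube_subset[OF IH(1)] sel Qeq by (auto simp: selected_def)
    have "ch (Suc k) y = Some Q" if "y \<in> hcube Q" for y
    proof -
      have "ch k y = Some P" using sub that by (intro IH(2)) auto
      moreover have "selected (\<Phi> P) P y" "maximal_cube (\<Phi> P) P y = Q"
        using maximal_cube_eq[OF IH(1) sel, of y] that Qeq by simp_all
      ultimately show ?thesis by (simp add: ch_def child_def)
    qed
    moreover have "x \<in> hcube Q" unfolding Qeq by (rule maximal_cube_mem[OF IH(1)])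
    moreover have "0 < snd Q" using IH(1) by (simp add: Qeq maximal_cube_def)
    ultimately show ?case by blast
  qed
  have step: "selected (\<Phi> Q) Q x \<and> P = maximal_cube (\<Phi> Q) Q x" if "ch k x = Some Q" "ch (Suc k) x = Some P" for k x Q P
    using that by (auto simp: ch_def child_def split: if_splits)
  have nest: "hcube P \<subseteq> hcube Q" if "ch k x = Some Q" "ch (Suc k) x = Some P" for k x Q P
    using step[OF that] mem[OF that(1)] maximal_cube_subset by blast
  have cnt: "countable {Q. \<exists>x. ch k x = Some Q}" for k
  proof (induction k)
    case 0
    have "{Q. \<exists>x. ch 0 x = Some Q} \<subseteq> {R}" by (auto simp: ch_def split: if_splits)
    then show ?case by (rule countable_subset) auto
  next
    case (Suc k)
    have "{Q. \<exists>x. ch (Suc k) x = Some Q} \<subseteq> (\<Union>P\<in>{Q. \<exists>x. ch k x = Some Q}. maximal_cubes (\<Phi> P) P)"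
    proof
      fix Q assume "Q \<in> {Q. \<exists>x. ch (Suc k) x = Some Q}"
      then obtain x where x: "ch (Suc k) x = Some Q" by auto
      then obtain P where P: "ch k x = Some P" by (auto simp: ch_def split: option.splits)
      with step[OF P x] have "Q \<in> maximal_cubes (\<Phi> P) P" by (auto simp: maximal_cubes_def)
      with P show "Q \<in> (\<Union>P\<in>{Q. \<exists>x. ch k x = Some Q}. maximal_cubes (\<Phi> P) P)"
        by (intro UN_I[of P]) auto
    qed
    then show ?case by (rule countable_subset) (intro countable_UN Suc countable_maximal_cubes)
  qed
  have half: "2 * emeasure lebesgue (hcube Q \<inter> {y. ch (Suc k) y \<noteq> None}) \<le> emeasure lebesgue (hcube Q)"
    if Qx: "ch k x = Some Q" for k x Q
  proof -
    have Q: "0 < snd Q" using mem[OF Qx] by auto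
    have eq: "hcube Q \<inter> {y. ch (Suc k) y \<noteq> None} = {y. selected (\<Phi> Q) Q y}"
      using mem[OF Qx] by (auto simp: ch_def child_def selected_def split: if_splits)
    have UL [measurable]: "U Q \<in> sets lebesgue" using U(3)[OF Q] by (auto simp: fmeasurable_def)
    have "emeasure lebesgue {y. selected (\<Phi> Q) Q y} \<le>
       (\<integral>\<^sup>+y\<in>{y. selected (\<Phi> Q) Q y}. ennreal (2 ^ (n+2)) * indicator (U Q) y \<partial>lebesgue)"
    proof (rule emeasure_selected_le[OF Q])
      fix P assume P: "\<Phi> Q P" "0 < snd P"
      have m: "hcube P \<inter> U Q \<in> lmeasurable" using P by (intro fmeasurable.Int hcube_lmeasurable U(3) Q) auto
      have "(\<integral>\<^sup>+x\<in>hcube P. ennreal (2 ^ (n+2)) * indicator (U Q) x \<partial>lebesgue) =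
         (\<integral>\<^sup>+x. ennreal (2 ^ (n+2)) * indicator (hcube P \<inter> U Q) x \<partial>lebesgue)"
        by (intro nn_integral_cong) (auto simp: indicator_def)
      also have "\<dots> = ennreal (2^(n+2)) * emeasure lebesgue (hcube P \<inter> U Q)"
        by (subst nn_integral_cmult_indicator) auto
      also have "\<dots> = ennreal (2^(n+2) * ?\<mu> (hcube P \<inter> U Q))"
        using m by (simp add: emeasure_eq_measure2 ennreal_mult)
      also have "\<dots> \<ge> ennreal (?\<mu> (hcube P))"
        using P(1) by (intro ennreal_leI) (simp add: \<Phi>_def field_simps)
      finally show "emeasure lebesgue (hcube P) \<le> (\<integral>\<^sup>+x\<in>hcube P. ennreal (2 ^ (n+2)) * indicator (U Q) x \<partial>lebesgue)"
        using P(2) hcube_lmeasurable[of P] by (simp add: emeasure_eq_measure2)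
    qed measurable
    also have "\<dots> \<le> (\<integral>\<^sup>+y. ennreal (2 ^ (n+2)) * indicator (U Q) y \<partial>lebesgue)"
      by (intro nn_integral_mono) (auto simp: indicator_def)
    also have "\<dots> = ennreal (2 ^ (n+2) * ?\<mu> (U Q))"
      using U(3)[OF Q] by (subst nn_integral_cmult_indicator) (auto simp: emeasure_eq_measure2 ennreal_mult)
    finally have "2 * emeasure lebesgue {y. selected (\<Phi> Q) Q y} \<le> 2 * ennreal (2 ^ (n+2) * ?\<mu> (U Q))"
      by (rule mult_left_mono) auto
    also have "\<dots> = ennreal (2 ^ (n+3) * ?\<mu> (U Q))"
      by (simp add: power_add flip: ennreal_numeral ennreal_mult)
    also have "\<dots> \<le> ennreal (?\<mu> (hcube Q))"
      using U(4)[OF Q] by (intro ennreal_leI) (simp add: field_simps)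
    also have "\<dots> = emeasure lebesgue (hcube Q)" using Q hcube_lmeasurable[of Q] by (simp add: emeasure_eq_measure2)
    finally show ?thesis unfolding eq .
  qed
  have ch0: "ch 0 x = (if x \<in> hcube R then Some R else None)" for x by (simp add: ch_def)
  have chN: "ch (Suc k) x = None" if "ch k x = None" for k x using that by (simp add: ch_def)
  have sp: "sparse_chain R ch"
    by (rule sparse_chain.intro; fact ch0 chN mem nest cnt half)
  moreover have "x \<notin> Bad Q" if "ch k x = Some Q" "ch (Suc k) x = None" for k x Q
  proof
    assume x: "x \<in> Bad Q"
    have Q: "0 < snd Q" "x \<in> hcube Q" using mem[OF that(1)] by auto
    have "x \<in> U Q" using U(2)[OF Q(1)] x by auto
    then obtain j where j: "hcube (dyadic Q j x) \<subseteq> U Q" using dyadic_in_open[OF Q(1) U(1)[OF Q(1)]] by blast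
    then have "hcube (dyadic Q j x) \<inter> U Q = hcube (dyadic Q j x)" by auto
    moreover have "?\<mu> (hcube (dyadic Q j x)) > 0" using Q by (intro pos) auto
    moreover have "m / 2 ^ (n+2) < m" if "m > 0" for m :: real
    proof -
      have "(1::real) < 2^(n+2)" by (rule one_less_power) auto
      then show ?thesis using that by (simp add: divide_less_eq del: power_Suc power_add)
    qed
    ultimately have "\<Phi> Q (dyadic Q j x)" by (simp add: \<Phi>_def)
    then have "selected (\<Phi> Q) Q x" using Q by (auto simp: selected_def)
    then show False using that by (auto simp: ch_def child_def)
  qed
  moreover have "\<exists>y\<in>hcube P. y \<notin> Bad Q \<and> y \<notin> Bad P" if ch: "ch k x = Some Q" "ch (Suc k) x = Some P" for k x Q P
  proof (rule ccontr)
    assume "\<not> ?thesis"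
    then have cov: "hcube P \<subseteq> (hcube P \<inter> Bad Q) \<union> Bad P" by auto
    have Q: "0 < snd Q" and P: "0 < snd P" using mem ch by blast+
    have sel: "selected (\<Phi> Q) Q x" "P = maximal_cube (\<Phi> Q) Q x" using step[OF ch] by auto
    obtain P' where P': "\<not> \<Phi> Q P'" "hcube P \<subseteq> hcube P'" "snd P' = 2 * snd P"
      using maximal_cube_parent[OF Q sel(1) nroot[OF Q]] sel(2) by metis
    have "?\<mu> (hcube P \<inter> Bad Q) \<le> ?\<mu> (hcube P' \<inter> U Q)"
      using P P' U(2)[OF Q] U(3)[OF Q] meas[OF Q]
      by (intro measure_mono_fmeasurable) (auto intro!: fmeasurable.Int)
    also have "\<dots> \<le> ?\<mu> (hcube P') / 2 ^ (n+2)" using P'(1) by (simp add: \<Phi>_def)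
    also have "\<dots> = ?\<mu> (hcube P) / 4"
      using P P'(3) by (simp add: measure_hcube n_def power_mult_distrib power_add)
    finally have 1: "?\<mu> (hcube P \<inter> Bad Q) \<le> ?\<mu> (hcube P) / 4" .
    have 2: "?\<mu> (Bad P) \<le> ?\<mu> (hcube P) / 4"
    proof -
      have "?\<mu> (Bad P) \<le> ?\<mu> (hcube P) / 2 ^ (CARD('n) + 4)" by (rule small[OF P])
      also have "\<dots> \<le> ?\<mu> (hcube P) / 2 ^ 2"
        by (intro divide_left_mono power_increasing) auto
      finally show ?thesis by simp
    qed
    have BP: "Bad P \<in> lmeasurable" using P by (intro fmeasurableI2[OF hcube_lmeasurable sub meas]) auto
    have BQ: "hcube P \<inter> Bad Q \<in> lmeasurable" using P Q meas[OF Q] by (intro fmeasurable_Int_fmeasurable) auto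
    have "?\<mu> (hcube P) \<le> ?\<mu> ((hcube P \<inter> Bad Q) \<union> Bad P)"
      using cov BP BQ by (intro measure_mono_fmeasurable) auto
    also have "\<dots> \<le> ?\<mu> (hcube P \<inter> Bad Q) + ?\<mu> (Bad P)"
      using BP BQ by (intro measure_Un_le) auto
    also have "\<dots> \<le> ?\<mu> (hcube P) / 2" using 1 2 by simp
    finally show False using pos[OF P] by simp
  qed
  ultimately show ?thesis by (rule that)
qed

lemma average_mult_emeasure:
  fixes Q :: "'n::finite node"
  assumes "0 < snd Q"
  shows "average (closed_cube Q) g * emeasure lebesgue (hcube Q) = (\<integral>\<^sup>+x\<in>hcube Q. g x \<partial>lebesgue)"
  using assms by (simp add: average_closed_cube emeasure_hcube ennreal_divide_times ennreal_divide_self)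

context sparse_chain begin

definition level :: "nat \<Rightarrow> (real^'n) set" where "level k = {x. ch k x \<noteq> None}"

definition nodes :: "nat \<Rightarrow> 'n node set" where "nodes k = {Q. \<exists>x. ch k x = Some Q}"

lemma nodes_iff: "Q \<in> nodes k \<longleftrightarrow> (\<exists>x. ch k x = Some Q)"
  by (simp add: nodes_def)

lemma chain_pos: "ch k x = Some Q \<Longrightarrow> 0 < snd Q"
  and chain_mem: "ch k x = Some Q \<Longrightarrow> x \<in> hcube Q"
  and chain_const: "ch k x = Some Q \<Longrightarrow> y \<in> hcube Q \<Longrightarrow> ch k y = Some Q"
  by (blast dest: member)+

lemma nodesE:
  assumes "Q \<in> nodes k"
  obtains x where "ch k x = Some Q"
  using assms unfolding nodes_iff by (rule exE)

lemma node_pos: "Q \<in> nodes k \<Longrightarrow> 0 < snd Q"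
  by (erule nodesE) (rule chain_pos)

lemma node_mem:
  assumes "Q \<in> nodes k"
  shows "y \<in> hcube Q \<longleftrightarrow> ch k y = Some Q"
proof -
  obtain x where "ch k x = Some Q" using assms by (rule nodesE)
  from chain_const[OF this, of y] chain_mem[of k y Q] show ?thesis by (rule iffI)
qed

lemma level_Suc: "level (Suc k) \<subseteq> level k"
proof
  fix x assume "x \<in> level (Suc k)"
  then show "x \<in> level k" using stopped[of k x] unfolding level_def by (cases "ch k x = None") simp_all
qed

lemma level_antimono: "j \<le> k \<Longrightarrow> level k \<subseteq> level j"
  by (rule lift_Suc_antimono_le[of level, OF level_Suc])

lemma level_0: "level 0 = hcube R"
  by (auto simp: level_def root)

lemma level_eq_Union: "level k = (\<Union>Q\<in>nodes k. hcube Q)"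
proof (intro set_eqI iffI)
  fix x assume "x \<in> level k"
  then obtain Q where Q: "ch k x = Some Q" by (auto simp: level_def)
  then show "x \<in> (\<Union>Q\<in>nodes k. hcube Q)"
    by (intro UN_I[of Q] chain_mem[OF Q]) (auto simp: nodes_def)
next
  fix x assume "x \<in> (\<Union>Q\<in>nodes k. hcube Q)"
  then obtain Q where "Q \<in> nodes k" "x \<in> hcube Q" by (rule UN_E)
  then show "x \<in> level k" by (simp add: node_mem level_def)
qed

lemma disjoint_nodes: "disjoint_family_on hcube (nodes k)"
  unfolding disjoint_family_on_def by (fastforce simp: node_mem)

lemma countable_nodes': "countable (nodes k)"
  using countable_nodes by (simp add: nodes_def)

lemma level_measurable [measurable]: "level k \<in> sets lebesgue"
  unfolding level_eq_Union by (intro sets.countable_UN' countable_nodes') auto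

lemma borel_measurable_chain:
  fixes F :: "'n node option \<Rightarrow> 'b::topological_space"
  shows "(\<lambda>x. F (ch k x)) \<in> borel_measurable lebesgue"
proof -
  define A where "A = insert None (Some ` nodes k)"
  have "countable A" using countable_nodes' by (simp add: A_def)
  have "ch k \<in> measurable lebesgue (count_space A)"
  proof (subst measurable_count_space_eq_countable[OF \<open>countable A\<close>], intro conjI ballI)
    show "ch k \<in> space lebesgue \<rightarrow> A" 
    proof
      fix x show "ch k x \<in> A"
      proof (cases "ch k x")
        case (Some Q)
        then have "Q \<in> nodes k" unfolding nodes_iff by (rule exI)
        then show ?thesis using Some by (simp add: A_def)
      qed (simp add: A_def)
    qed
    fix a assume "a \<in> A"
    then consider "a = None" | Q where "Q \<in> nodes k" "a = Some Q" by (auto simp: A_def)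
    then show "ch k -` {a} \<inter> space lebesgue \<in> sets lebesgue"
    proof cases
      case 1
      then have "ch k -` {a} \<inter> space lebesgue = - level k" by (auto simp: level_def)
      then show ?thesis using sets.compl_sets[OF level_measurable[of k]] by (simp add: Compl_eq_Diff_UNIV)
    next
      case 2
      then have "ch k -` {a} \<inter> space lebesgue = hcube Q" by (auto simp: node_mem)
      then show ?thesis by simp
    qed
  qed
  then show ?thesis by (rule measurable_compose) simp
qed

lemma nested_le:
  assumes "ch k x = Some P" "ch j x = Some Q" "j \<le> k"
  shows "hcube P \<subseteq> hcube Q"
  using assms(3,1)
proof (induction k arbitrary: P rule: dec_induct)
  case base then show ?case using assms(2) by simp
next
  case (step k)
  have "ch k x \<noteq> None" using stopped step(4) by fastforce
  then obtain P' where "ch k x = Some P'" by auto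
  then show ?case using nested[of k x P' P] step by blast
qed

lemma chain_eq:
  assumes "ch k x = Some P" "y \<in> hcube P" "j \<le> k"
  shows "ch j y = ch j x"
proof -
  have "x \<in> level k" using assms(1) by (simp add: level_def)
  then have "x \<in> level j" using level_antimono[OF assms(3)] by blast
  then obtain Q where Q: "ch j x = Some Q" by (auto simp: level_def)
  then show ?thesis using nested_le[OF assms(1) Q assms(3)] assms(2) chain_const[OF Q, of y] by auto
qed

lemma node_subset_or_disjoint:
  assumes "Q \<in> nodes k" "P \<in> nodes j" "k \<le> j"
  shows "hcube P \<subseteq> hcube Q \<or> hcube P \<inter> hcube Q = {}"
proof (rule disjCI)
  assume "hcube P \<inter> hcube Q \<noteq> {}"
  then obtain y where "ch j y = Some P" "ch k y = Some Q" using assms by (auto simp: node_mem)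
  then show "hcube P \<subseteq> hcube Q" using nested_le assms(3) by blast
qed

lemma nn_integral_level_mono:
  assumes "f \<in> borel_measurable lebesgue" "g \<in> borel_measurable lebesgue"
    and "\<And>Q. Q \<in> nodes k \<Longrightarrow> (\<integral>\<^sup>+x\<in>hcube Q. f x \<partial>lebesgue) \<le> (\<integral>\<^sup>+x\<in>hcube Q. g x \<partial>lebesgue)"
  shows "(\<integral>\<^sup>+x\<in>level k. f x \<partial>lebesgue) \<le> (\<integral>\<^sup>+x\<in>level k. g x \<partial>lebesgue)"
  unfolding level_eq_Union
  by (rule nn_integral_UN_mono[OF countable_nodes' _ disjoint_nodes assms]) auto

lemma emeasure_node_finite: "Q \<in> nodes k \<Longrightarrow> emeasure lebesgue (hcube Q) < \<infinity>"
  by (drule node_pos) (simp add: emeasure_hcube)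

text \<open>Sparseness in the form in which it is used: the part of a cube outside the next generation
carries at least half of its measure.\<close>

lemma node_le_remainder:
  assumes "Q \<in> nodes k"
  shows "emeasure lebesgue (hcube Q) \<le> 2 * emeasure lebesgue (hcube Q - level (Suc k))"
proof -
  let ?e = "emeasure lebesgue"
  have h: "2 * ?e (hcube Q \<inter> level (Suc k)) \<le> ?e (hcube Q)"
    using half nodesE[OF assms] unfolding level_def by metis
  have "?e (hcube Q) = ?e (hcube Q \<inter> level (Suc k)) + ?e (hcube Q - level (Suc k))"
    by (subst plus_emeasure) (auto intro!: arg_cong[where f="?e"])
  then have "?e (hcube Q) + ?e (hcube Q) = 2 * ?e (hcube Q \<inter> level (Suc k)) + 2 * ?e (hcube Q - level (Suc k))"
    by (simp add: distrib_left flip: mult_2)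
  also have "\<dots> \<le> ?e (hcube Q) + 2 * ?e (hcube Q - level (Suc k))"
    using h by (rule add_right_mono)
  finally show ?thesis
    using emeasure_node_finite[OF assms] by (auto simp: ennreal_add_left_cancel_le)
qed

lemma emeasure_level_Suc: "2 * emeasure lebesgue (level (Suc k)) \<le> emeasure lebesgue (level k)"
proof -
  have "(\<integral>\<^sup>+x\<in>level k. 2 * indicator (level (Suc k)) x \<partial>lebesgue) \<le> (\<integral>\<^sup>+x\<in>level k. 1 \<partial>lebesgue)"
  proof (rule nn_integral_level_mono)
    fix Q assume Q: "Q \<in> nodes k"
    have "(\<integral>\<^sup>+x\<in>hcube Q. 2 * indicator (level (Suc k)) x \<partial>lebesgue) =
      (\<integral>\<^sup>+x. 2 * indicator (hcube Q \<inter> level (Suc k)) x \<partial>lebesgue)"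
      by (intro nn_integral_cong) (auto simp: indicator_def)
    also have "\<dots> = 2 * emeasure lebesgue (hcube Q \<inter> level (Suc k))"
      by (subst nn_integral_cmult_indicator) auto
    also have "\<dots> \<le> emeasure lebesgue (hcube Q)" using half nodesE[OF Q] unfolding level_def by metis
    finally show "(\<integral>\<^sup>+x\<in>hcube Q. 2 * indicator (level (Suc k)) x \<partial>lebesgue) \<le> (\<integral>\<^sup>+x\<in>hcube Q. 1 \<partial>lebesgue)"
      by simp
  qed auto
  moreover have "(\<integral>\<^sup>+x\<in>level k. 2 * indicator (level (Suc k)) x \<partial>lebesgue) =
      (\<integral>\<^sup>+x. 2 * indicator (level (Suc k)) x \<partial>lebesgue)"
    using level_Suc by (intro nn_integral_cong) (auto simp: indicator_def)
  ultimately show ?thesis by (simp add: nn_integral_cmult_indicator)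
qed

text \<open>The measure of the levels decays geometrically.\<close>

lemma AE_chain_finite: "AE x in lebesgue. \<exists>k. x \<notin> level k"
proof -
  let ?e = "emeasure lebesgue"
  define N where "N = (\<Inter>k. level k)"
  have N [measurable]: "N \<in> sets lebesgue" unfolding N_def by (intro sets.countable_INT) auto
  have R: "?e (hcube R) < \<infinity>"
  proof (cases "hcube R = {}")
    case False
    then have "R \<in> nodes 0" by (auto simp: nodes_def root)
    then show ?thesis by (rule emeasure_node_finite)
  qed simp
  have "2 ^ k * ?e (level k) \<le> ?e (hcube R)" for k
  proof (induction k)
    case 0 then show ?case by (simp add: level_0)
  next
    case (Suc k)
    have "2 ^ Suc k * ?e (level (Suc k)) = 2 ^ k * (2 * ?e (level (Suc k)))" by (simp add: mult_ac)
    also have "\<dots> \<le> 2 ^ k * ?e (level k)" by (intro mult_left_mono emeasure_level_Suc) auto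
    finally show ?case using Suc by simp
  qed
  moreover have "?e N \<le> ?e (level k)" for k by (rule emeasure_mono) (auto simp: N_def)
  ultimately have le: "2 ^ k * ?e N \<le> ?e (hcube R)" for k
    by (meson mult_left_mono order_trans zero_le)
  have "?e N = 0"
  proof (rule ccontr)
    assume "?e N \<noteq> 0"
    have "?e N \<le> ?e (hcube R)" using le[of 0] by simp
    then have fin: "?e N < \<infinity>" using R by (rule le_less_trans)
    obtain r s where r: "?e N = ennreal r" "0 < r" and s: "?e (hcube R) = ennreal s" "0 \<le> s"
      using fin R \<open>?e N \<noteq> 0\<close> by (cases "?e N"; cases "?e (hcube R)") auto
    have "2 ^ k * r \<le> s" for k
    proof -
      have "ennreal (2 ^ k * r) \<le> ennreal s" using le[of k] r s by (simp add: ennreal_mult ennreal_power[symmetric])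
      then show ?thesis using s(2) by (simp add: ennreal_le_iff)
    qed
    moreover obtain k where "s / r < 2 ^ k" using real_arch_pow[of 2 "s / r"] by auto
    ultimately show False using r(2) by (metis divide_less_eq not_less)
  qed
  then have "N \<in> null_sets lebesgue" by auto
  from AE_not_in[OF this] show ?thesis by eventually_elim (auto simp: N_def)
qed

lemma sum_level_differences_le: "(\<Sum>j\<in>{k..<m}. indicator (level j - level (Suc j)) x) \<le> (1::ennreal)"
proof (cases "k \<le> m")
  case True
  then have "(\<Sum>j\<in>{k..<m}. indicator (level j - level (Suc j)) x) + indicator (level m) x = (indicator (level k) x :: ennreal)"
  proof (induction m rule: dec_induct)
    case (step m)
    have "indicator (level m - level (Suc m)) x + indicator (level (Suc m)) x = (indicator (level m) x :: ennreal)"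
      using level_Suc[of m] by (auto simp: indicator_def)
    then show ?case using step by (simp add: add.assoc)
  qed simp
  then have "(\<Sum>j\<in>{k..<m}. indicator (level j - level (Suc j)) x) \<le> (indicator (level k) x :: ennreal)"
    by (rule subst) simp
  also have "\<dots> \<le> 1" by (auto simp: indicator_def)
  finally show ?thesis .
qed simp

text \<open>On the part of a cube \<open>P \<subseteq> Q\<close> outside the next generation, \<open>M(g \<chi>\<^sub>Q)\<close> is at least the average of
\<open>g\<close> over \<open>P\<close>, and this part has at least half of the measure of \<open>P\<close>; these parts are disjoint for
different \<open>P\<close>. The averages are constant on cubes and hence measurable, which gives additivity of their integrals;
the maximal function is only compared with them pointwise.\<close>

lemma carleson_maximal:
  fixes g :: "real^'n \<Rightarrow> ennreal"
  assumes g [measurable]: "g \<in> borel_measurable lebesgue" and Q: "Q \<in> nodes k"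
  shows "(\<Sum>j\<in>{k..<m}. \<integral>\<^sup>+x\<in>hcube Q \<inter> level j. g x \<partial>lebesgue)
    \<le> 2 * (\<integral>\<^sup>+x\<in>hcube Q. hl_maximal (\<lambda>y. g y * indicator (hcube Q) y) x \<partial>lebesgue)"
proof -
  let ?M = "hl_maximal (\<lambda>y. g y * indicator (hcube Q) y)"
  define av where "av P = average (closed_cube P) (\<lambda>y. g y * indicator (hcube Q) y)" for P
  define m' where "m' j x = (case ch j x of None \<Rightarrow> 0 | Some P \<Rightarrow> av P)" for j x
  have m' [measurable]: "m' j \<in> borel_measurable lebesgue" for j
    unfolding m'_def by (rule borel_measurable_chain)
  have m'_le: "m' j x \<le> ?M x" for j x
  proof (cases "ch j x")
    case (Some P)
    then have "closed_cube P \<in> cubes" "x \<in> closed_cube P"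
      using chain_pos[OF Some] chain_mem[OF Some] closed_cube_in_cubes[of P] hcube_subset_cbox[of P] by (auto simp: closed_cube_def)
    then have "closed_cube P \<in> {Q \<in> cubes. x \<in> Q}" by simp
    then show ?thesis unfolding m'_def hl_maximal_def av_def Some by (auto intro: SUP_upper)
  qed (simp add: m'_def)
  let ?D = "\<lambda>j. level j - level (Suc j)"
  have one: "(\<integral>\<^sup>+x\<in>hcube Q \<inter> level j. g x \<partial>lebesgue) \<le>
      (\<integral>\<^sup>+x. 2 * m' j x * indicator (?D j) x * indicator (hcube Q) x \<partial>lebesgue)" if "k \<le> j" for j
  proof -
    have "(\<integral>\<^sup>+x\<in>hcube Q \<inter> level j. g x \<partial>lebesgue) = (\<integral>\<^sup>+x\<in>level j. g x * indicator (hcube Q) x \<partial>lebesgue)"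
      by (intro nn_integral_cong) (auto simp: indicator_def)
    also have "\<dots> \<le> (\<integral>\<^sup>+x\<in>level j. 2 * m' j x * indicator (?D j) x * indicator (hcube Q) x \<partial>lebesgue)"
    proof (rule nn_integral_level_mono)
      fix P assume P: "P \<in> nodes j"
      show "(\<integral>\<^sup>+x\<in>hcube P. g x * indicator (hcube Q) x \<partial>lebesgue) \<le>
        (\<integral>\<^sup>+x\<in>hcube P. 2 * m' j x * indicator (?D j) x * indicator (hcube Q) x \<partial>lebesgue)"
        using node_subset_or_disjoint[OF Q P that]
      proof
        assume "hcube P \<inter> hcube Q = {}"
        then have "(\<integral>\<^sup>+x\<in>hcube P. g x * indicator (hcube Q) x \<partial>lebesgue) = (\<integral>\<^sup>+(x::real^'n). 0 \<partial>lebesgue)"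
          by (intro nn_integral_cong) (auto simp: indicator_def)
        then show ?thesis by simp
      next
        assume PQ: "hcube P \<subseteq> hcube Q"
        have "(\<integral>\<^sup>+x\<in>hcube P. g x * indicator (hcube Q) x \<partial>lebesgue) = av P * emeasure lebesgue (hcube P)"
          unfolding av_def by (rule average_mult_emeasure[OF node_pos[OF P], symmetric])
        also have "\<dots> \<le> av P * (2 * emeasure lebesgue (hcube P - level (Suc j)))"
          by (intro mult_left_mono node_le_remainder[OF P]) auto
        also have "\<dots> = (\<integral>\<^sup>+x. 2 * av P * indicator (hcube P - level (Suc j)) x \<partial>lebesgue)"
          by (subst nn_integral_cmult_indicator) (auto simp: mult_ac)
        also have "\<dots> = (\<integral>\<^sup>+x\<in>hcube P. 2 * m' j x * indicator (?D j) x * indicator (hcube Q) x \<partial>lebesgue)"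
        proof (intro nn_integral_cong)
          fix x
          show "2 * av P * indicator (hcube P - level (Suc j)) x =
            2 * m' j x * indicator (?D j) x * indicator (hcube Q) x * indicator (hcube P) x"
          proof (cases "x \<in> hcube P")
            case True
            then have "ch j x = Some P" using node_mem[OF P] by simp
            then show ?thesis using True PQ by (auto simp: indicator_def m'_def level_def)
          qed simp
        qed
        finally show ?thesis .
      qed
    qed measurable
    also have "\<dots> \<le> (\<integral>\<^sup>+x. 2 * m' j x * indicator (?D j) x * indicator (hcube Q) x \<partial>lebesgue)"
      by (intro nn_integral_mono) (auto simp: indicator_def)
    finally show ?thesis .
  qed
  have "(\<Sum>j\<in>{k..<m}. \<integral>\<^sup>+x\<in>hcube Q \<inter> level j. g x \<partial>lebesgue) \<le>
     (\<Sum>j\<in>{k..<m}. \<integral>\<^sup>+x. 2 * m' j x * indicator (?D j) x * indicator (hcube Q) x \<partial>lebesgue)"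
    by (intro sum_mono one) auto
  also have "\<dots> = (\<integral>\<^sup>+x. (\<Sum>j\<in>{k..<m}. 2 * m' j x * indicator (?D j) x * indicator (hcube Q) x) \<partial>lebesgue)"
    by (rule nn_integral_sum[symmetric]) measurable
  also have "\<dots> = 2 * (\<integral>\<^sup>+x. (\<Sum>j\<in>{k..<m}. m' j x * indicator (?D j) x * indicator (hcube Q) x) \<partial>lebesgue)"
    by (subst nn_integral_cmult[symmetric]) (auto simp: sum_distrib_left mult_ac)
  also have "\<dots> \<le> 2 * (\<integral>\<^sup>+x\<in>hcube Q. ?M x \<partial>lebesgue)"
  proof (intro mult_left_mono nn_integral_mono)
    fix x
    have "(\<Sum>j\<in>{k..<m}. m' j x * indicator (?D j) x * indicator (hcube Q) x)
       \<le> (\<Sum>j\<in>{k..<m}. ?M x * indicator (hcube Q) x * indicator (?D j) x)"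
      using m'_le[of _ x] by (intro sum_mono) (auto simp: indicator_def)
    also have "\<dots> = ?M x * indicator (hcube Q) x * (\<Sum>j\<in>{k..<m}. indicator (?D j) x)"
      by (simp add: sum_distrib_left)
    also have "\<dots> \<le> ?M x * indicator (hcube Q) x * 1"
      by (intro mult_left_mono sum_level_differences_le) auto
    finally show "(\<Sum>j\<in>{k..<m}. m' j x * indicator (?D j) x * indicator (hcube Q) x) \<le> ?M x * indicator (hcube Q) x"
      by simp
  qed auto
  finally show ?thesis .
qed

end

section \<open>Sums along a sparse chain\<close>

lemma powr_diff_le:
  fixes p x y :: real
  assumes "1 \<le> p" "0 \<le> y" "y \<le> x"
  shows "x powr p - y powr p \<le> p * (x - y) * x powr (p - 1)"
proof (cases "y = x")
  case False
  then have "y < x" using assms by simp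
  show ?thesis
  proof (cases "y = 0")
    case True
    have "x powr p = x * x powr (p - 1)"
      using \<open>y < x\<close> True by (simp add: powr_diff)
    also have "\<dots> \<le> p * x * x powr (p-1)"
      using mult_right_mono[of 1 p "x * x powr (p-1)"] assms True by (simp add: mult.assoc)
    finally show ?thesis using True by simp
  next
    case False
    then have y: "0 < y" using assms by simp
    have "\<exists>z>y. z < x \<and> x powr p - y powr p = (x - y) * (p * z powr (p - 1))"
      using y \<open>y < x\<close> by (intro MVT2) (auto intro!: has_real_derivative_powr)
    then obtain z where z: "y < z" "z < x" "x powr p - y powr p = (x - y) * (p * z powr (p - 1))" by blast
    have "z powr (p - 1) \<le> x powr (p - 1)" using z y assms by (intro powr_mono2) auto
    then have "(x - y) * (p * z powr (p - 1)) \<le> (x - y) * (p * x powr (p - 1))"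
      using \<open>y < x\<close> assms by (intro mult_left_mono) auto
    then show ?thesis using z(3) by (simp add: mult_ac)
  qed
qed simp

text \<open>The two cases \<open>c a \<le> A\<close> and \<open>A < c a\<close>. The parameter \<open>c\<close> makes the coefficient of \<open>A powr p\<close> as
small as an absorption argument requires.\<close>

lemma powr_split_le:
  fixes a A p c :: real
  assumes "1 \<le> p" "0 < c" "0 \<le> a" "0 \<le> A"
  shows "a * A powr (p - 1) \<le> A powr p / c + c powr (p - 1) * a powr p"
proof (cases "c * a \<le> A")
  case True
  have "c * (a * A powr (p - 1)) \<le> A * A powr (p - 1)"
    using True by (simp add: mult.assoc[symmetric] mult_right_mono)
  also have "\<dots> = A powr p" using assms by (cases "A = 0") (simp_all add: powr_diff)
  finally have "a * A powr (p - 1) \<le> A powr p / c" using assms(2) by (simp add: field_simps)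
  moreover have "0 \<le> c powr (p - 1) * a powr p" by simp
  ultimately show ?thesis by linarith
next
  case False
  then have a: "0 < a" using assms by (cases "a = 0") auto
  have "a * A powr (p - 1) \<le> a * (c * a) powr (p - 1)"
    using False assms by (intro mult_left_mono powr_mono2) auto
  also have "\<dots> = c powr (p - 1) * a powr p" using a assms by (simp add: powr_mult powr_diff)
  finally show ?thesis using assms by (simp add: add_increasing)
qed

text \<open>For \<open>p \<le> 1\<close> the increments of the concave power decrease under translation.\<close>

lemma powr_add_diff_mono:
  fixes c u v p :: real
  assumes "0 < p" "p \<le> 1" "0 \<le> c" "0 \<le> v" "v \<le> u"
  shows "(c + u) powr p - (c + v) powr p \<le> u powr p - v powr p"
proof (cases "v = 0")
  case True
  have "(c + u) powr p \<le> c powr p + u powr p"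
  proof (cases "c + u = 0")
    case False
    then have pos: "0 < c + u" using assms by auto
    have *: "t \<le> t powr p" if "0 \<le> t" "t \<le> 1" for t :: real
      using that assms powr_mono'[of p 1 t] by (cases "t = 0") auto
    have "c / (c + u) + u / (c + u) \<le> (c / (c + u)) powr p + (u / (c + u)) powr p"
      using assms pos by (intro add_mono *) (auto simp: field_simps)
    also have "c / (c + u) + u / (c + u) = 1" using pos by (simp flip: add_divide_distrib)
    finally have "1 \<le> (c powr p + u powr p) / (c + u) powr p"
      using assms pos by (simp add: powr_divide add_divide_distrib)
    then show ?thesis using pos by (simp add: field_simps)
  qed (use assms in auto)
  then show ?thesis using True assms by simp
next
  case False
  then have v: "0 < v" using assms by simp
  have "(c + u) powr p - u powr p \<le> (c + v) powr p - v powr p"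
  proof (rule DERIV_nonpos_imp_nonincreasing[OF assms(5), where f="\<lambda>t. (c + t) powr p - t powr p"])
    fix t assume t: "v \<le> t" "t \<le> u"
    then have "0 < t" using v by simp
    have "((\<lambda>t. (c + t) powr p - t powr p) has_real_derivative (p * (c + t) powr (p - 1) - p * t powr (p - 1))) (at t)"
    proof (intro DERIV_diff)
      have "((\<lambda>t. c + t) has_real_derivative 1) (at t)" by (auto intro!: derivative_eq_intros)
      from DERIV_chain2[OF has_real_derivative_powr this, of p] 
      show "((\<lambda>t. (c + t) powr p) has_real_derivative p * (c + t) powr (p - 1)) (at t)"
        using \<open>0 < t\<close> assms(3) by simp
      show "((\<lambda>t. t powr p) has_real_derivative p * t powr (p - 1)) (at t)"
        using \<open>0 < t\<close> by (rule has_real_derivative_powr)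
    qed
    moreover have "(c + t) powr (p - 1) \<le> t powr (p - 1)"
      by (rule powr_mono2') (use \<open>0 < t\<close> assms in linarith)+
    then have "p * (c + t) powr (p - 1) \<le> p * t powr (p - 1)"
      by (rule mult_left_mono) (use assms in simp)
    then have "p * (c + t) powr (p - 1) - p * t powr (p - 1) \<le> 0" by linarith
    ultimately show "\<exists>y. ((\<lambda>t. (c + t) powr p - t powr p) has_real_derivative y) (at t) \<and> y \<le> 0" by blast
  qed
  then show ?thesis by simp
qed

lemma powr_increment_le:
  fixes a Y p c :: real
  assumes "0 < p" "p \<le> 1" "0 < c" "0 \<le> a" "c * a \<le> Y"
  shows "(Y + a) powr p - Y powr p \<le> p / c * (Y + a) powr p"
proof (cases "a = 0")
  case False
  then have a: "0 < a" using assms by simp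
  then have "0 < c * a" using assms by simp
  then have pos: "0 < a" "0 < Y" using a assms(5) by linarith+
  have "\<exists>z>Y. z < Y + a \<and> (Y + a) powr p - Y powr p = (Y + a - Y) * (p * z powr (p - 1))"
    using pos by (intro MVT2) (auto intro!: has_real_derivative_powr)
  then obtain z where z: "Y < z" "z < Y + a" "(Y + a) powr p - Y powr p = a * (p * z powr (p - 1))" by auto
  have "z powr (p - 1) \<le> Y powr (p - 1)" using z pos assms by (intro powr_mono2') auto
  then have "a * (p * z powr (p - 1)) \<le> a * (p * Y powr (p - 1))" using pos assms by simp
  also have "\<dots> \<le> (Y / c) * (p * Y powr (p - 1))"
    using assms by (intro mult_right_mono) (auto simp: field_simps)
  also have "\<dots> = p / c * Y powr p" using pos by (simp add: powr_diff)
  also have "\<dots> \<le> p / c * (Y + a) powr p"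
    using assms pos by (intro mult_left_mono powr_mono2) auto
  finally show ?thesis using z(3) by simp
next
  case True then show ?thesis using assms by simp
qed

lemma sum_triangle_swap:
  fixes f :: "nat \<Rightarrow> nat \<Rightarrow> 'a::comm_monoid_add"
  shows "(\<Sum>k\<le>K. \<Sum>j\<le>k. f k j) = (\<Sum>j\<le>K. \<Sum>k\<in>{j..<Suc K}. f k j)"
  by (induction K) (simp_all add: sum.distrib add_ac)

context sparse_chain begin

definition adapted :: "(nat \<Rightarrow> real^'n \<Rightarrow> real) \<Rightarrow> bool" where
  "adapted h \<longleftrightarrow> (\<forall>k. h k \<in> borel_measurable lebesgue) \<and> (\<forall>k x. 0 \<le> h k x \<and> h k x \<le> h (Suc k) x) \<and>
     (\<forall>k x Q y. ch k x = Some Q \<longrightarrow> y \<in> hcube Q \<longrightarrow> h k y = h k x)"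

lemma adapted_measurable: "adapted h \<Longrightarrow> h k \<in> borel_measurable lebesgue"
  by (simp add: adapted_def)

lemma adapted_nonneg: "adapted h \<Longrightarrow> 0 \<le> h k x"
  by (simp add: adapted_def)

lemma adapted_mono:
  assumes "adapted h" "j \<le> k"
  shows "h j x \<le> h k x"
  by (rule lift_Suc_mono_le[of "\<lambda>k. h k x", OF _ assms(2)]) (use assms(1) in \<open>simp add: adapted_def\<close>)

lemma adapted_const: "adapted h \<Longrightarrow> ch k x = Some Q \<Longrightarrow> y \<in> hcube Q \<Longrightarrow> h k y = h k x"
  unfolding adapted_def by blast

lemma adapted_const_le:
  assumes "adapted h" "ch k x = Some Q" "y \<in> hcube Q" "j \<le> k"
  shows "h j y = h j x"
proof -
  have "x \<in> level k" using assms(2) by (simp add: level_def)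
  then have "x \<in> level j" using level_antimono[OF assms(4)] by blast
  then obtain P where P: "ch j x = Some P" by (auto simp: level_def)
  have "ch j y = ch j x" by (rule chain_eq[OF assms(2-4)])
  then have "y \<in> hcube P" using P by (intro chain_mem[of j]) simp
  with P show ?thesis by (rule adapted_const[OF assms(1)])
qed

lemma adapted_powr: "adapted h \<Longrightarrow> 0 \<le> p \<Longrightarrow> adapted (\<lambda>k x. h k x powr p)"
  unfolding adapted_def by (auto intro!: powr_mono2 powr_real_measurable)

lemma adapted_scale: "adapted h \<Longrightarrow> 0 \<le> c \<Longrightarrow> adapted (\<lambda>k x. c * h k x)"
  unfolding adapted_def by (auto intro!: mult_left_mono borel_measurable_times)

lemma adapted_add: "adapted h \<Longrightarrow> adapted h' \<Longrightarrow> adapted (\<lambda>k x. h k x + h' k x)"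
  unfolding adapted_def by (auto intro!: add_mono borel_measurable_add) 

definition cumulative :: "(nat \<Rightarrow> real^'n \<Rightarrow> real) \<Rightarrow> nat \<Rightarrow> real^'n \<Rightarrow> real" where
  "cumulative h k x = (\<Sum>j\<le>k. indicator (level j) x * h j x)"

lemma cumulative_Suc: "cumulative h (Suc k) x = cumulative h k x + indicator (level (Suc k)) x * h (Suc k) x"
  by (simp add: cumulative_def)

lemma adapted_cumulative:
  assumes "adapted h"
  shows "adapted (cumulative h)"
  unfolding adapted_def
proof (intro conjI allI impI)
  fix k x
  show "cumulative h k \<in> borel_measurable lebesgue"
    unfolding cumulative_def using adapted_measurable[OF assms] by measurable
  show "0 \<le> cumulative h k x"
    unfolding cumulative_def using adapted_nonneg[OF assms] by (intro sum_nonneg) auto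
  show "cumulative h k x \<le> cumulative h (Suc k) x"
    using adapted_nonneg[OF assms] by (simp add: cumulative_Suc)
  fix Q y assume Q: "ch k x = Some Q" and y: "y \<in> hcube Q"
  show "cumulative h k y = cumulative h k x"
    unfolding cumulative_def
  proof (rule sum.cong)
    fix j assume "j \<in> {..k}"
    then have "j \<le> k" by simp
    have "ch j y = ch j x" by (rule chain_eq[OF Q y \<open>j \<le> k\<close>])
    then have "indicator (level j) y = (indicator (level j) x :: real)" by (simp add: level_def indicator_def)
    then show "indicator (level j) y * h j y = indicator (level j) x * h j x"
      using adapted_const_le[OF assms Q y \<open>j \<le> k\<close>] by simp
  qed simp
qed

text \<open>Summation by parts: \<open>h\<^sub>k\<close> is the sum of its increments \<open>d\<^sub>j\<close>, \<open>j \<le> k\<close>. Each increment is constant on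
the cubes of generation \<open>j\<close>, so the Carleson condition on those cubes bounds the sum of its integrals
over all later levels by \<open>\<Lambda>\<close> times its integral over level \<open>j\<close>. Monotonicity of \<open>h\<close> makes all increments
nonnegative.\<close>

lemma carleson_embedding:
  fixes g :: "real^'n \<Rightarrow> ennreal"
  assumes h: "adapted h" and g [measurable]: "g \<in> borel_measurable lebesgue"
    and carleson: "\<And>k m Q. Q \<in> nodes k \<Longrightarrow>
      (\<Sum>j\<in>{k..<m}. \<integral>\<^sup>+x\<in>hcube Q \<inter> level j. g x \<partial>lebesgue) \<le> \<Lambda> * (\<integral>\<^sup>+x\<in>hcube Q. g x \<partial>lebesgue)"
  shows "(\<Sum>k\<le>K. \<integral>\<^sup>+x\<in>level k. ennreal (h k x) * g x \<partial>lebesgue)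
    \<le> \<Lambda> * (\<integral>\<^sup>+x\<in>level 0. ennreal (h K x) * g x \<partial>lebesgue)"
proof -
  have hm [measurable]: "h k \<in> borel_measurable lebesgue" for k by (rule adapted_measurable[OF h])
  define d where "d j x = (case j of 0 \<Rightarrow> h 0 x | Suc i \<Rightarrow> h (Suc i) x - h i x)" for j x
  have dm [measurable]: "d j \<in> borel_measurable lebesgue" for j
    unfolding d_def by (cases j) auto
  have d0: "0 \<le> d j x" for j x
    using adapted_nonneg[OF h, of 0 x] adapted_mono[OF h, of "j - 1" j x] by (cases j) (auto simp: d_def)
  have sum_d: "(\<Sum>j\<le>k. d j x) = h k x" for k x
    by (induction k) (auto simp: d_def)
  have hd: "ennreal (h k x) = (\<Sum>j\<le>k. ennreal (d j x))" for k x
    unfolding sum_d[symmetric] using d0 by simp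
  have d_const: "d j y = d j x" if "ch j x = Some Q" "y \<in> hcube Q" for j x y Q
    using adapted_const_le[OF h that] by (cases j) (auto simp: d_def)
  have one: "(\<Sum>k\<in>{j..<Suc K}. \<integral>\<^sup>+x\<in>level k. ennreal (d j x) * g x \<partial>lebesgue)
     \<le> (\<integral>\<^sup>+x\<in>level j. \<Lambda> * (ennreal (d j x) * g x) \<partial>lebesgue)" for j
  proof -
    have "(\<Sum>k\<in>{j..<Suc K}. \<integral>\<^sup>+x\<in>level k. ennreal (d j x) * g x \<partial>lebesgue)
       = (\<integral>\<^sup>+x\<in>level j. (\<Sum>k\<in>{j..<Suc K}. ennreal (d j x) * g x * indicator (level k) x) \<partial>lebesgue)"
    proof (subst nn_integral_sum[symmetric])
      show "(\<integral>\<^sup>+ x. (\<Sum>k = j..<Suc K. ennreal (d j x) * g x * indicator (level k) x) \<partial>lebesgue) =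
         (\<integral>\<^sup>+x\<in>level j. (\<Sum>k\<in>{j..<Suc K}. ennreal (d j x) * g x * indicator (level k) x) \<partial>lebesgue)"
      proof (intro nn_integral_cong)
        fix x
        have "ennreal (d j x) * g x * indicator (level k) x = 
            ennreal (d j x) * g x * indicator (level k) x * indicator (level j) x" if "j \<le> k" for k
          using level_antimono[OF that] by (auto simp: indicator_def)
        then show "(\<Sum>k = j..<Suc K. ennreal (d j x) * g x * indicator (level k) x) =
           (\<Sum>k = j..<Suc K. ennreal (d j x) * g x * indicator (level k) x) * indicator (level j) x"
          unfolding sum_distrib_right by (intro sum.cong) auto
      qed
    qed measurable
    also have "\<dots> \<le> (\<integral>\<^sup>+x\<in>level j. \<Lambda> * (ennreal (d j x) * g x) \<partial>lebesgue)"
    proof (rule nn_integral_level_mono)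
      fix Q assume Q: "Q \<in> nodes j"
      then obtain z where z: "ch j z = Some Q" by (rule nodesE)
      have "(\<integral>\<^sup>+x\<in>hcube Q. (\<Sum>k\<in>{j..<Suc K}. ennreal (d j x) * g x * indicator (level k) x) \<partial>lebesgue)
         = (\<integral>\<^sup>+x. (\<Sum>k\<in>{j..<Suc K}. ennreal (d j z) * (g x * indicator (hcube Q \<inter> level k) x)) \<partial>lebesgue)"
      proof (intro nn_integral_cong)
        fix x
        show "(\<Sum>k\<in>{j..<Suc K}. ennreal (d j x) * g x * indicator (level k) x) * indicator (hcube Q) x =
            (\<Sum>k\<in>{j..<Suc K}. ennreal (d j z) * (g x * indicator (hcube Q \<inter> level k) x))"
          using d_const[OF z, of x] unfolding sum_distrib_right
          by (intro sum.cong) (auto simp: indicator_def)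
      qed
      also have "\<dots> = ennreal (d j z) * (\<Sum>k\<in>{j..<Suc K}. \<integral>\<^sup>+x\<in>hcube Q \<inter> level k. g x \<partial>lebesgue)"
        by (subst nn_integral_sum) (auto simp: nn_integral_cmult sum_distrib_left simp del: sum.op_ivl_Suc)
      also have "\<dots> \<le> ennreal (d j z) * (\<Lambda> * (\<integral>\<^sup>+x\<in>hcube Q. g x \<partial>lebesgue))"
        by (intro mult_left_mono carleson[OF Q]) auto
      also have "\<dots> = (\<integral>\<^sup>+x. ennreal (d j z) * (\<Lambda> * (g x * indicator (hcube Q) x)) \<partial>lebesgue)"
        by (simp add: nn_integral_cmult)
      also have "\<dots> = (\<integral>\<^sup>+x\<in>hcube Q. \<Lambda> * (ennreal (d j x) * g x) \<partial>lebesgue)"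
        using d_const[OF z] by (intro nn_integral_cong) (auto simp: indicator_def mult_ac)
      finally show "(\<integral>\<^sup>+x\<in>hcube Q. (\<Sum>k\<in>{j..<Suc K}. ennreal (d j x) * g x * indicator (level k) x) \<partial>lebesgue)
        \<le> (\<integral>\<^sup>+x\<in>hcube Q. \<Lambda> * (ennreal (d j x) * g x) \<partial>lebesgue)" .
    qed measurable
    finally show ?thesis .
  qed
  have "(\<Sum>k\<le>K. \<integral>\<^sup>+x\<in>level k. ennreal (h k x) * g x \<partial>lebesgue)
     = (\<Sum>k\<le>K. \<Sum>j\<le>k. \<integral>\<^sup>+x\<in>level k. ennreal (d j x) * g x \<partial>lebesgue)"
    unfolding hd sum_distrib_right by (subst nn_integral_sum) auto
  also have "\<dots> = (\<Sum>j\<le>K. \<Sum>k\<in>{j..<Suc K}. \<integral>\<^sup>+x\<in>level k. ennreal (d j x) * g x \<partial>lebesgue)"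
    by (rule sum_triangle_swap)
  also have "\<dots> \<le> (\<Sum>j\<le>K. \<integral>\<^sup>+x\<in>level j. \<Lambda> * (ennreal (d j x) * g x) \<partial>lebesgue)"
    by (intro sum_mono one)
  also have "\<dots> \<le> (\<Sum>j\<le>K. \<integral>\<^sup>+x\<in>level 0. \<Lambda> * (ennreal (d j x) * g x) \<partial>lebesgue)"
  proof (intro sum_mono nn_integral_mono)
    fix j x
    show "\<Lambda> * (ennreal (d j x) * g x) * indicator (level j) x \<le> \<Lambda> * (ennreal (d j x) * g x) * indicator (level 0) x"
      using level_antimono[of 0 j] by (auto simp: indicator_def)
  qed
  also have "\<dots> = (\<integral>\<^sup>+x. (\<Sum>j\<le>K. \<Lambda> * (ennreal (d j x) * g x) * indicator (level 0) x) \<partial>lebesgue)"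
    by (rule nn_integral_sum[symmetric]) measurable
  also have "\<dots> = (\<integral>\<^sup>+x. \<Lambda> * (ennreal (h K x) * g x * indicator (level 0) x) \<partial>lebesgue)"
    unfolding hd by (intro nn_integral_cong) (simp add: sum_distrib_left sum_distrib_right mult_ac)
  also have "\<dots> = \<Lambda> * (\<integral>\<^sup>+x\<in>level 0. ennreal (h K x) * g x \<partial>lebesgue)"
    by (rule nn_integral_cmult) measurable
  finally show ?thesis .
qed

lemma cumulative_0: "cumulative h 0 x = indicator (level 0) x * h 0 x"
proof -
  have "(\<Sum>k\<le>(0::nat). f k) = f 0" for f :: "nat \<Rightarrow> real" by simp
  then show ?thesis unfolding cumulative_def .
qed

text \<open>Telescoping of the power of the partial sums. The first term on the right will be absorbed after
integration, by the choice of \<open>c\<close>.\<close>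

lemma cumulative_powr_le_ge1:
  assumes a: "adapted a" and "1 \<le> p" "0 < c"
  shows "cumulative a K x powr p \<le>
    (\<Sum>k\<le>K. indicator (level k) x * (p / c * cumulative a k x powr p + p * c powr (p - 1) * a k x powr p))"
proof -
  note ad = adapted_cumulative[OF a]
  have step: "cumulative a k x powr p \<le> y powr p +
     indicator (level k) x * (p / c * cumulative a k x powr p + p * c powr (p - 1) * a k x powr p)"
    if y: "0 \<le> y" "cumulative a k x = y + indicator (level k) x * a k x" for k y
  proof (cases "x \<in> level k")
    case True
    have "cumulative a k x powr p - y powr p \<le> p * (cumulative a k x - y) * cumulative a k x powr (p - 1)"
      using y adapted_nonneg[OF a, of k x] assms by (intro powr_diff_le) auto
    also have "\<dots> = p * (a k x * cumulative a k x powr (p - 1))" using y True by simp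
    also have "\<dots> \<le> p * (cumulative a k x powr p / c + c powr (p - 1) * a k x powr p)"
      using assms adapted_nonneg[OF a, of k x] adapted_nonneg[OF ad, of k x]
      by (intro mult_left_mono powr_split_le) auto
    finally show ?thesis using True by (simp add: field_simps)
  qed (use y in simp)
  show ?thesis
  proof (induction K)
    case 0
    have *: "(\<Sum>k\<le>(0::nat). f k) = f 0" for f :: "nat \<Rightarrow> real" by simp
    show ?case unfolding * using step[of 0 0] assms by (simp add: cumulative_0)
  next
    case (Suc K)
    show ?case
      using step[of "cumulative a K x" "Suc K"] Suc adapted_nonneg[OF ad] by (simp add: cumulative_Suc)
  qed
qed

text \<open>For \<open>p < 1\<close> the power of the partial sums \<open>A\<^sub>k\<close> has unbounded derivative near zero. Adding \<open>c a\<^sub>k\<close> removes this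
difficulty: a growth of \<open>a\<close> is paid for by \<open>c powr p * a powr p\<close>, and the addition of a new term to the
sum changes the power by a factor of at most \<open>1 + p/c\<close>. The factor \<open>p\<close> keeps the final constant bounded
as \<open>p\<close> tends to zero.\<close>

lemma cumulative_powr_le_le1:
  assumes a: "adapted a" and p: "0 < p" "p \<le> 1" and c: "0 < c"
  shows "(cumulative a K x + c * a K x) powr p \<le> c powr p * a K x powr p +
    (\<Sum>k\<le>K. indicator (level k) x * (p / c * (cumulative a k x + c * a k x) powr p))"
proof -
  note ad = adapted_cumulative[OF a]
  have step: "(cumulative a k x + c * a k x) powr p \<le> (y + c * v) powr p + (c powr p * a k x powr p - c powr p * v powr p)
     + indicator (level k) x * (p / c * (cumulative a k x + c * a k x) powr p)"
    if y: "0 \<le> y" "cumulative a k x = y + indicator (level k) x * a k x" and v: "0 \<le> v" "v \<le> a k x" for k y v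
  proof -
    have 1: "(y + c * a k x) powr p - (y + c * v) powr p \<le> (c * a k x) powr p - (c * v) powr p"
      using y v p c by (intro powr_add_diff_mono) auto
    have 2: "(cumulative a k x + c * a k x) powr p - (y + c * a k x) powr p
      \<le> indicator (level k) x * (p / c * (cumulative a k x + c * a k x) powr p)"
    proof (cases "x \<in> level k")
      case True
      then have eq: "cumulative a k x + c * a k x = (y + c * a k x) + a k x" using y by simp
      show ?thesis unfolding eq using True y v p c powr_increment_le[of p c "a k x" "y + c * a k x"] by simp
    qed (use y in simp)
    show ?thesis using 1 2 v c by (simp add: powr_mult)
  qed
  show ?thesis
  proof (induction K)
    case 0
    have *: "(\<Sum>k\<le>(0::nat). f k) = f 0" for f :: "nat \<Rightarrow> real" by simp
    show ?case unfolding * using step[of 0 0 0] adapted_nonneg[OF a, of 0 x] p by (simp add: cumulative_0)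
  next
    case (Suc K)
    show ?case
      using step[of "cumulative a K x" "Suc K" "a K x"] Suc adapted_nonneg[OF ad] adapted_nonneg[OF a]
        adapted_mono[OF a, of K "Suc K" x]
      by (simp add: cumulative_Suc)
  qed
qed

lemma cumulative_le: "adapted a \<Longrightarrow> cumulative a K x \<le> (real K + 1) * a K x"
proof -
  assume a: "adapted a"
  have "cumulative a K x \<le> (\<Sum>j\<le>K. a K x)"
    unfolding cumulative_def
  proof (rule sum_mono)
    fix j assume "j \<in> {..K}"
    then show "indicator (level j) x * a j x \<le> a K x"
      using adapted_mono[OF a, of j K x] adapted_nonneg[OF a, of K x] by (auto simp: indicator_def)
  qed
  then show ?thesis by (simp add: algebra_simps)
qed

text \<open>Integrating the pointwise bounds and applying the Carleson embedding to their right-hand sides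
reproduces the left-hand side with coefficient \<open>1/2\<close>, respectively \<open>p/2\<close>, which is absorbed. The
absorbed integral is finite because \<open>A\<^sub>K \<le> (K+1) a\<^sub>K\<close>.\<close>

lemma cumulative_weighted_bound:
  fixes g :: "real^'n \<Rightarrow> ennreal"
  assumes a: "adapted a" and g [measurable]: "g \<in> borel_measurable lebesgue"
    and L: "0 < L" and p: "0 < p"
    and carleson: "\<And>k m Q. Q \<in> nodes k \<Longrightarrow>
      (\<Sum>j\<in>{k..<m}. \<integral>\<^sup>+x\<in>hcube Q \<inter> level j. g x \<partial>lebesgue) \<le> ennreal L * (\<integral>\<^sup>+x\<in>hcube Q. g x \<partial>lebesgue)"
    and fin: "(\<integral>\<^sup>+x\<in>level 0. ennreal (a K x powr p) * g x \<partial>lebesgue) < \<infinity>"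
  shows "(\<integral>\<^sup>+x\<in>level 0. ennreal (cumulative a K x powr p) * g x \<partial>lebesgue)
    \<le> ennreal ((4 * L * max 1 p) powr p) * (\<integral>\<^sup>+x\<in>level 0. ennreal (a K x powr p) * g x \<partial>lebesgue)"
proof -
  note ad = adapted_cumulative[OF a]
  define I where "I f = (\<integral>\<^sup>+x\<in>level 0. ennreal (f x) * g x \<partial>lebesgue)" for f
  have am [measurable]: "a k \<in> borel_measurable lebesgue" for k by (rule adapted_measurable[OF a])
  have cm [measurable]: "cumulative a k \<in> borel_measurable lebesgue" for k by (rule adapted_measurable[OF ad])
  have a0: "0 \<le> a k x" for k x by (rule adapted_nonneg[OF a])
  have c0: "0 \<le> cumulative a k x" for k x by (rule adapted_nonneg[OF ad])
  have I_mono: "I f \<le> I f'" if "\<And>x. f x \<le> f' x" for f f'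
    unfolding I_def using that by (intro nn_integral_mono mult_right_mono ennreal_leI) auto
  have I_scale: "I (\<lambda>x. c * f x) = ennreal c * I f" if "f \<in> borel_measurable lebesgue" "0 \<le> c" for c f
    unfolding I_def using that by (subst nn_integral_cmult[symmetric]) (auto simp: ennreal_mult' mult_ac)
  have I_add: "I (\<lambda>x. f x + f' x) = I f + I f'"
    if "f \<in> borel_measurable lebesgue" "f' \<in> borel_measurable lebesgue" "\<And>x. 0 \<le> f x" "\<And>x. 0 \<le> f' x" for f f'
    unfolding I_def using that by (subst nn_integral_add[symmetric]) (auto simp: ennreal_plus algebra_simps)
  have embed: "I (\<lambda>x. \<Sum>k\<le>K. indicator (level k) x * h k x) \<le> ennreal L * I (h K)" if h: "adapted h" for h
  proof -
    have [measurable]: "h k \<in> borel_measurable lebesgue" for k by (rule adapted_measurable[OF h])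
    have h0: "0 \<le> h k x" for k x by (rule adapted_nonneg[OF h])
    have "I (\<lambda>x. \<Sum>k\<le>K. indicator (level k) x * h k x) =
       (\<integral>\<^sup>+x. (\<Sum>k\<le>K. ennreal (h k x) * g x * indicator (level k) x) \<partial>lebesgue)"
      unfolding I_def
    proof (intro nn_integral_cong)
      fix x
      have "ennreal (\<Sum>k\<le>K. indicator (level k) x * h k x) = (\<Sum>k\<le>K. ennreal (indicator (level k) x * h k x))"
        using h0 by (intro sum_ennreal[symmetric]) auto
      moreover have "ennreal (indicator (level k) x * h k x) * g x * indicator (level 0) x =
          ennreal (h k x) * g x * indicator (level k) x" for k
        using level_antimono[of 0 k] by (auto simp: indicator_def)
      ultimately show "ennreal (\<Sum>k\<le>K. indicator (level k) x * h k x) * g x * indicator (level 0) x =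
        (\<Sum>k\<le>K. ennreal (h k x) * g x * indicator (level k) x)"
        by (simp add: sum_distrib_right)
    qed
    also have "\<dots> = (\<Sum>k\<le>K. \<integral>\<^sup>+x\<in>level k. ennreal (h k x) * g x \<partial>lebesgue)"
      by (rule nn_integral_sum) measurable
    also have "\<dots> \<le> ennreal L * I (h K)"
      unfolding I_def by (rule carleson_embedding[OF h g carleson])
    finally show ?thesis .
  qed
  have finI: "I (\<lambda>x. a K x powr p) < \<infinity>" using fin by (simp add: I_def)
  have fin_le: "I f < \<infinity>" if "\<And>x. f x \<le> (C * a K x) powr p" "0 \<le> C" for f C
  proof -
    have "I f \<le> I (\<lambda>x. C powr p * a K x powr p)"
      using that a0 by (intro I_mono) (simp add: powr_mult)
    also have "\<dots> = ennreal (C powr p) * I (\<lambda>x. a K x powr p)" by (rule I_scale) auto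
    also have "\<dots> < \<infinity>" using finI by (simp add: ennreal_mult_less_top)
    finally show ?thesis .
  qed
  have "I (\<lambda>x. cumulative a K x powr p) \<le> ennreal ((4 * L * max 1 p) powr p) * I (\<lambda>x. a K x powr p)"
  proof (cases "1 \<le> p")
    case True
    define c where "c = 2 * L * p"
    have c: "0 < c" using L p by (simp add: c_def)
    let ?h = "\<lambda>k x. p / c * cumulative a k x powr p + p * c powr (p - 1) * a k x powr p"
    have h: "adapted ?h"
      using p c by (intro adapted_add adapted_scale adapted_powr a ad) auto
    have "I (\<lambda>x. cumulative a K x powr p) \<le> I (\<lambda>x. \<Sum>k\<le>K. indicator (level k) x * ?h k x)"
      by (intro I_mono cumulative_powr_le_ge1[OF a True c])
    also have "\<dots> \<le> ennreal L * I (?h K)" by (rule embed[OF h])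
    also have "I (?h K) = I (\<lambda>x. p / c * cumulative a K x powr p) + I (\<lambda>x. p * c powr (p - 1) * a K x powr p)"
      using p c by (intro I_add) auto
    also have "\<dots> = ennreal (p / c) * I (\<lambda>x. cumulative a K x powr p)
        + ennreal (p * c powr (p - 1)) * I (\<lambda>x. a K x powr p)"
      using p c by (subst (1 2) I_scale) auto
    finally have le: "I (\<lambda>x. cumulative a K x powr p) \<le> ennreal L * (ennreal (p / c) * I (\<lambda>x. cumulative a K x powr p)
        + ennreal (p * c powr (p - 1)) * I (\<lambda>x. a K x powr p))" .
    have "I (\<lambda>x. cumulative a K x powr p) < \<infinity>"
      using cumulative_le[OF a, of K] c0 p by (intro fin_le[of _ "real K + 1"] powr_mono2) auto
    then obtain r where r: "I (\<lambda>x. cumulative a K x powr p) = ennreal r" "0 \<le> r" by (cases "I (\<lambda>x. cumulative a K x powr p)") auto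
    obtain s where s: "I (\<lambda>x. a K x powr p) = ennreal s" "0 \<le> s" using finI by (cases "I (\<lambda>x. a K x powr p)") auto
    have "ennreal L * (ennreal (p / c) * ennreal r + ennreal (p * c powr (p - 1)) * ennreal s)
        = ennreal (L * (p / c * r + p * c powr (p - 1) * s))"
      using r(2) s(2) L p c by (simp flip: ennreal_mult ennreal_plus)
    with le have "ennreal r \<le> ennreal (L * (p / c * r + p * c powr (p - 1) * s))"
      unfolding r s by simp
    then have "r \<le> L * (p / c * r + p * c powr (p - 1) * s)"
      using r s L p c by (subst (asm) ennreal_le_iff) auto
    moreover have "L * (p / c * r) = r / 2" using L p by (simp add: c_def)
    ultimately have "r \<le> 2 * L * p * c powr (p - 1) * s" by (simp add: algebra_simps)
    also have "2 * L * p * c powr (p - 1) = c powr p" using c by (simp add: c_def powr_diff)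
    also have "c powr p * s \<le> (4 * L * max 1 p) powr p * s"
      using L p c s True by (intro mult_right_mono powr_mono2) (auto simp: c_def)
    finally show ?thesis unfolding r s by (simp add: s(2) flip: ennreal_mult)
  next
    case False
    define c where "c = 2 * L"
    have c: "0 < c" using L by (simp add: c_def)
    define X where "X k x = cumulative a k x + c * a k x" for k x
    have X: "adapted X" unfolding X_def using c by (intro adapted_add adapted_scale a ad) auto
    have [measurable]: "X k \<in> borel_measurable lebesgue" for k by (rule adapted_measurable[OF X])
    have X0: "0 \<le> X k x" for k x by (rule adapted_nonneg[OF X])
    let ?h = "\<lambda>k x. p / c * X k x powr p"
    have h: "adapted ?h" using p c by (intro adapted_scale adapted_powr X) auto
    have "I (\<lambda>x. X K x powr p) \<le> I (\<lambda>x. c powr p * a K x powr p + (\<Sum>k\<le>K. indicator (level k) x * ?h k x))"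
      unfolding X_def using p c False by (intro I_mono cumulative_powr_le_le1[OF a]) auto
    also have "\<dots> = I (\<lambda>x. c powr p * a K x powr p) + I (\<lambda>x. \<Sum>k\<le>K. indicator (level k) x * ?h k x)"
      using p c by (intro I_add) (auto intro!: sum_nonneg)
    also have "\<dots> \<le> ennreal (c powr p) * I (\<lambda>x. a K x powr p) + ennreal L * I (?h K)"
      by (intro add_mono embed[OF h]) (simp add: I_scale)
    also have "I (?h K) = ennreal (p / c) * I (\<lambda>x. X K x powr p)"
      using p c by (intro I_scale) auto
    finally have le: "I (\<lambda>x. X K x powr p) \<le> ennreal (c powr p) * I (\<lambda>x. a K x powr p)
       + ennreal L * (ennreal (p / c) * I (\<lambda>x. X K x powr p))" .
    have "X K x \<le> (real K + 1 + c) * a K x" for x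
      using cumulative_le[OF a, of K x] by (simp add: X_def algebra_simps)
    then have "I (\<lambda>x. X K x powr p) < \<infinity>"
      using X0 p c by (intro fin_le[of _ "real K + 1 + c"] powr_mono2) auto
    then obtain r where r: "I (\<lambda>x. X K x powr p) = ennreal r" "0 \<le> r" by (cases "I (\<lambda>x. X K x powr p)") auto
    obtain s where s: "I (\<lambda>x. a K x powr p) = ennreal s" "0 \<le> s" using finI by (cases "I (\<lambda>x. a K x powr p)") auto
    have "ennreal (c powr p) * ennreal s + ennreal L * (ennreal (p / c) * ennreal r)
        = ennreal (c powr p * s + L * (p / c * r))"
      using r(2) s(2) L p c by (simp flip: ennreal_mult ennreal_plus)
    with le have "ennreal r \<le> ennreal (c powr p * s + L * (p / c * r))"
      unfolding r s by simp
    then have "r \<le> c powr p * s + L * (p / c * r)"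
      using r s L p c by (subst (asm) ennreal_le_iff) auto
    moreover have "L * (p / c * r) = r * p / 2" using L p by (simp add: c_def)
    ultimately have "r \<le> c powr p * s + r * p / 2" by linarith
    then have "r * (1 - p / 2) \<le> c powr p * s" by (simp add: algebra_simps)
    \<comment> \<open>Convexity of \<open>p \<mapsto> 2 powr -p\<close> on \<open>[0, 1]\<close>; this bounds \<open>(1 - p/2) powr (-1/p)\<close> by \<open>2\<close>.\<close>
    moreover have half: "1 / 2 powr p \<le> 1 - p / 2"
    proof -
      have "2 powr (- p) \<le> 1 - p / 2"
      proof -
        have "convex_on UNIV (\<lambda>t::real. exp t)" by (rule exp_convex)
        then have "exp ((1 - p) *\<^sub>R 0 + p *\<^sub>R (- ln 2)) \<le> (1 - p) * exp 0 + p * exp (- ln (2::real))"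
          by (rule convex_onD) (use p False in auto)
        then show ?thesis by (simp add: powr_def exp_minus algebra_simps)
      qed
      then show ?thesis by (simp add: powr_minus_divide)
    qed
    then have "r * (1 / 2 powr p) \<le> r * (1 - p / 2)" using r(2) by (rule mult_left_mono)
    ultimately have "r * (1 / 2 powr p) \<le> c powr p * s" by linarith
    then have "r \<le> 2 powr p * (c powr p * s)" by (simp add: field_simps)
    also have "\<dots> = (4 * L * max 1 p) powr p * s"
      using L False by (simp add: c_def max_def flip: powr_mult)
    finally have "ennreal r \<le> ennreal ((4 * L * max 1 p) powr p) * I (\<lambda>x. a K x powr p)"
      unfolding s by (simp add: s(2) flip: ennreal_mult)
    moreover have "I (\<lambda>x. cumulative a K x powr p) \<le> ennreal r"
      unfolding r(1)[symmetric] X_def using c0 a0 c p by (intro I_mono powr_mono2) auto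
    ultimately show ?thesis by (rule order_trans[rotated])
  qed
  then show ?thesis by (simp add: I_def)
qed

end

section \<open>The maximal operator and functions of bounded mean oscillation\<close>

text \<open>Quantifiers over cubes are kept whole instead of being split into corner and side.\<close>

declare split_paired_Ex [simp del] split_paired_All [simp del]

lemma cubes_measure:
  assumes "Q \<in> cubes"
  shows "Q \<in> sets lebesgue" "0 < emeasure lebesgue Q" "emeasure lebesgue Q < \<infinity>"
  using assms by (auto simp: cubes_def emeasure_cbox_cube)

lemma average_le_maximal: "Q \<in> cubes \<Longrightarrow> x \<in> Q \<Longrightarrow> average Q g \<le> hl_maximal g x"
  unfolding hl_maximal_def by (rule SUP_upper) simp

lemma average_mono: "(\<And>x. x \<in> Q \<Longrightarrow> f x \<le> g x) \<Longrightarrow> average Q f \<le> average Q g"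
  unfolding average_def by (intro divide_right_mono_ennreal nn_integral_mono) (auto simp: indicator_def)

lemma maximal_mono: "(\<And>x. f x \<le> g x) \<Longrightarrow> hl_maximal f x \<le> hl_maximal g x"
  unfolding hl_maximal_def by (intro SUP_mono) (auto intro: average_mono)

lemma average_const:
  assumes "Q \<in> cubes"
  shows "average Q (\<lambda>x. c) = c"
  using cubes_measure[OF assms] unfolding average_def
  by (subst nn_integral_cmult_indicator) (auto simp: mult_divide_eq_ennreal)

text \<open>On \<open>Q\<close> the maximal function is at least the average over \<open>Q\<close>. Hence single averages are bounded by
\<open>M\<^sup>2\<close> as well as by \<open>M\<close>, everywhere.\<close>

lemma average_le_average_maximal:
  assumes "Q \<in> cubes"
  shows "average Q g \<le> average Q (hl_maximal g)"
  using average_mono[of Q "\<lambda>_. average Q g" "hl_maximal g"] average_le_maximal[OF assms]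
  by (simp add: average_const[OF assms])

lemma average_le_maximal2:
  assumes "Q \<in> cubes" "x \<in> Q"
  shows "average Q g \<le> hl_maximal (hl_maximal g) x"
  by (rule order_trans[OF average_le_average_maximal average_le_maximal]) (use assms in auto)

text \<open>Chebyshev's inequality with the threshold measured in units of the average bound \<open>\<beta>\<close>, so that
\<open>\<beta> = 0\<close> is included.\<close>

lemma scaled_chebyshev:
  fixes h :: "'a \<Rightarrow> real"
  assumes h [measurable]: "h \<in> borel_measurable M" and h0: "\<And>x. 0 \<le> h x" and S: "S \<in> fmeasurable M"
    and le: "(\<integral>\<^sup>+x\<in>S. ennreal (h x) \<partial>M) \<le> ennreal \<beta> * emeasure M S" and \<beta>: "0 \<le> \<beta>" and A: "0 < A"
  shows "measure M {x\<in>S. A * \<beta> < h x} \<le> measure M S / A"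
proof -
  have [measurable]: "S \<in> sets M" using S by (auto simp: fmeasurable_def)
  have Ssp: "S \<subseteq> space M" by (rule sets.sets_into_space) simp
  have Bm: "{x\<in>S. A * \<beta> < h x} \<in> sets M"
  proof -
    have "{x\<in>S. A * \<beta> < h x} = S \<inter> {x\<in>space M. A * \<beta> < h x}" using Ssp by auto
    then show ?thesis by simp
  qed
  have B: "{x\<in>S. A * \<beta> < h x} \<in> fmeasurable M" by (rule fmeasurableI2[OF S]) (use Bm in auto)
  show ?thesis
  proof (cases "\<beta> = 0")
    case True
    then have "(\<integral>\<^sup>+x\<in>S. ennreal (h x) \<partial>M) = 0" using le by simp
    then have "AE x in M. ennreal (h x) * indicator S x = 0" by (subst (asm) nn_integral_0_iff_AE) auto
    then have "AE x in M. x \<notin> {x\<in>S. A * \<beta> < h x}" by eventually_elim (use True in auto)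
    then have "emeasure M {x\<in>S. A * \<beta> < h x} = 0"
      using Bm by (metis AE_iff_measurable sets.sets_into_space AE_iff_null_sets null_setsD1)
    then show ?thesis using A by (simp add: measure_def)
  next
    case False
    then have b: "0 < \<beta>" using \<beta> by simp
    have "ennreal (A * \<beta>) * emeasure M {x\<in>S. A * \<beta> < h x} = (\<integral>\<^sup>+x. ennreal (A * \<beta>) * indicator {x\<in>S. A * \<beta> < h x} x \<partial>M)"
      using Bm by (simp add: nn_integral_cmult_indicator)
    also have "\<dots> \<le> (\<integral>\<^sup>+x\<in>S. ennreal (h x) \<partial>M)"
      by (intro nn_integral_mono) (auto simp: indicator_def intro!: ennreal_leI)
    also have "\<dots> \<le> ennreal \<beta> * emeasure M S" by (rule le)
    finally have "ennreal (A * \<beta> * measure M {x\<in>S. A * \<beta> < h x}) \<le> ennreal (\<beta> * measure M S)"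
      using A b by (simp add: emeasure_eq_measure2[OF B] emeasure_eq_measure2[OF S] flip: ennreal_mult)
    then have "\<beta> * (A * measure M {x\<in>S. A * \<beta> < h x}) \<le> \<beta> * measure M S"
      using b by (subst (asm) ennreal_le_iff) (auto simp: mult_ac)
    then show ?thesis using A b by (simp add: field_simps)
  qed
qed

lemma corner_in_hcube: "0 < snd Q \<Longrightarrow> fst Q \<in> hcube Q"
  by (simp add: hcube_def)

lemma BMO_D:
  assumes "b \<in> BMO"
  shows "b \<in> borel_measurable lebesgue" "Q \<in> cubes \<Longrightarrow> set_integrable lebesgue Q b" "BMO_norm b < \<infinity>"
    "BMO_norm b = ennreal (enn2real (BMO_norm b))"
  using assms by (auto simp: BMO_def)

lemma BMO_average_le: "Q \<in> cubes \<Longrightarrow> average Q (\<lambda>x. ennreal (norm (b x - mean_value Q b))) \<le> BMO_norm b"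
  unfolding BMO_norm_def by (rule SUP_upper)

definition cube_mean :: "(real^'n \<Rightarrow> complex) \<Rightarrow> 'n::finite node \<Rightarrow> complex" where
  "cube_mean b Q = mean_value (closed_cube Q) b"

lemma BMO_hcube:
  fixes Q :: "'n::finite node"
  assumes "b \<in> BMO" "0 < snd Q"
  shows "(\<integral>\<^sup>+x\<in>hcube Q. ennreal (norm (b x - cube_mean b Q)) \<partial>lebesgue) \<le> BMO_norm b * emeasure lebesgue (hcube Q)"
proof -
  have "(\<integral>\<^sup>+x\<in>hcube Q. ennreal (norm (b x - cube_mean b Q)) \<partial>lebesgue) =
     average (closed_cube Q) (\<lambda>x. ennreal (norm (b x - cube_mean b Q))) * emeasure lebesgue (hcube Q)"
    by (rule average_mult_emeasure[OF assms(2), symmetric])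
  also have "\<dots> \<le> BMO_norm b * emeasure lebesgue (hcube Q)"
    unfolding cube_mean_def by (intro mult_right_mono BMO_average_le closed_cube_in_cubes assms) simp
  finally show ?thesis .
qed

lemma BMO_oscillation_measure:
  fixes Q :: "'n::finite node"
  assumes b: "b \<in> BMO" and Q: "0 < snd Q" and A: "0 < A"
  shows "measure lebesgue {x\<in>hcube Q. A * enn2real (BMO_norm b) < norm (b x - cube_mean b Q)} \<le> measure lebesgue (hcube Q) / A"
proof -
  have [measurable]: "b \<in> borel_measurable lebesgue" using BMO_D(1)[OF b] .
  show ?thesis
    using BMO_hcube[OF b Q] BMO_D(4)[OF b] Q A by (intro scaled_chebyshev) auto
qed

text \<open>The exceptional sets of \<open>b\<close> generate a sparse chain along which the means of \<open>b\<close> change by at most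
\<open>2 A \<beta>\<close> in each step. Hence \<open>|b - \<beta>\<^sub>R|\<close> is at most \<open>2 A \<beta>\<close> times the number of levels containing the
point, and the integral of \<open>F\<close> over all levels is at most \<open>2 \<integral>\<^sub>R M F\<close> by sparseness. This plays the role
of the duality between \<open>BMO\<close> and the class \<open>L log L\<close>.\<close>

lemma BMO_product_bound:
  fixes b :: "real^'n \<Rightarrow> complex" and F :: "real^'n \<Rightarrow> ennreal"
  assumes b: "b \<in> BMO" and F [measurable]: "F \<in> borel_measurable lebesgue" and R: "0 < snd R"
  shows "(\<integral>\<^sup>+x\<in>hcube R. ennreal (norm (b x - cube_mean b R)) * F x \<partial>lebesgue)
    \<le> ennreal (2 ^ (CARD('n) + 6)) * BMO_norm b * (\<integral>\<^sup>+x\<in>hcube R. hl_maximal F x \<partial>lebesgue)"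
proof -
  define \<beta> where "\<beta> = enn2real (BMO_norm b)"
  have \<beta>: "0 \<le> \<beta>" "BMO_norm b = ennreal \<beta>" using BMO_D(4)[OF b] by (auto simp: \<beta>_def)
  \<comment> \<open>The reciprocal of the density allowed for exceptional sets.\<close>
  define A where "A = (2::real) ^ (CARD('n) + 4)"
  have A: "0 < A" by (simp add: A_def)
  have [measurable]: "b \<in> borel_measurable lebesgue" using BMO_D(1)[OF b] .
  define Bad where "Bad Q = {x\<in>hcube Q. A * \<beta> < norm (b x - cube_mean b Q)}" for Q
  obtain ch where ch: "sparse_chain R ch"
    and stop: "\<And>k x Q. ch k x = Some Q \<Longrightarrow> ch (Suc k) x = None \<Longrightarrow> x \<notin> Bad Q"
    and child: "\<And>k x Q P. ch k x = Some Q \<Longrightarrow> ch (Suc k) x = Some P \<Longrightarrow> \<exists>y\<in>hcube P. y \<notin> Bad Q \<and> y \<notin> Bad P"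
  proof (rule sparse_chain_exists[OF R, of Bad])
    fix Q :: "'n node" assume Q: "0 < snd Q"
    have "Bad Q = hcube Q \<inter> {x\<in>space lebesgue. A * \<beta> < norm (b x - cube_mean b Q)}" by (auto simp: Bad_def)
    also have "\<dots> \<in> sets lebesgue" by measurable
    finally show "Bad Q \<in> sets lebesgue" .
    show "Bad Q \<subseteq> hcube Q" by (auto simp: Bad_def)
    show "measure lebesgue (Bad Q) \<le> measure lebesgue (hcube Q) / 2 ^ (CARD('n) + 4)"
      using BMO_oscillation_measure[OF b Q A] by (simp add: Bad_def \<beta>_def A_def)
  qed (rule that)
  interpret sparse_chain R ch by (rule ch)
  have mean_le: "norm (cube_mean b Q - cube_mean b R) \<le> 2 * A * \<beta> * real k" if "ch k x = Some Q" for k x Q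
    using that
  proof (induction k arbitrary: Q)
    case 0
    then show ?case by (simp add: root split: if_splits)
  next
    case (Suc k)
    have "ch k x \<noteq> None"
    proof
      assume "ch k x = None"
      from stopped[OF this] Suc.prems show False by simp
    qed
    then obtain P where P: "ch k x = Some P" unfolding not_None_eq by blast
    obtain y where y: "y \<in> hcube Q" "y \<notin> Bad P" "y \<notin> Bad Q" using child[OF P Suc.prems] by blast
    have "y \<in> hcube P" using nested[OF P Suc.prems] y(1) by blast
    then have 1: "norm (b y - cube_mean b P) \<le> A * \<beta>" using y(2) by (simp add: Bad_def not_less)
    have 2: "norm (b y - cube_mean b Q) \<le> A * \<beta>" using y(1,3) by (simp add: Bad_def not_less)
    have "norm (cube_mean b Q - cube_mean b R) = norm ((b y - cube_mean b P) - (b y - cube_mean b Q) + (cube_mean b P - cube_mean b R))"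
      by simp
    also have "\<dots> \<le> norm (b y - cube_mean b P) + norm (b y - cube_mean b Q) + norm (cube_mean b P - cube_mean b R)"
      by (intro order_trans[OF norm_triangle_ineq] add_right_mono norm_triangle_ineq4)
    also have "\<dots> \<le> A * \<beta> + A * \<beta> + 2 * A * \<beta> * real k" by (intro add_mono 1 2 Suc.IH[OF P])
    finally show ?case by (simp add: algebra_simps)
  qed
  have pointwise: "AE x in lebesgue. ennreal (norm (b x - cube_mean b R)) * F x * indicator (hcube R) x
      \<le> ennreal (2 * A * \<beta>) * (\<Sum>j. F x * indicator (level j) x)"
    using AE_chain_finite
  proof eventually_elim
    fix x assume fin: "\<exists>k. x \<notin> level k"
    show "ennreal (norm (b x - cube_mean b R)) * F x * indicator (hcube R) x \<le> ennreal (2 * A * \<beta>) * (\<Sum>j. F x * indicator (level j) x)"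
    proof (cases "x \<in> hcube R")
      case True
      define m where "m = (LEAST k. x \<notin> level k)"
      have m: "x \<notin> level m" unfolding m_def using fin by (rule LeastI_ex)
      have "m \<noteq> 0" using m True by (metis level_0)
      then obtain k where k: "m = Suc k" by (cases m) auto
      have xk: "x \<in> level k" using not_less_Least[of k "\<lambda>k. x \<notin> level k"] k m_def by auto
      then obtain Q where Q: "ch k x = Some Q" by (auto simp: level_def)
      have "ch (Suc k) x = None" using m k unfolding level_def by simp
      then have "x \<notin> Bad Q" by (rule stop[OF Q])
      then have 1: "norm (b x - cube_mean b Q) \<le> A * \<beta>" using chain_mem[OF Q] by (simp add: Bad_def not_less)
      have "norm (b x - cube_mean b R) \<le> norm (b x - cube_mean b Q) + norm (cube_mean b Q - cube_mean b R)"
        using norm_triangle_ineq[of "b x - cube_mean b Q" "cube_mean b Q - cube_mean b R"] by simp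
      also have "\<dots> \<le> A * \<beta> + 2 * A * \<beta> * real k" by (intro add_mono 1 mean_le[OF Q])
      also have "\<dots> \<le> 2 * A * \<beta> * (real k + 1)" using A \<beta>(1) by (simp add: algebra_simps)
      finally have "ennreal (norm (b x - cube_mean b R)) \<le> ennreal (2 * A * \<beta> * (real k + 1))"
        by (rule ennreal_leI)
      also have "\<dots> = ennreal (2 * A * \<beta>) * of_nat (Suc k)"
        using A \<beta>(1) unfolding ennreal_of_nat_eq_real_of_nat by (subst ennreal_mult[symmetric]) (auto simp: add.commute)
      finally have "ennreal (norm (b x - cube_mean b R)) \<le> ennreal (2 * A * \<beta>) * of_nat (Suc k)" .
      then have "ennreal (norm (b x - cube_mean b R)) * F x \<le> ennreal (2 * A * \<beta>) * of_nat (Suc k) * F x"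
        by (rule mult_right_mono) simp
      also have "\<dots> = ennreal (2 * A * \<beta>) * (\<Sum>j<Suc k. F x * indicator (level j) x)"
      proof -
        have "(\<Sum>j<Suc k. F x * indicator (level j) x) = (\<Sum>j<Suc k. F x)"
        proof (rule sum.cong)
          fix j assume "j \<in> {..<Suc k}"
          then have "x \<in> level j" using level_antimono[of j k] xk by auto
          then show "F x * indicator (level j) x = F x" by simp
        qed simp
        then show ?thesis by (simp add: mult_ac)
      qed
      also have "\<dots> \<le> ennreal (2 * A * \<beta>) * (\<Sum>j. F x * indicator (level j) x)"
        by (intro mult_left_mono sum_le_suminf) auto
      finally show ?thesis using True by simp
    qed simp
  qed
  have R0: "R \<in> nodes 0" using corner_in_hcube[OF R] by (auto simp: nodes_iff root)
  have "(\<integral>\<^sup>+x\<in>hcube R. ennreal (norm (b x - cube_mean b R)) * F x \<partial>lebesgue)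
     \<le> (\<integral>\<^sup>+x. ennreal (2 * A * \<beta>) * (\<Sum>j. F x * indicator (level j) x) \<partial>lebesgue)"
    by (rule nn_integral_mono_AE[OF pointwise])
  also have "\<dots> = ennreal (2 * A * \<beta>) * (\<Sum>j. \<integral>\<^sup>+x\<in>level j. F x \<partial>lebesgue)"
    by (subst nn_integral_cmult, measurable, subst nn_integral_suminf) auto
  also have "(\<Sum>j. \<integral>\<^sup>+x\<in>level j. F x \<partial>lebesgue) \<le> 2 * (\<integral>\<^sup>+x\<in>hcube R. hl_maximal F x \<partial>lebesgue)"
  proof (rule suminf_le_const[OF summableI])
    fix m
    have "(\<Sum>j<m. \<integral>\<^sup>+x\<in>level j. F x \<partial>lebesgue) = (\<Sum>j\<in>{0..<m}. \<integral>\<^sup>+x\<in>hcube R \<inter> level j. F x \<partial>lebesgue)"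
      using level_antimono[of 0] level_0
      by (intro sum.cong) (auto simp: Int_absorb1 atLeast0LessThan)
    also have "\<dots> \<le> 2 * (\<integral>\<^sup>+x\<in>hcube R. hl_maximal (\<lambda>y. F y * indicator (hcube R) y) x \<partial>lebesgue)"
      by (rule carleson_maximal[OF F R0])
    also have "\<dots> \<le> 2 * (\<integral>\<^sup>+x\<in>hcube R. hl_maximal F x \<partial>lebesgue)"
      by (intro mult_left_mono nn_integral_mono mult_right_mono maximal_mono) (auto simp: indicator_def)
    finally show "(\<Sum>j<m. \<integral>\<^sup>+x\<in>level j. F x \<partial>lebesgue) \<le> 2 * (\<integral>\<^sup>+x\<in>hcube R. hl_maximal F x \<partial>lebesgue)" .
  qed
  also have "ennreal (2 * A * \<beta>) * (2 * (\<integral>\<^sup>+x\<in>hcube R. hl_maximal F x \<partial>lebesgue)) =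
     ennreal (2 ^ (CARD('n) + 6)) * BMO_norm b * (\<integral>\<^sup>+x\<in>hcube R. hl_maximal F x \<partial>lebesgue)"
  proof -
    have "2 ^ (CARD('n) + 6) = 4 * A" by (simp add: A_def power_add)
    then have "ennreal (2 ^ (CARD('n) + 6)) * BMO_norm b = ennreal (4 * A * \<beta>)" using \<beta> A by (simp add: ennreal_mult)
    also have "\<dots> = ennreal (2 * A * \<beta>) * 2" using A \<beta>(1) by (simp add: mult_ac flip: ennreal_numeral ennreal_mult)
    finally show ?thesis by (simp add: mult.assoc)
  qed
  finally show ?thesis by (simp add: mult_left_mono)
qed

section \<open>Averages over concentric cubes\<close>

definition center :: "'n::finite node \<Rightarrow> real^'n" where
  "center Q = fst Q + vec (snd Q / 2)"

definition dilate :: "real \<Rightarrow> 'n::finite node \<Rightarrow> 'n node" where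
  "dilate t Q = (center Q - vec (t * snd Q / 2), t * snd Q)"

lemma snd_dilate [simp]: "snd (dilate t Q) = t * snd Q"
  by (simp add: dilate_def)

lemma mem_closed_cube_dilate:
  "x \<in> closed_cube (dilate t Q) \<longleftrightarrow> (\<forall>i. \<bar>x $ i - center Q $ i\<bar> \<le> t * snd Q / 2)"
proof -
  have "(c - r \<le> u \<and> u \<le> c - r + (r + r)) = (\<bar>u - c\<bar> \<le> r)" for u c r :: real by auto
  note this[where r="t * snd Q / 2"]
  then show ?thesis by (simp add: closed_cube_def dilate_def mem_box_cart)
qed

lemma mem_hcube_center: "x \<in> hcube Q \<Longrightarrow> \<bar>x $ i - center Q $ i\<bar> \<le> snd Q / 2"
proof -
  assume "x \<in> hcube Q"
  then have "fst Q $ i \<le> x $ i" "x $ i < fst Q $ i + snd Q" by (auto simp: hcube_def)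
  then have "x $ i - center Q $ i \<le> snd Q / 2" "- (x $ i - center Q $ i) \<le> snd Q / 2"
    by (simp_all add: center_def)
  then show ?thesis by (rule abs_leI)
qed

lemma hcube_subset_dilate:
  assumes "1 \<le> t" "0 < snd Q"
  shows "hcube Q \<subseteq> closed_cube (dilate t Q)"
proof
  fix x assume x: "x \<in> hcube Q"
  have "snd Q / 2 \<le> t * snd Q / 2" using assms by simp
  then show "x \<in> closed_cube (dilate t Q)"
    unfolding mem_closed_cube_dilate using mem_hcube_center[OF x] order_trans by blast
qed

lemma dilate_mono:
  assumes "t \<le> t'" "0 < snd Q"
  shows "closed_cube (dilate t Q) \<subseteq> closed_cube (dilate t' Q)"
proof
  fix x assume x: "x \<in> closed_cube (dilate t Q)"
  have "t * snd Q / 2 \<le> t' * snd Q / 2" using assms by simp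
  then show "x \<in> closed_cube (dilate t' Q)"
    using x unfolding mem_closed_cube_dilate using order_trans by blast
qed

lemma emeasure_closed_cube:
  fixes Q :: "'n::finite node"
  shows "0 \<le> snd Q \<Longrightarrow> emeasure lebesgue (closed_cube Q) = ennreal (snd Q ^ CARD('n))"
  unfolding closed_cube_def by (rule emeasure_cbox_cube)

lemma closed_cube_sets [measurable]: "closed_cube Q \<in> sets lebesgue"
  by (simp add: closed_cube_def)

text \<open>The factor \<open>4 n\<close> makes points outside the dilated cube farther from the center than twice the
distance of any point of \<open>Q\<close>, so that the regularity of the kernel applies.\<close>

definition concentric :: "'n::finite node \<Rightarrow> nat \<Rightarrow> 'n node" where
  "concentric Q m = dilate (4 * real CARD('n) * 2 ^ m) Q"

lemma snd_concentric: "snd (concentric Q m) = 4 * real CARD('n) * 2 ^ m * snd (Q :: 'n::finite node)"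
  by (simp add: concentric_def)

lemma concentric_pos: "0 < snd Q \<Longrightarrow> 0 < snd (concentric Q m)"
  by (simp add: snd_concentric)

lemma card_pos_real: "1 \<le> real CARD('n::finite)"
  by (simp add: Suc_leI)

lemma concentric_factor: "1 \<le> 4 * real CARD('n::finite) * 2 ^ m"
  using mult_mono[OF card_pos_real[where 'n='n] one_le_power[of "2::real" m]] by simp

lemma hcube_subset_concentric: "0 < snd Q \<Longrightarrow> hcube Q \<subseteq> closed_cube (concentric Q m)"
  unfolding concentric_def by (rule hcube_subset_dilate[OF concentric_factor])

lemma concentric_mono: "0 < snd Q \<Longrightarrow> m \<le> m' \<Longrightarrow> closed_cube (concentric Q m) \<subseteq> closed_cube (concentric Q m')"
  unfolding concentric_def by (rule dilate_mono) (auto intro!: mult_left_mono power_increasing)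

lemma closed_cube_subset_concentric: "0 < snd (Q::'n::finite node) \<Longrightarrow> closed_cube Q \<subseteq> closed_cube (concentric Q m)"
proof -
  assume Q: "0 < snd Q"
  have "Q = dilate 1 Q" by (simp add: dilate_def center_def prod_eq_iff)
  then have "closed_cube Q = closed_cube (dilate 1 Q)" by simp
  also have "\<dots> \<subseteq> closed_cube (concentric Q m)" unfolding concentric_def by (rule dilate_mono[OF concentric_factor Q])
  finally show ?thesis .
qed

lemma concentric_covers:
  fixes Q :: "'n::finite node"
  assumes "0 < snd Q"
  shows "\<exists>m. x \<in> closed_cube (concentric Q m)"
proof -
  define r where "r = norm (x - center Q)"
  obtain m where m: "2 * r / snd Q < 2 ^ m" using real_arch_pow[of 2 "2 * r / snd Q"] by auto
  have "r \<le> 2 ^ m * snd Q / 2" using m assms by (simp add: field_simps)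
  also have "\<dots> = 1 * (2 ^ m * snd Q / 2)" by simp
  also have "\<dots> \<le> (4 * real CARD('n)) * (2 ^ m * snd Q / 2)"
    using card_pos_real[where 'n='n] assms by (intro mult_right_mono) (linarith, simp)
  also have "\<dots> = (4 * real CARD('n) * 2 ^ m) * snd Q / 2" by simp
  finally have "\<bar>x $ i - center Q $ i\<bar> \<le> (4 * real CARD('n) * 2 ^ m) * snd Q / 2" for i
    using component_le_norm_cart[of "x - center Q" i] by (simp add: r_def)
  then show ?thesis by (auto simp: concentric_def mem_closed_cube_dilate)
qed

text \<open>A majorant for differences of the kernel, in both variables, that is integrable with integral
\<open>1/(1 - q)\<close> and whose integral against \<open>F\<close> is a sum of averages of \<open>F\<close>.\<close>

definition bump :: "real \<Rightarrow> 'n::finite node \<Rightarrow> real^'n \<Rightarrow> ennreal" where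
  "bump q Q y = (\<Sum>m. ennreal (q ^ m) * (indicator (closed_cube (concentric Q m)) y / emeasure lebesgue (closed_cube (concentric Q m))))"

definition tail_average :: "real \<Rightarrow> 'n::finite node \<Rightarrow> (real^'n \<Rightarrow> ennreal) \<Rightarrow> ennreal" where
  "tail_average q Q F = (\<Sum>m. ennreal (q ^ m) * average (closed_cube (concentric Q m)) F)"

lemma bump_measurable [measurable]: "bump q Q \<in> borel_measurable lebesgue"
  unfolding bump_def by measurable

lemma nn_integral_bump:
  assumes [measurable]: "F \<in> borel_measurable lebesgue"
  shows "(\<integral>\<^sup>+y. F y * bump q Q y \<partial>lebesgue) = tail_average q Q F"
proof -
  have "(\<integral>\<^sup>+y. F y * bump q Q y \<partial>lebesgue) =
     (\<integral>\<^sup>+y. (\<Sum>m. ennreal (q ^ m) * (F y * indicator (closed_cube (concentric Q m)) y / emeasure lebesgue (closed_cube (concentric Q m)))) \<partial>lebesgue)"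
    unfolding bump_def by (simp add: ennreal_times_divide mult_ac flip: ennreal_suminf_cmult)
  also have "\<dots> = (\<Sum>m. \<integral>\<^sup>+y. ennreal (q ^ m) * (F y * indicator (closed_cube (concentric Q m)) y / emeasure lebesgue (closed_cube (concentric Q m))) \<partial>lebesgue)"
    by (rule nn_integral_suminf) measurable
  also have "\<dots> = tail_average q Q F"
    unfolding tail_average_def average_def
    by (intro suminf_cong) (subst nn_integral_cmult, measurable, subst nn_integral_divide, auto)
  finally show ?thesis .
qed

lemma geometric_ennreal:
  assumes "0 \<le> q" "q < 1"
  shows "(\<Sum>m. ennreal (q ^ m)) = ennreal (1 / (1 - q))"
  using assms by (subst suminf_ennreal2) (auto simp: suminf_geometric summable_geometric)

lemma nn_integral_bump_1:
  assumes "0 \<le> q" "q < 1" "0 < snd Q"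
  shows "(\<integral>\<^sup>+y. bump q Q y \<partial>lebesgue) = ennreal (1 / (1 - q))"
proof -
  have "(\<integral>\<^sup>+y. bump q Q y \<partial>lebesgue) = tail_average q Q (\<lambda>_. 1)"
    using nn_integral_bump[of "\<lambda>_. 1" q Q] by simp
  also have "\<dots> = (\<Sum>m. ennreal (q ^ m))"
    unfolding tail_average_def using assms by (simp add: average_const closed_cube_in_cubes concentric_pos)
  also have "\<dots> = ennreal (1 / (1 - q))" by (rule geometric_ennreal[OF assms(1,2)])
  finally show ?thesis .
qed

lemma tail_average_le_maximal2:
  assumes "0 \<le> q" "q < 1" "0 < snd Q" "x \<in> hcube Q"
  shows "tail_average q Q F \<le> ennreal (1 / (1 - q)) * hl_maximal (hl_maximal F) x"
proof -
  have "tail_average q Q F \<le> (\<Sum>m. ennreal (q ^ m) * hl_maximal (hl_maximal F) x)"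
    unfolding tail_average_def
  proof (intro suminf_le summableI mult_left_mono average_le_maximal2 closed_cube_in_cubes concentric_pos assms)
    show "x \<in> closed_cube (concentric Q m)" for m using hcube_subset_concentric[OF assms(3)] assms(4) by blast
  qed auto
  also have "\<dots> = ennreal (1 / (1 - q)) * hl_maximal (hl_maximal F) x"
    unfolding ennreal_suminf_multc geometric_ennreal[OF assms(1,2)] ..
  finally show ?thesis .
qed

lemma average_le_tail_average:
  shows "average (closed_cube (concentric Q 0)) F \<le> tail_average q Q F"
  using sum_le_suminf[OF summableI, of "{0}" "\<lambda>m. ennreal (q ^ m) * average (closed_cube (concentric Q m)) F"]
  by (simp add: tail_average_def)

text \<open>The mean over \<open>Q\<close> of \<open>b\<close> minus its mean over \<open>P\<close> is at most the mean oscillation over \<open>P\<close> times the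
ratio of the measures.\<close>

lemma cube_mean_diff:
  fixes P Q :: "'n::finite node"
  assumes b: "b \<in> BMO" and Q: "0 < snd Q" and P: "0 < snd P" and sub: "closed_cube Q \<subseteq> closed_cube P"
  shows "norm (cube_mean b Q - cube_mean b P) \<le> (snd P / snd Q) ^ CARD('n) * enn2real (BMO_norm b)"
proof -
  define \<beta> where "\<beta> = enn2real (BMO_norm b)"
  have \<beta>: "0 \<le> \<beta>" "BMO_norm b = ennreal \<beta>" using BMO_D(4)[OF b] by (auto simp: \<beta>_def)
  let ?c = "cube_mean b P"
  let ?Q = "closed_cube Q"
  have mQ: "measure lebesgue ?Q = snd Q ^ CARD('n)" using Q by (simp add: measure_def emeasure_closed_cube)
  have fQ: "?Q \<in> lmeasurable" using Q by (intro fmeasurableI) (auto simp: emeasure_closed_cube)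
  have ib: "set_integrable lebesgue ?Q b" by (rule BMO_D(2)[OF b closed_cube_in_cubes[OF Q]])
  have ic: "set_integrable lebesgue ?Q (\<lambda>_. ?c)"
    unfolding set_integrable_def using fQ by (intro integrable_scaleR_left) (auto simp: integrable_real_indicator fmeasurable_def)
  have id: "set_integrable lebesgue ?Q (\<lambda>x. b x - ?c)" by (rule set_integral_diff(1)[OF ib ic])
  have "(LINT x:?Q|lebesgue. b x - ?c) = (LINT x:?Q|lebesgue. b x) - (LINT x:?Q|lebesgue. ?c)"
    by (rule set_integral_diff(2)[OF ib ic])
  also have "(LINT x:?Q|lebesgue. ?c) = of_real (measure lebesgue ?Q) * ?c"
    unfolding set_lebesgue_integral_def using fQ by (simp add: scaleR_conv_of_real fmeasurable_def)
  also have "(LINT x:?Q|lebesgue. b x) = of_real (measure lebesgue ?Q) * cube_mean b Q"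
    using Q mQ by (simp add: cube_mean_def mean_value_def)
  finally have "(LINT x:?Q|lebesgue. b x - ?c) = of_real (measure lebesgue ?Q) * (cube_mean b Q - ?c)"
    by (simp add: algebra_simps)
  then have "ennreal (measure lebesgue ?Q * norm (cube_mean b Q - ?c)) = ennreal (norm (LINT x:?Q|lebesgue. b x - ?c))"
    by (simp add: norm_mult)
  also have "\<dots> \<le> (\<integral>\<^sup>+x. ennreal (norm (indicator ?Q x *\<^sub>R (b x - ?c))) \<partial>lebesgue)"
    unfolding set_lebesgue_integral_def by (rule integral_norm_bound_ennreal) (use id in \<open>simp add: set_integrable_def\<close>)
  also have "\<dots> \<le> (\<integral>\<^sup>+x\<in>closed_cube P. ennreal (norm (b x - ?c)) \<partial>lebesgue)"
    using sub by (intro nn_integral_mono) (auto simp: indicator_def)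
  also have "\<dots> = (\<integral>\<^sup>+x\<in>hcube P. ennreal (norm (b x - ?c)) \<partial>lebesgue)"
    using P by (intro nn_integral_closed_cube) simp
  also have "\<dots> \<le> BMO_norm b * emeasure lebesgue (hcube P)" by (rule BMO_hcube[OF b P])
  also have "\<dots> = ennreal (\<beta> * snd P ^ CARD('n))" using P \<beta> by (simp add: emeasure_hcube ennreal_mult)
  finally have "snd Q ^ CARD('n) * norm (cube_mean b Q - ?c) \<le> \<beta> * snd P ^ CARD('n)"
    using P \<beta> mQ by (simp add: ennreal_le_iff)
  then show ?thesis using Q by (simp add: \<beta>_def field_simps power_divide)
qed

text \<open>Each doubling of the side changes the mean by a bounded multiple of the norm, so the means over
concentric cubes grow at most linearly in the number of doublings.\<close>

lemma cube_mean_concentric: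
  fixes Q :: "'n::finite node"
  assumes b: "b \<in> BMO" and Q: "0 < snd Q"
  shows "norm (cube_mean b Q - cube_mean b (concentric Q m))
    \<le> (4 * real CARD('n)) ^ CARD('n) * (real m + 1) * enn2real (BMO_norm b)"
proof (induction m)
  case 0
  from cube_mean_diff[OF b Q concentric_pos[OF Q] closed_cube_subset_concentric[OF Q, of 0]] show ?case using Q by (simp add: snd_concentric)
next
  case (Suc m)
  have "norm (cube_mean b (concentric Q m) - cube_mean b (concentric Q (Suc m))) \<le>
     (snd (concentric Q (Suc m)) / snd (concentric Q m)) ^ CARD('n) * enn2real (BMO_norm b)"
    by (intro cube_mean_diff[OF b] concentric_pos Q concentric_mono) auto
  also have "snd (concentric Q (Suc m)) / snd (concentric Q m) = 2" using Q by (simp add: snd_concentric)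
  also have "2 ^ CARD('n) * enn2real (BMO_norm b) \<le> (4 * real CARD('n)) ^ CARD('n) * enn2real (BMO_norm b)"
    using card_pos_real[where 'n='n] by (intro mult_right_mono power_mono enn2real_nonneg) linarith+
  finally have "norm (cube_mean b (concentric Q m) - cube_mean b (concentric Q (Suc m))) \<le>
     (4 * real CARD('n)) ^ CARD('n) * enn2real (BMO_norm b)" .
  then show ?case
    using Suc norm_triangle_ineq[of "cube_mean b Q - cube_mean b (concentric Q m)" "cube_mean b (concentric Q m) - cube_mean b (concentric Q (Suc m))"]
    by (simp add: algebra_simps)
qed

text \<open>The linear growth of the means of \<open>b\<close> is summable against \<open>q\<^sup>m\<close>, and the oscillation of \<open>b\<close> around its
mean over each concentric cube is controlled by \<open>BMO_product_bound\<close>.\<close>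

lemma tail_average_BMO:
  fixes b :: "real^'n \<Rightarrow> complex"
  assumes b: "b \<in> BMO" and q: "0 \<le> q" "q < 1" and Q: "0 < snd Q" and x: "x \<in> hcube Q"
    and F [measurable]: "F \<in> borel_measurable lebesgue"
  shows "tail_average q Q (\<lambda>y. ennreal (norm (b y - cube_mean b Q)) * F y)
    \<le> ennreal ((2 ^ (CARD('n) + 6) + (4 * real CARD('n)) ^ CARD('n)) / (1 - q)\<^sup>2) * BMO_norm b * hl_maximal (hl_maximal F) x"
proof -
  define \<beta> where "\<beta> = enn2real (BMO_norm b)"
  have \<beta>: "0 \<le> \<beta>" "BMO_norm b = ennreal \<beta>" using BMO_D(4)[OF b] by (auto simp: \<beta>_def)
  have [measurable]: "b \<in> borel_measurable lebesgue" using BMO_D(1)[OF b] .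
  define C where "C = (2::real) ^ (CARD('n) + 6)"
  define D where "D = (4 * real CARD('n)) ^ CARD('n)"
  have CD: "0 \<le> C" "0 \<le> D" by (auto simp: C_def D_def)
  let ?M = "hl_maximal (hl_maximal F) x"
  have concentric_le: "average (closed_cube (concentric Q m)) (\<lambda>y. ennreal (norm (b y - cube_mean b Q)) * F y)
     \<le> ennreal ((C + D) * (real m + 1) * \<beta>) * ?M" for m
  proof -
    let ?R = "concentric Q m"
    have R: "0 < snd ?R" by (rule concentric_pos[OF Q])
    have cu: "closed_cube ?R \<in> cubes" by (rule closed_cube_in_cubes[OF R])
    have xR: "x \<in> closed_cube ?R" using hcube_subset_concentric[OF Q] x by blast
    let ?v = "ennreal (snd ?R ^ CARD('n))"
    have "(\<integral>\<^sup>+y\<in>hcube ?R. ennreal (norm (b y - cube_mean b Q)) * F y \<partial>lebesgue)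
       \<le> (\<integral>\<^sup>+y. ennreal (norm (b y - cube_mean b ?R)) * F y * indicator (hcube ?R) y
            + ennreal (D * (real m + 1) * \<beta>) * (F y * indicator (hcube ?R) y) \<partial>lebesgue)"
    proof (intro nn_integral_mono)
      fix y
      have "norm (b y - cube_mean b Q) \<le> norm (b y - cube_mean b ?R) + norm (cube_mean b Q - cube_mean b ?R)"
        using norm_triangle_ineq4[of "b y - cube_mean b ?R" "cube_mean b Q - cube_mean b ?R"] by simp
      also have "\<dots> \<le> norm (b y - cube_mean b ?R) + D * (real m + 1) * \<beta>"
        using cube_mean_concentric[OF b Q, of m] by (simp add: D_def \<beta>_def)
      finally have "ennreal (norm (b y - cube_mean b Q)) \<le> ennreal (norm (b y - cube_mean b ?R)) + ennreal (D * (real m + 1) * \<beta>)"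
        using CD \<beta> by (simp flip: ennreal_plus add: ennreal_leI)
      then have "ennreal (norm (b y - cube_mean b Q)) * (F y * indicator (hcube ?R) y) \<le> (ennreal (norm (b y - cube_mean b ?R)) + ennreal (D * (real m + 1) * \<beta>)) * (F y * indicator (hcube ?R) y)"
        by (rule mult_right_mono) simp
      then show "ennreal (norm (b y - cube_mean b Q)) * F y * indicator (hcube ?R) y \<le>
         ennreal (norm (b y - cube_mean b ?R)) * F y * indicator (hcube ?R) y
            + ennreal (D * (real m + 1) * \<beta>) * (F y * indicator (hcube ?R) y)"
        by (simp add: algebra_simps)
    qed
    also have "\<dots> = (\<integral>\<^sup>+y\<in>hcube ?R. ennreal (norm (b y - cube_mean b ?R)) * F y \<partial>lebesgue)
        + ennreal (D * (real m + 1) * \<beta>) * (\<integral>\<^sup>+y\<in>hcube ?R. F y \<partial>lebesgue)"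
      by (subst nn_integral_add) (auto simp: nn_integral_cmult)
    also have "\<dots> \<le> ennreal C * BMO_norm b * (\<integral>\<^sup>+y\<in>hcube ?R. hl_maximal F y \<partial>lebesgue)
        + ennreal (D * (real m + 1) * \<beta>) * (\<integral>\<^sup>+y\<in>hcube ?R. F y \<partial>lebesgue)"
      unfolding C_def by (intro add_right_mono BMO_product_bound b F R)
    also have "(\<integral>\<^sup>+y\<in>hcube ?R. hl_maximal F y \<partial>lebesgue) = average (closed_cube ?R) (hl_maximal F) * emeasure lebesgue (hcube ?R)"
      by (rule average_mult_emeasure[OF R, symmetric])
    also have "(\<integral>\<^sup>+y\<in>hcube ?R. F y \<partial>lebesgue) = average (closed_cube ?R) F * emeasure lebesgue (hcube ?R)"
      by (rule average_mult_emeasure[OF R, symmetric])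
    also have "ennreal C * BMO_norm b * (average (closed_cube ?R) (hl_maximal F) * emeasure lebesgue (hcube ?R)) +
        ennreal (D * (real m + 1) * \<beta>) * (average (closed_cube ?R) F * emeasure lebesgue (hcube ?R))
      \<le> ennreal (C * (real m + 1) * \<beta>) * (?M * emeasure lebesgue (hcube ?R)) +
        ennreal (D * (real m + 1) * \<beta>) * (?M * emeasure lebesgue (hcube ?R))"
    proof (intro add_mono mult_mono mult_right_mono mult_left_mono)
      have "C * \<beta> * 1 \<le> C * \<beta> * (real m + 1)" using CD \<beta>(1) by (intro mult_left_mono) auto
      then show "ennreal C * BMO_norm b \<le> ennreal (C * (real m + 1) * \<beta>)"
        using CD \<beta> by (simp add: mult_ac ennreal_leI flip: ennreal_mult)
      show "average (closed_cube ?R) (hl_maximal F) \<le> ?M" by (rule average_le_maximal[OF cu xR])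
      show "average (closed_cube ?R) F \<le> ?M" by (rule average_le_maximal2[OF cu xR])
    qed auto
    also have "\<dots> = ennreal ((C + D) * (real m + 1) * \<beta>) * ?M * emeasure lebesgue (hcube ?R)"
      using CD \<beta>(1) by (simp add: ennreal_plus distrib_right mult.assoc)
    finally have "(\<integral>\<^sup>+y\<in>hcube ?R. ennreal (norm (b y - cube_mean b Q)) * F y \<partial>lebesgue) / ?v
       \<le> ennreal ((C + D) * (real m + 1) * \<beta>) * ?M * ?v / ?v"
      using R by (intro divide_right_mono_ennreal) (simp add: emeasure_hcube)
    then show ?thesis using R by (simp add: average_closed_cube mult_divide_eq_ennreal)
  qed
  have "tail_average q Q (\<lambda>y. ennreal (norm (b y - cube_mean b Q)) * F y) \<le>
     (\<Sum>m. ennreal (q ^ m) * (ennreal ((C + D) * (real m + 1) * \<beta>) * ?M))"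
    unfolding tail_average_def by (intro suminf_le summableI mult_left_mono concentric_le) auto
  also have "\<dots> = (\<Sum>m. ennreal ((C + D) * \<beta> * (real (Suc m) * q ^ m))) * ?M"
    using CD \<beta>(1) q by (simp add: mult_ac add_ac flip: ennreal_suminf_multc ennreal_mult')
  also have "(\<Sum>m. ennreal ((C + D) * \<beta> * (real (Suc m) * q ^ m))) = ennreal ((C + D) * \<beta> * (1 / (1 - q)\<^sup>2))"
  proof -
    have "(\<lambda>m. real (Suc m) * q ^ m) sums (1 / (1 - q)\<^sup>2)"
      using geometric_deriv_sums[of q] q by simp
    then have "(\<lambda>m. (C + D) * \<beta> * (real (Suc m) * q ^ m)) sums ((C + D) * \<beta> * (1 / (1 - q)\<^sup>2))"
      by (rule sums_mult)
    then show ?thesis using CD \<beta>(1) q by (intro suminf_ennreal_eq) auto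
  qed
  finally show ?thesis using \<beta> CD by (simp add: C_def D_def mult_ac flip: ennreal_mult')
qed

section \<open>Calderon-Zygmund operators\<close>

lemma L2_measurable: "f \<in> L2 \<Longrightarrow> f \<in> borel_measurable lebesgue"
  by (simp add: L2_def)

lemma L2_I:
  assumes f [measurable]: "f \<in> borel_measurable lebesgue" and "(\<integral>\<^sup>+x. ennreal ((norm (f x))\<^sup>2) \<partial>lebesgue) < \<infinity>"
  shows "f \<in> L2"
  unfolding L2_def using assms by (auto intro!: integrableI_nonneg)

lemma L2_nn_integral:
  assumes "f \<in> L2"
  shows "(\<integral>\<^sup>+x. ennreal ((norm (f x))\<^sup>2) \<partial>lebesgue) = ennreal ((L2_norm f)\<^sup>2)"
proof -
  have i: "integrable lebesgue (\<lambda>x. (norm (f x))\<^sup>2)" using assms by (simp add: L2_def)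
  have "(\<integral>\<^sup>+x. ennreal ((norm (f x))\<^sup>2) \<partial>lebesgue) = ennreal (LINT x|lebesgue. (norm (f x))\<^sup>2)"
    by (rule nn_integral_eq_integral[OF i]) simp
  also have "(LINT x|lebesgue. (norm (f x))\<^sup>2) = (L2_norm f)\<^sup>2"
    unfolding L2_norm_def by (rule real_sqrt_pow2[symmetric]) simp
  finally show ?thesis .
qed

lemma L2_dominated:
  assumes g: "g \<in> L2" and f [measurable]: "f \<in> borel_measurable lebesgue" and le: "\<And>x. norm (f x) \<le> norm (g x)"
  shows "f \<in> L2"
proof (rule L2_I[OF f])
  have "(\<integral>\<^sup>+x. ennreal ((norm (f x))\<^sup>2) \<partial>lebesgue) \<le> (\<integral>\<^sup>+x. ennreal ((norm (g x))\<^sup>2) \<partial>lebesgue)"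
    using le by (intro nn_integral_mono ennreal_leI power_mono) auto
  then show "(\<integral>\<^sup>+x. ennreal ((norm (f x))\<^sup>2) \<partial>lebesgue) < \<infinity>"
    unfolding L2_nn_integral[OF g] by (rule le_less_trans) simp
qed

lemma L2_add:
  assumes f: "f \<in> L2" and g: "g \<in> L2"
  shows "(\<lambda>x. f x + g x) \<in> L2"
proof (rule L2_I)
  note [measurable] = L2_measurable[OF f] L2_measurable[OF g]
  show "(\<lambda>x. f x + g x) \<in> borel_measurable lebesgue" by measurable
  have "(\<integral>\<^sup>+x. ennreal ((norm (f x + g x))\<^sup>2) \<partial>lebesgue) \<le>
    (\<integral>\<^sup>+x. 2 * ennreal ((norm (f x))\<^sup>2) + 2 * ennreal ((norm (g x))\<^sup>2) \<partial>lebesgue)"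
  proof (intro nn_integral_mono)
    fix x
    have "(norm (f x + g x))\<^sup>2 \<le> (norm (f x) + norm (g x))\<^sup>2"
      by (intro power_mono norm_triangle_ineq) simp
    also have "\<dots> \<le> 2 * (norm (f x))\<^sup>2 + 2 * (norm (g x))\<^sup>2"
      using sum_squares_bound[of "norm (f x)" "norm (g x)"] by (simp add: power2_sum)
    finally have "ennreal ((norm (f x + g x))\<^sup>2) \<le> ennreal (2 * (norm (f x))\<^sup>2 + 2 * (norm (g x))\<^sup>2)"
      by (rule ennreal_leI)
    also have "\<dots> = 2 * ennreal ((norm (f x))\<^sup>2) + 2 * ennreal ((norm (g x))\<^sup>2)"
      by (simp add: ennreal_plus ennreal_mult)
    finally show "ennreal ((norm (f x + g x))\<^sup>2) \<le> 2 * ennreal ((norm (f x))\<^sup>2) + 2 * ennreal ((norm (g x))\<^sup>2)" .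
  qed
  also have "\<dots> = 2 * ennreal ((L2_norm f)\<^sup>2) + 2 * ennreal ((L2_norm g)\<^sup>2)"
    by (subst nn_integral_add) (auto simp: nn_integral_cmult L2_nn_integral f g)
  also have "\<dots> < \<infinity>" by (simp add: ennreal_mult_less_top)
  finally show "(\<integral>\<^sup>+x. ennreal ((norm (f x + g x))\<^sup>2) \<partial>lebesgue) < \<infinity>" .
qed

lemma L2_cmult:
  assumes f: "f \<in> L2"
  shows "(\<lambda>x. c * f x) \<in> L2"
proof (rule L2_I)
  note [measurable] = L2_measurable[OF f]
  show "(\<lambda>x. c * f x) \<in> borel_measurable lebesgue" by measurable
  have "(\<integral>\<^sup>+x. ennreal ((norm (c * f x))\<^sup>2) \<partial>lebesgue) = (\<integral>\<^sup>+x. ennreal ((norm c)\<^sup>2) * ennreal ((norm (f x))\<^sup>2) \<partial>lebesgue)"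
    by (simp add: norm_mult power_mult_distrib ennreal_mult)
  also have "\<dots> < \<infinity>" by (simp add: nn_integral_cmult L2_nn_integral f ennreal_mult_less_top)
  finally show "(\<integral>\<^sup>+x. ennreal ((norm (c * f x))\<^sup>2) \<partial>lebesgue) < \<infinity>" .
qed

lemma L2_zero: "(\<lambda>x. 0) \<in> L2"
  by (rule L2_I) auto

lemma L2_sum: "finite F \<Longrightarrow> (\<And>j. j \<in> F \<Longrightarrow> h j \<in> L2) \<Longrightarrow> (\<lambda>x. \<Sum>j\<in>F. h j x) \<in> L2"
  by (induction F rule: finite_induct) (auto intro: L2_zero L2_add)

lemma L2_diff:
  assumes "f \<in> L2" "g \<in> L2"
  shows "(\<lambda>x. f x - g x) \<in> L2"
  using L2_add[OF assms(1) L2_cmult[OF assms(2), of "-1"]] by simp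

lemma L2_restrict:
  assumes "f \<in> L2" "S \<in> sets lebesgue"
  shows "(\<lambda>x. indicator S x * f x) \<in> L2"
  using L2_measurable[OF assms(1)] assms(2)
  by (intro L2_dominated[OF assms(1)]) (auto simp: indicator_def)

lemma L2_integrable_on_bounded:
  fixes f :: "real^'n \<Rightarrow> complex"
  assumes f: "f \<in> L2" and S: "S \<in> lmeasurable" and off: "\<And>x. x \<notin> S \<Longrightarrow> f x = 0"
  shows "integrable lebesgue f"
proof -
  have i: "integrable lebesgue (\<lambda>x. indicator S x + (norm (f x))\<^sup>2)"
    using f S by (intro Bochner_Integration.integrable_add) (auto simp: L2_def fmeasurable_def integrable_real_indicator)
  show ?thesis
  proof (rule Bochner_Integration.integrable_bound[OF i L2_measurable[OF f]], rule AE_I2)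
    fix x
    have "t \<le> 1 + t\<^sup>2" for t :: real
      using zero_le_power2[of "t - 1/2"] by (simp add: power2_diff power_divide) 
    from this[of "norm (f x)"] show "norm (f x) \<le> norm (indicator S x + (norm (f x))\<^sup>2)"
      using off[of x] by (cases "x \<in> S") auto
  qed
qed

text \<open>The data of a Calderon-Zygmund operator with its constants fixed, so that later constants depend on
these and on the dimension only.\<close>

locale cz_operator =
  fixes T :: "(real^'n \<Rightarrow> complex) \<Rightarrow> (real^'n \<Rightarrow> complex)" and K :: "real^'n \<Rightarrow> real^'n \<Rightarrow> complex"
    and B C \<delta> :: real
  assumes T_L2: "f \<in> L2 \<Longrightarrow> T f \<in> L2"
    and T_add: "f \<in> L2 \<Longrightarrow> g \<in> L2 \<Longrightarrow> AE x in lebesgue. T (\<lambda>y. f y + g y) x = T f x + T g x"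
    and T_scale: "f \<in> L2 \<Longrightarrow> AE x in lebesgue. T (\<lambda>y. c * f y) x = c * T f x"
    and T_bound: "f \<in> L2 \<Longrightarrow> L2_norm (T f) \<le> B * L2_norm f"
    and B: "0 \<le> B" and C: "0 \<le> C" and \<delta>: "0 < \<delta>"
    and size: "x \<noteq> y \<Longrightarrow> norm (K x y) \<le> C / dist x y ^ CARD('n)"
    and regularity1: "2 * dist x x' < dist x y \<Longrightarrow>
       norm (K x y - K x' y) \<le> C * dist x x' powr \<delta> / dist x y powr (real CARD('n) + \<delta>)"
    and regularity2: "2 * dist y y' < dist x y \<Longrightarrow>
       norm (K x y - K x y') \<le> C * dist y y' powr \<delta> / dist x y powr (real CARD('n) + \<delta>)"
    and kernel: "f \<in> L2 \<Longrightarrow> compact (support f) \<Longrightarrow>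
       AE x in lebesgue. x \<notin> support f \<longrightarrow> T f x = (LINT y|lebesgue. K x y * f y)"

lemma Calderon_Zygmund_operatorE:
  fixes T :: "(real^'n \<Rightarrow> complex) \<Rightarrow> (real^'n \<Rightarrow> complex)"
  assumes "Calderon_Zygmund_operator T"
  obtains K B C \<delta> where "cz_operator T K B C \<delta>"
proof -
  obtain K where lin: "bounded_linear_on_L2 T" and K: "standard_kernel K" "associated_kernel T K"
    using assms by (auto simp: Calderon_Zygmund_operator_def)
  obtain B where B: "\<And>f. f \<in> L2 \<Longrightarrow> L2_norm (T f) \<le> B * L2_norm f"
    using lin unfolding bounded_linear_on_L2_def by blast
  obtain C \<delta> where c: "0 < \<delta>"
     "\<And>x y. x \<noteq> y \<Longrightarrow> norm (K x y) \<le> C / dist x y ^ CARD('n)"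
     "\<And>x x' y. 2 * dist x x' < dist x y \<Longrightarrow>
        norm (K x y - K x' y) \<le> C * dist x x' powr \<delta> / dist x y powr (real CARD('n) + \<delta>)"
     "\<And>x y y'. 2 * dist y y' < dist x y \<Longrightarrow>
        norm (K x y - K x y') \<le> C * dist y y' powr \<delta> / dist x y powr (real CARD('n) + \<delta>)"
    using K(1) unfolding standard_kernel_def by blast
  have N: "0 \<le> L2_norm f" for f :: "real^'n \<Rightarrow> complex" by (simp add: L2_norm_def)
  have "cz_operator T K \<bar>B\<bar> \<bar>C\<bar> \<delta>"
  proof
    show "f \<in> L2 \<Longrightarrow> L2_norm (T f) \<le> \<bar>B\<bar> * L2_norm f" for f
      by (rule order_trans[OF B mult_right_mono[OF abs_ge_self N]])
    show "x \<noteq> y \<Longrightarrow> norm (K x y) \<le> \<bar>C\<bar> / dist x y ^ CARD('n)" for x y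
      by (rule order_trans[OF c(2) divide_right_mono[OF abs_ge_self]]) auto
    show "2 * dist x x' < dist x y \<Longrightarrow>
       norm (K x y - K x' y) \<le> \<bar>C\<bar> * dist x x' powr \<delta> / dist x y powr (real CARD('n) + \<delta>)" for x x' y
      by (rule order_trans[OF c(3) divide_right_mono[OF mult_right_mono[OF abs_ge_self]]]) auto
    show "2 * dist y y' < dist x y \<Longrightarrow>
       norm (K x y - K x y') \<le> \<bar>C\<bar> * dist y y' powr \<delta> / dist x y powr (real CARD('n) + \<delta>)" for x y y'
      by (rule order_trans[OF c(4) divide_right_mono[OF mult_right_mono[OF abs_ge_self]]]) auto
  qed (use lin K(2) c(1) in \<open>auto simp: bounded_linear_on_L2_def associated_kernel_def\<close>)
  then show ?thesis by (rule that)
qed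

lemma concentric_complement_dist:
  fixes Q :: "'n::finite node"
  assumes "y \<notin> closed_cube (concentric Q k)"
  shows "2 * real CARD('n) * 2 ^ k * snd Q < dist (center Q) y"
proof -
  obtain i where "\<not> \<bar>y $ i - center Q $ i\<bar> \<le> 4 * real CARD('n) * 2 ^ k * snd Q / 2"
    using assms unfolding concentric_def mem_closed_cube_dilate by blast
  then have "2 * real CARD('n) * 2 ^ k * snd Q < \<bar>y $ i - center Q $ i\<bar>" by (simp add: not_le mult_ac)
  also have "\<bar>y $ i - center Q $ i\<bar> \<le> dist (center Q) y"
    using component_le_norm_cart[of "y - center Q" i] by (simp add: dist_norm norm_minus_commute)
  finally show ?thesis .
qed

lemma dist_center:
  fixes Q :: "'n::finite node"
  assumes "x \<in> hcube Q"
  shows "dist x (center Q) \<le> real CARD('n) * snd Q / 2"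
proof -
  have "norm (x - center Q) \<le> (\<Sum>i\<in>UNIV. \<bar>(x - center Q) $ i\<bar>)" by (rule norm_le_l1_cart)
  also have "\<dots> \<le> (\<Sum>i\<in>(UNIV::'n set). snd Q / 2)"
    using mem_hcube_center[OF assms] by (intro sum_mono) simp
  finally show ?thesis by (simp add: dist_norm)
qed

lemma concentric_separation:
  fixes Q :: "'n::finite node"
  assumes Q: "0 < snd Q" and x: "x \<in> hcube Q" and y: "y \<notin> closed_cube (concentric Q 0)"
  shows "2 * dist (center Q) x < dist (center Q) y" "snd Q \<le> dist x y"
proof -
  have n: "1 \<le> real CARD('n)" by (rule card_pos_real)
  have 1: "2 * real CARD('n) * snd Q < dist (center Q) y" using concentric_complement_dist[OF y] by simp
  have 2: "dist (center Q) x \<le> real CARD('n) * snd Q / 2" using dist_center[OF x] by (simp add: dist_commute)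
  have 3: "snd Q \<le> real CARD('n) * snd Q" using mult_right_mono[OF n, of "snd Q"] Q by simp
  have 4: "0 < real CARD('n) * snd Q" using 3 Q by linarith
  show "2 * dist (center Q) x < dist (center Q) y" using 1 2 4 by linarith
  have "dist (center Q) y \<le> dist (center Q) x + dist x y" by (rule dist_triangle)
  then show "snd Q \<le> dist x y" using 1 2 3 4 by linarith
qed

text \<open>Let \<open>m\<close> be the first index for which the concentric cube contains \<open>y\<close>. Then the distance of \<open>y\<close> from
the center is comparable with \<open>2\<^sup>m\<close> times the side of \<open>Q\<close>, and the single term of index \<open>m\<close> suffices.\<close>

lemma bump_lower_bound:
  fixes Q :: "'n::finite node"
  assumes Q: "0 < snd Q" and x: "x \<in> hcube Q" and y: "y \<notin> closed_cube (concentric Q 0)" and \<delta>: "0 < \<delta>" and C: "0 \<le> C"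
  shows "ennreal (C * dist (center Q) x powr \<delta> / dist (center Q) y powr (real CARD('n) + \<delta>))
    \<le> ennreal (C * 4 ^ CARD('n)) * bump (2 powr (-\<delta>)) Q y"
proof -
  let ?n = "CARD('n)" and ?q = "2 powr (-\<delta>)"
  define D where "D = dist (center Q) y"
  define d where "d = dist (center Q) x"
  define m where "m = (LEAST m. y \<in> closed_cube (concentric Q m))"
  have ym: "y \<in> closed_cube (concentric Q m)" unfolding m_def by (rule LeastI_ex[OF concentric_covers[OF Q]])
  have "m \<noteq> 0" using ym y by (metis)
  then obtain k where k: "m = Suc k" by (cases m) auto
  have "y \<notin> closed_cube (concentric Q k)" using not_less_Least[of k "\<lambda>m. y \<in> closed_cube (concentric Q m)"] k m_def by auto
  then have D: "2 * real ?n * 2 ^ k * snd Q < D" unfolding D_def by (rule concentric_complement_dist)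
  have d: "0 \<le> d" "d \<le> real ?n * snd Q / 2" using dist_center[OF x] by (auto simp: d_def dist_commute)
  define e where "e = 2 * real ?n * 2 ^ k * snd Q"
  have n: "1 \<le> real ?n" by (rule card_pos_real)
  have e: "0 < e" "e < D" using D Q n by (auto simp: e_def)
  then have Dpos: "0 < D" by simp
  have "d / D \<le> (real ?n * snd Q / 2) / e" using d e by (intro frac_le) auto
  also have "\<dots> = 1 / (4 * 2 ^ k)" using Q n by (simp add: e_def field_simps)
  also have "\<dots> \<le> 1 / 2 ^ m" unfolding k by (intro divide_left_mono) auto
  finally have "(d / D) powr \<delta> \<le> (1 / 2 ^ m) powr \<delta>" using d Dpos \<delta> by (intro powr_mono2) auto
  also have "(1 / 2 ^ m) powr \<delta> = ?q ^ m"
    by (simp add: powr_divide powr_minus_divide power_one_over powr_power powr_powr mult.commute flip: powr_realpow)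
  finally have 1: "(d / D) powr \<delta> \<le> ?q ^ m" .
  have vol: "snd (concentric Q m) ^ ?n = 4 ^ ?n * e ^ ?n"
    by (simp add: snd_concentric e_def k mult_ac flip: power_mult_distrib)
  have 2: "1 / D ^ ?n \<le> 4 ^ ?n / snd (concentric Q m) ^ ?n"
  proof -
    have "1 / D ^ ?n \<le> 1 / e ^ ?n" using e by (intro divide_left_mono power_mono) auto
    then show ?thesis by (simp add: vol)
  qed
  have "d powr \<delta> / D powr (real ?n + \<delta>) = (d / D) powr \<delta> * (1 / D ^ ?n)"
    using d Dpos by (simp add: powr_add powr_divide powr_realpow)
  also have "\<dots> \<le> ?q ^ m * (4 ^ ?n / snd (concentric Q m) ^ ?n)"
    using 1 2 Dpos by (intro mult_mono) auto
  finally have "C * (d powr \<delta> / D powr (real ?n + \<delta>)) \<le> C * (?q ^ m * (4 ^ ?n / snd (concentric Q m) ^ ?n))"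
    using C by (rule mult_left_mono)
  then have "ennreal (C * d powr \<delta> / D powr (real ?n + \<delta>)) \<le> ennreal (C * 4 ^ ?n * (?q ^ m * (1 / snd (concentric Q m) ^ ?n)))"
    by (intro ennreal_leI) (simp add: mult_ac)
  also have "\<dots> = ennreal (C * 4 ^ ?n) * (ennreal (?q ^ m) * (indicator (closed_cube (concentric Q m)) y / emeasure lebesgue (closed_cube (concentric Q m))))"
  proof -
    have v: "0 < snd (concentric Q m) ^ ?n" using concentric_pos[OF Q] by simp
    then have "(indicator (closed_cube (concentric Q m)) y / emeasure lebesgue (closed_cube (concentric Q m)) :: ennreal) = ennreal (1 / snd (concentric Q m) ^ ?n)"
      using ym concentric_pos[OF Q, of m] divide_ennreal[of 1 "snd (concentric Q m) ^ ?n"] by (simp add: emeasure_closed_cube)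
    moreover have "ennreal (C * 4 ^ ?n) * (ennreal (?q ^ m) * ennreal (1 / snd (concentric Q m) ^ ?n)) =
        ennreal (C * 4 ^ ?n) * ennreal (?q ^ m * (1 / snd (concentric Q m) ^ ?n))"
      using v by (subst ennreal_mult) auto
    moreover have "\<dots> = ennreal (C * 4 ^ ?n * (?q ^ m * (1 / snd (concentric Q m) ^ ?n)))"
      using C v by (subst ennreal_mult[symmetric]) auto
    ultimately show ?thesis by simp
  qed
  also have "\<dots> \<le> ennreal (C * 4 ^ ?n) * bump ?q Q y"
    unfolding bump_def
    using sum_le_suminf[OF summableI, of "{m}" "\<lambda>m. ennreal (?q ^ m) * (indicator (closed_cube (concentric Q m)) y / emeasure lebesgue (closed_cube (concentric Q m)))"]
    by (intro mult_left_mono) auto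
  finally show ?thesis by (simp add: D_def d_def)
qed

context cz_operator begin

text \<open>The decay of kernel differences when the distance doubles.\<close>

abbreviation "q \<equiv> 2 powr (- \<delta>)"

lemma q: "0 \<le> q" "q < 1"
  using \<delta> by (auto simp: powr_less_one)

lemma kernel_difference1:
  assumes "0 < snd Q" "x \<in> hcube Q" "y \<notin> closed_cube (concentric Q 0)"
  shows "ennreal (norm (K x y - K (center Q) y)) \<le> ennreal (C * 4 ^ CARD('n)) * bump q Q y"
proof -
  have "norm (K (center Q) y - K x y) \<le> C * dist (center Q) x powr \<delta> / dist (center Q) y powr (real CARD('n) + \<delta>)"
    by (rule regularity1[OF concentric_separation(1)[OF assms]])
  then have "ennreal (norm (K x y - K (center Q) y)) \<le>
      ennreal (C * dist (center Q) x powr \<delta> / dist (center Q) y powr (real CARD('n) + \<delta>))"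
    by (simp add: norm_minus_commute ennreal_leI)
  also have "\<dots> \<le> ennreal (C * 4 ^ CARD('n)) * bump q Q y" by (rule bump_lower_bound[OF assms \<delta> C])
  finally show ?thesis .
qed

lemma kernel_difference2:
  assumes "0 < snd Q" "x \<in> hcube Q" "y \<notin> closed_cube (concentric Q 0)"
  shows "ennreal (norm (K y x - K y (center Q))) \<le> ennreal (C * 4 ^ CARD('n)) * bump q Q y"
proof -
  have "norm (K y (center Q) - K y x) \<le> C * dist (center Q) x powr \<delta> / dist y (center Q) powr (real CARD('n) + \<delta>)"
    by (rule regularity2) (use concentric_separation(1)[OF assms] in \<open>simp add: dist_commute\<close>)
  then have "ennreal (norm (K y x - K y (center Q))) \<le>
      ennreal (C * dist (center Q) x powr \<delta> / dist (center Q) y powr (real CARD('n) + \<delta>))"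
    by (simp add: norm_minus_commute ennreal_leI dist_commute)
  also have "\<dots> \<le> ennreal (C * 4 ^ CARD('n)) * bump q Q y" by (rule bump_lower_bound[OF assms \<delta> C])
  finally show ?thesis .
qed

lemma kernel_continuous: "continuous_on (- {x}) (K x)"
proof -
  have "isCont (K x) y" if y: "y \<noteq> x" for y
  proof -
    define D where "D = dist x y"
    have D: "0 < D" using y by (simp add: D_def)
    have "((\<lambda>y'. K x y' - K x y) \<longlongrightarrow> 0) (at y)"
    proof (rule Lim_null_comparison)
      show "\<forall>\<^sub>F y' in at y. norm (K x y' - K x y) \<le> C * dist y y' powr \<delta> / D powr (real CARD('n) + \<delta>)"
        unfolding eventually_at
      proof (intro exI[of _ "D / 2"] conjI ballI impI)
        fix y' assume "y' \<noteq> y \<and> dist y' y < D / 2"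
        then show "norm (K x y' - K x y) \<le> C * dist y y' powr \<delta> / D powr (real CARD('n) + \<delta>)"
          using regularity2[of y y' x] by (simp add: D_def dist_commute norm_minus_commute)
      qed (use D in auto)
      have "((\<lambda>y'. dist y y' powr \<delta>) \<longlongrightarrow> 0) (at y)"
        using tendsto_dist[OF tendsto_const tendsto_ident_at, of y y UNIV] \<delta>
        by (intro tendsto_zero_powrI[where b=\<delta>]) auto
      then have "((\<lambda>y'. C * dist y y' powr \<delta> / D powr (real CARD('n) + \<delta>)) \<longlongrightarrow> C * 0 / D powr (real CARD('n) + \<delta>)) (at y)"
        using D by (intro tendsto_intros) auto
      then show "((\<lambda>y'. C * dist y y' powr \<delta> / D powr (real CARD('n) + \<delta>)) \<longlongrightarrow> 0) (at y)" by simp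
    qed
    then show ?thesis by (simp add: isCont_def LIM_zero_iff)
  qed
  then show ?thesis by (intro continuous_at_imp_continuous_on) auto
qed

text \<open>Regularity makes the kernel continuous off the diagonal; vanishing of \<open>h\<close> at \<open>x\<close> hides the one point
where nothing is known.\<close>

lemma kernel_times_measurable:
  assumes h [measurable]: "h \<in> borel_measurable lebesgue" and x: "h x = 0"
  shows "(\<lambda>y. K x y * h y) \<in> borel_measurable lebesgue"
proof -
  have "(\<lambda>y. indicator (- {x}) y *\<^sub>R K x y) \<in> borel_measurable borel"
    by (rule borel_measurable_continuous_on_indicator[OF _ kernel_continuous]) simp
  then have [measurable]: "(\<lambda>y. indicator (- {x}) y *\<^sub>R K x y) \<in> borel_measurable lebesgue"
    by (simp add: measurable_completion)
  have "(\<lambda>y. K x y * h y) = (\<lambda>y. (indicator (- {x}) y *\<^sub>R K x y) * h y)"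
    using x by (auto simp: indicator_def)
  moreover have "(\<lambda>y. (indicator (- {x}) y *\<^sub>R K x y) * h y) \<in> borel_measurable lebesgue"
    by (rule borel_measurable_times) fact+
  ultimately show ?thesis by (simp only:)
qed

lemma kernel_times_integrable:
  assumes h: "integrable lebesgue h" and r: "0 < r" and far: "\<And>y. h y \<noteq> 0 \<Longrightarrow> r \<le> dist x y"
  shows "integrable lebesgue (\<lambda>y. K x y * h y)"
proof -
  have i: "integrable lebesgue (\<lambda>y. (C / r ^ CARD('n)) * norm (h y))" using h by simp
  have "h x = 0" using far[of x] r by auto
  show ?thesis
  proof (rule Bochner_Integration.integrable_bound[OF i kernel_times_measurable], rule borel_measurable_integrable[OF h], fact, rule AE_I2)
    fix y
    show "norm (K x y * h y) \<le> norm ((C / r ^ CARD('n)) * norm (h y))"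
    proof (cases "h y = 0")
      case False
      then have d: "r \<le> dist x y" by (rule far)
      then have "norm (K x y) \<le> C / dist x y ^ CARD('n)" using r by (intro size) auto
      also have "\<dots> \<le> C / r ^ CARD('n)" using d r C by (intro divide_left_mono power_mono mult_pos_pos zero_less_power) auto
      finally have "norm (K x y) * norm (h y) \<le> C / r ^ CARD('n) * norm (h y)" by (rule mult_right_mono) simp
      then show ?thesis using C r by (simp add: norm_mult abs_mult)
    qed simp
  qed
qed

lemma T_null:
  assumes f: "f \<in> L2" and 0: "AE x in lebesgue. f x = 0"
  shows "AE x in lebesgue. T f x = 0"
proof -
  have "(\<integral>\<^sup>+x. ennreal ((norm (f x))\<^sup>2) \<partial>lebesgue) = (\<integral>\<^sup>+(x::real^'n). 0 \<partial>lebesgue)"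
    using 0 by (intro nn_integral_cong_AE) (auto elim!: eventually_mono)
  then have "L2_norm f = 0" using L2_nn_integral[OF f] by (simp add: L2_norm_def)
  then have "L2_norm (T f) \<le> 0" using T_bound[OF f] by simp
  moreover have "0 \<le> L2_norm (T f)" by (simp add: L2_norm_def)
  ultimately have "L2_norm (T f) = 0" by simp
  then have "(\<integral>\<^sup>+x. ennreal ((norm (T f x))\<^sup>2) \<partial>lebesgue) = 0" using L2_nn_integral[OF T_L2[OF f]] by simp
  then have "AE x in lebesgue. ennreal ((norm (T f x))\<^sup>2) = 0"
    using L2_measurable[OF T_L2[OF f]] by (subst (asm) nn_integral_0_iff_AE) auto
  then show ?thesis by eventually_elim simp
qed

lemma T_diff:
  assumes f: "f \<in> L2" and g: "g \<in> L2"
  shows "AE x in lebesgue. T (\<lambda>y. f y - g y) x = T f x - T g x"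
proof -
  have eq: "(\<lambda>y. f y - g y) = (\<lambda>y. f y + (-1) * g y)" by simp
  show ?thesis unfolding eq
    using T_add[OF f L2_cmult[OF g, of "-1"]] T_scale[OF g, of "-1"]
    by eventually_elim simp
qed

lemma T_sum:
  assumes "finite F" "\<And>j. j \<in> F \<Longrightarrow> h j \<in> L2"
  shows "AE x in lebesgue. T (\<lambda>y. \<Sum>j\<in>F. h j y) x = (\<Sum>j\<in>F. T (h j) x)"
  using assms
proof (induction F rule: finite_induct)
  case empty
  then show ?case using T_null[OF L2_zero] by simp
next
  case (insert j F)
  have "AE x in lebesgue. T (\<lambda>y. \<Sum>i\<in>F. h i y) x = (\<Sum>i\<in>F. T (h i) x)" using insert by auto
  moreover have "AE x in lebesgue. T (\<lambda>y. h j y + (\<Sum>i\<in>F. h i y)) x = T (h j) x + T (\<lambda>y. \<Sum>i\<in>F. h i y) x"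
    using insert by (intro T_add L2_sum) auto
  ultimately have "AE x in lebesgue. T (\<lambda>y. h j y + (\<Sum>i\<in>F. h i y)) x = T (h j) x + (\<Sum>i\<in>F. T (h i) x)"
    by eventually_elim simp
  then show ?case using insert(1,2) by simp
qed

lemma T_norm_le: "f \<in> L2 \<Longrightarrow>
  (\<integral>\<^sup>+x. ennreal ((norm (T f x))\<^sup>2) \<partial>lebesgue) \<le> ennreal (B\<^sup>2) * (\<integral>\<^sup>+x. ennreal ((norm (f x))\<^sup>2) \<partial>lebesgue)"
proof -
  assume f: "f \<in> L2"
  have "(L2_norm (T f))\<^sup>2 \<le> (B * L2_norm f)\<^sup>2"
    by (rule power_mono[OF T_bound[OF f]]) (simp add: L2_norm_def)
  then show ?thesis
    by (simp add: L2_nn_integral f T_L2 power_mult_distrib ennreal_leI flip: ennreal_mult)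
qed

lemma support_subset_closed_cube:
  assumes "\<And>y. y \<notin> hcube Q \<Longrightarrow> h y = 0"
  shows "support h \<subseteq> closed_cube Q" "compact (support h)"
proof -
  have "closed (closed_cube Q)" unfolding closed_cube_def by (rule closed_cbox)
  moreover have "{x. h x \<noteq> 0} \<subseteq> closed_cube Q" using assms hcube_subset_cbox[of Q] by (auto simp: closed_cube_def)
  ultimately show s: "support h \<subseteq> closed_cube Q" unfolding support_def by (rule closure_minimal[rotated])
  have "bounded (support h)" using s by (rule bounded_subset[rotated]) (simp add: closed_cube_def bounded_cbox)
  then show "compact (support h)" by (simp add: compact_eq_bounded_closed support_def)
qed

text \<open>Because of the vanishing mean, \<open>K x (center Q)\<close> may be subtracted from the kernel.\<close>

lemma T_mean_zero:
  fixes Q :: "'n node"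
  assumes h: "h \<in> L2" and Q: "0 < snd Q" and off: "\<And>y. y \<notin> hcube Q \<Longrightarrow> h y = 0"
    and mean: "(LINT y|lebesgue. h y) = 0"
  shows "AE x in lebesgue. x \<notin> closed_cube (concentric Q 0) \<longrightarrow>
    ennreal (norm (T h x)) \<le> ennreal (C * 4 ^ CARD('n)) * bump q Q x * (\<integral>\<^sup>+y. ennreal (norm (h y)) \<partial>lebesgue)"
proof -
  have "compact (support h)" using off by (rule support_subset_closed_cube(2))
  from kernel[OF h this] show ?thesis
  proof eventually_elim
    fix x assume ker: "x \<notin> support h \<longrightarrow> T h x = (LINT y|lebesgue. K x y * h y)"
    show "x \<notin> closed_cube (concentric Q 0) \<longrightarrow>
      ennreal (norm (T h x)) \<le> ennreal (C * 4 ^ CARD('n)) * bump q Q x * (\<integral>\<^sup>+y. ennreal (norm (h y)) \<partial>lebesgue)"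
    proof
      assume x: "x \<notin> closed_cube (concentric Q 0)"
      have Th: "T h x = (LINT y|lebesgue. K x y * h y)"
        using ker x support_subset_closed_cube(1)[of Q h] off closed_cube_subset_concentric[OF Q, of 0] by blast
      have ih: "integrable lebesgue h"
        using Q off by (intro L2_integrable_on_bounded[OF h hcube_lmeasurable[of Q]]) auto
      have iK: "integrable lebesgue (\<lambda>y. K x y * h y)"
      proof (rule kernel_times_integrable[OF ih Q])
        fix y assume "h y \<noteq> 0"
        then have "y \<in> hcube Q" using off by blast
        then show "snd Q \<le> dist x y" using concentric_separation(2)[OF Q _ x, of y] by (simp add: dist_commute)
      qed
      have ic: "integrable lebesgue (\<lambda>y. K x (center Q) * h y)" using ih by simp
      have "T h x = (LINT y|lebesgue. K x y * h y) - (LINT y|lebesgue. K x (center Q) * h y)" using Th mean by simp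
      also have "\<dots> = (LINT y|lebesgue. K x y * h y - K x (center Q) * h y)"
        by (rule Bochner_Integration.integral_diff[OF iK ic, symmetric])
      finally have "ennreal (norm (T h x)) \<le> (\<integral>\<^sup>+y. ennreal (norm (K x y * h y - K x (center Q) * h y)) \<partial>lebesgue)"
        using integral_norm_bound_ennreal[OF Bochner_Integration.integrable_diff[OF iK ic]] by simp
      also have "\<dots> \<le> (\<integral>\<^sup>+y. ennreal (C * 4 ^ CARD('n)) * bump q Q x * ennreal (norm (h y)) \<partial>lebesgue)"
      proof (intro nn_integral_mono)
        fix y
        show "ennreal (norm (K x y * h y - K x (center Q) * h y)) \<le> ennreal (C * 4 ^ CARD('n)) * bump q Q x * ennreal (norm (h y))"
        proof (cases "y \<in> hcube Q")
          case True
          have "ennreal (norm (K x y * h y - K x (center Q) * h y)) = ennreal (norm (K x y - K x (center Q))) * ennreal (norm (h y))"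
            by (simp add: norm_mult ennreal_mult flip: left_diff_distrib)
          also have "\<dots> \<le> ennreal (C * 4 ^ CARD('n)) * bump q Q x * ennreal (norm (h y))"
            by (intro mult_right_mono kernel_difference2[OF Q True x]) simp
          finally show ?thesis .
        qed (simp add: off)
      qed
      also have "\<dots> = ennreal (C * 4 ^ CARD('n)) * bump q Q x * (\<integral>\<^sup>+y. ennreal (norm (h y)) \<partial>lebesgue)"
        using L2_measurable[OF h] by (intro nn_integral_cmult) measurable
      finally show "ennreal (norm (T h x)) \<le> ennreal (C * 4 ^ CARD('n)) * bump q Q x * (\<integral>\<^sup>+y. ennreal (norm (h y)) \<partial>lebesgue)" .
    qed
qed
qed

end

section \<open>The weak type (1,1) estimate\<close>

text \<open>The stopping cubes of a Calderon-Zygmund decomposition at height \<open>l\<close>. A dyadic cube is selected if the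
average of \<open>|h|\<close> exceeds \<open>l\<close>, or if it is more than half covered by an open set \<open>U\<close> that contains
\<open>{|h| > l}\<close> and has measure at most \<open>2 I / l\<close>. Points outside all selected cubes are not in \<open>U\<close>, so
\<open>|h| \<le> l\<close> there. Finitely many cubes suffice because the remaining ones carry arbitrarily little of the
integral of \<open>|h|\<^sup>2\<close>; with a finite family the operator can be applied term by term.\<close>

lemma calderon_zygmund_cubes:
  fixes h :: "real^'n \<Rightarrow> complex" and R0 :: "'n node"
  assumes h: "h \<in> L2" and R0: "0 < snd R0" and off: "\<And>y. y \<notin> hcube R0 \<Longrightarrow> h y = 0"
    and l: "0 < l" and I: "(\<integral>\<^sup>+x. ennreal (norm (h x)) \<partial>lebesgue) = ennreal I" "0 < I"
  obtains F where "finite F" "\<And>P. P \<in> F \<Longrightarrow> 0 < snd P" "disjoint_family_on hcube F"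
    "(\<Sum>P\<in>F. emeasure lebesgue (hcube P)) \<le> ennreal (5 * I / l)"
    "\<And>P. P \<in> F \<Longrightarrow> (\<integral>\<^sup>+x\<in>hcube P. ennreal (norm (h x)) \<partial>lebesgue) \<le> ennreal (2 ^ CARD('n) * l) * emeasure lebesgue (hcube P)"
    "(\<integral>\<^sup>+x\<in>- (\<Union>P\<in>F. hcube P). ennreal ((norm (h x))\<^sup>2) \<partial>lebesgue) \<le> ennreal (2 * l * I)"
proof -
  let ?e = "emeasure (lebesgue :: (real^'n) measure)"
  note [measurable] = L2_measurable[OF h]
  define E where "E = {x. l < norm (h x)}"
  have Em [measurable]: "E \<in> sets lebesgue"
  proof -
    have "E = {x\<in>space lebesgue. l < norm (h x)}" by (simp add: E_def)
    also have "\<dots> \<in> sets lebesgue" by measurable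
    finally show ?thesis .
  qed
  have eE: "?e E \<le> ennreal (I / l)"
  proof -
    have "ennreal l * ?e E = (\<integral>\<^sup>+x. ennreal l * indicator E x \<partial>lebesgue)" by (simp add: nn_integral_cmult_indicator)
    also have "\<dots> \<le> ennreal I" unfolding I(1)[symmetric]
      by (intro nn_integral_mono) (auto simp: E_def indicator_def intro!: ennreal_leI)
    finally have "ennreal (1 / l) * (ennreal l * ?e E) \<le> ennreal (1 / l) * ennreal I" by (rule mult_left_mono) simp
    also have "ennreal (1 / l) * (ennreal l * ?e E) = ?e E" using l by (simp add: mult.assoc[symmetric] flip: ennreal_mult)
    also have "ennreal (1 / l) * ennreal I = ennreal (I / l)" using l I(2) by (simp flip: ennreal_mult)
    finally show ?thesis .
  qed
  obtain U where U: "open U" "E \<subseteq> U" "U - E \<in> lmeasurable" "?e (U - E) < ennreal (I / l)"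
    using sets_lebesgue_outer_open[OF Em, of "I / l"] l I(2) by auto
  have [measurable]: "U \<in> sets lebesgue" using U(1) by (simp add: borel_open sets_completionI_sets)
  have eU: "?e U \<le> ennreal (2 * I / l)"
  proof -
    have "?e U = ?e E + ?e (U - E)"
      using U(2) by (subst plus_emeasure) (auto intro!: arg_cong[where f="?e"])
    also have "\<dots> \<le> ennreal (I / l) + ennreal (I / l)" using eE U(4) by (intro add_mono) auto
    also have "\<dots> = ennreal (2 * I / l)" using l I(2) by (simp flip: ennreal_plus)
    finally show ?thesis .
  qed
  \<comment> \<open>A root so large that it is not selected itself.\<close>
  define t where "t = max 2 ((4 * I / l + 1) / snd R0)"
  define R where "R = dilate t R0"
  have t: "2 \<le> t" "4 * I / l + 1 \<le> t * snd R0" using R0 by (auto simp: t_def max_def field_simps)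
  have R: "0 < snd R" using t R0 by (simp add: R_def)
  have sub: "hcube R0 \<subseteq> hcube R"
  proof
    fix x assume x: "x \<in> hcube R0"
    have ts: "2 * snd R0 \<le> t * snd R0" using t R0 by (intro mult_right_mono) auto
    have "fst R $ i \<le> x $ i \<and> x $ i < fst R $ i + snd R" for i
    proof -
      have "x $ i - center R0 $ i \<le> snd R0 / 2" "- (x $ i - center R0 $ i) \<le> snd R0 / 2"
        using mem_hcube_center[OF x, of i] by (simp_all only: abs_le_iff)
      then show ?thesis
        using ts R0 unfolding R_def dilate_def fst_conv snd_conv vector_minus_component vec_component
        by (intro conjI; linarith)
    qed
    then show "x \<in> hcube R" by (simp add: hcube_def)
  qed
  have offR: "h y = 0" if "y \<notin> hcube R" for y using off sub that by blast
  have eR: "ennreal (4 * I / l) \<le> ?e (hcube R)"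
  proof -
    have "4 * I / l \<le> t * snd R0" using t by simp
    also have "\<dots> \<le> (t * snd R0) ^ CARD('n)" 
      using t(2) l I(2) by (intro self_le_power) (auto simp: le_diff_eq[symmetric] intro: order_trans[of 1 "4 * I / l + 1"])
    finally show ?thesis using R by (simp add: emeasure_hcube R_def ennreal_leI)
  qed
  define J where "J P = (\<integral>\<^sup>+x\<in>hcube P. ennreal (norm (h x)) \<partial>lebesgue)" for P
  have J_le: "J P \<le> ennreal I" for P
    unfolding J_def I(1)[symmetric] by (intro nn_integral_mono) (auto simp: indicator_def)
  define \<Phi> where "\<Phi> P \<longleftrightarrow> ennreal l * ?e (hcube P) < J P \<or> ?e (hcube P) < 2 * ?e (hcube P \<inter> U)" for P
  have nroot: "\<not> \<Phi> R"
  proof -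
    have "J R \<le> ennreal l * ennreal (4 * I / l)"
      using J_le[of R] l I(2) by (simp flip: ennreal_mult) (auto intro: order_trans ennreal_leI)
    also have "\<dots> \<le> ennreal l * ?e (hcube R)" by (intro mult_left_mono eR) auto
    finally have 1: "J R \<le> ennreal l * ?e (hcube R)" .
    have "2 * ?e (hcube R \<inter> U) \<le> 2 * ennreal (2 * I / l)"
      by (intro mult_left_mono order_trans[OF emeasure_mono eU]) auto
    also have "\<dots> = ennreal (4 * I / l)" using l I(2) by (simp flip: ennreal_mult ennreal_numeral)
    also have "\<dots> \<le> ?e (hcube R)" by (rule eR)
    finally show ?thesis using 1 by (simp add: \<Phi>_def not_less)
  qed
  define S where "S = {x. selected \<Phi> R x}"
  have [measurable]: "S \<in> sets lebesgue" unfolding S_def by (rule selected_measurable[OF R])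
  have SU: "S = (\<Union>P\<in>maximal_cubes \<Phi> R. hcube P)" unfolding S_def by (rule selected_eq_Union[OF R])
  let ?g = "\<lambda>x. ennreal (1 / l) * ennreal (norm (h x)) + 2 * indicator U x"
  have eS: "?e S \<le> ennreal (5 * I / l)"
  proof -
    have "?e S \<le> (\<integral>\<^sup>+x\<in>S. ?g x \<partial>lebesgue)" unfolding S_def
    proof (rule emeasure_selected_le[OF R])
      fix P assume P: "\<Phi> P" "0 < snd P"
      have "(\<integral>\<^sup>+x\<in>hcube P. ?g x \<partial>lebesgue) =
         (\<integral>\<^sup>+x. ennreal (1 / l) * (ennreal (norm (h x)) * indicator (hcube P) x) + 2 * indicator (hcube P \<inter> U) x \<partial>lebesgue)"
        by (intro nn_integral_cong) (auto simp: indicator_def)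
      also have "\<dots> = ennreal (1 / l) * J P + 2 * ?e (hcube P \<inter> U)"
        unfolding J_def by (subst nn_integral_add) (auto simp: nn_integral_cmult nn_integral_cmult_indicator)
      finally have eq: "(\<integral>\<^sup>+x\<in>hcube P. ?g x \<partial>lebesgue) = ennreal (1 / l) * J P + 2 * ?e (hcube P \<inter> U)" .
      show "?e (hcube P) \<le> (\<integral>\<^sup>+x\<in>hcube P. ?g x \<partial>lebesgue)"
        using P(1) unfolding \<Phi>_def eq
      proof
        assume "ennreal l * ?e (hcube P) < J P"
        then have "ennreal (1 / l) * (ennreal l * ?e (hcube P)) \<le> ennreal (1 / l) * J P" by (intro mult_left_mono) auto
        moreover have "ennreal (1 / l) * (ennreal l * ?e (hcube P)) = ?e (hcube P)"
          using l by (simp add: mult.assoc[symmetric] flip: ennreal_mult)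
        ultimately show "?e (hcube P) \<le> ennreal (1 / l) * J P + 2 * ?e (hcube P \<inter> U)"
          by (simp add: add_increasing2)
      qed (simp add: add_increasing)
    qed measurable
    also have "\<dots> \<le> (\<integral>\<^sup>+x. ?g x \<partial>lebesgue)" by (intro nn_integral_mono) (auto simp: indicator_def)
    also have "\<dots> = ennreal (1 / l) * ennreal I + 2 * ?e U"
      by (subst nn_integral_add) (auto simp: nn_integral_cmult nn_integral_cmult_indicator I(1))
    also have "\<dots> \<le> ennreal (1 / l) * ennreal I + 2 * ennreal (2 * I / l)"
      by (intro add_left_mono mult_left_mono eU) auto
    also have "\<dots> = ennreal (5 * I / l)" using l I(2) by (simp flip: ennreal_mult ennreal_plus ennreal_numeral)
    finally show ?thesis .
  qed
  have small: "norm (h x) \<le> l" if "x \<notin> S" for x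
  proof (cases "x \<in> hcube R")
    case True
    have "x \<notin> U"
    proof
      assume "x \<in> U"
      then obtain k where k: "hcube (dyadic R k x) \<subseteq> U" using dyadic_in_open[OF R U(1)] by blast
      then have "hcube (dyadic R k x) \<inter> U = hcube (dyadic R k x)" by auto
      moreover have "?e (hcube (dyadic R k x)) < 2 * ?e (hcube (dyadic R k x))"
        using R by (simp add: emeasure_hcube ennreal_less_iff flip: ennreal_mult ennreal_numeral)
      ultimately have "\<Phi> (dyadic R k x)" by (simp add: \<Phi>_def)
      then show False using that True by (auto simp: S_def selected_def)
    qed
    then have "x \<notin> E" using U(2) by blast
    then show ?thesis by (simp add: E_def not_less)
  qed (use offR l in auto)
  have avg: "J P \<le> ennreal (2 ^ CARD('n) * l) * ?e (hcube P)" if P: "P \<in> maximal_cubes \<Phi> R" for P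
  proof -
    obtain x where x: "selected \<Phi> R x" "P = maximal_cube \<Phi> R x" using P by (rule maximal_cubesE)
    obtain P' where P': "\<not> \<Phi> P'" "hcube P \<subseteq> hcube P'" "snd P' = 2 * snd P"
      using maximal_cube_parent[OF R x(1) nroot] x(2) by metis
    have pos: "0 < snd P" by (rule maximal_cubes_snd_pos[OF R P])
    have "J P \<le> J P'" unfolding J_def using P'(2) by (intro nn_integral_mono) (auto simp: indicator_def)
    also have "\<dots> \<le> ennreal l * ?e (hcube P')" using P'(1) by (simp add: \<Phi>_def not_less)
    also have "\<dots> = ennreal (2 ^ CARD('n) * l) * ?e (hcube P)"
      using pos P'(3) l by (simp add: emeasure_hcube power_mult_distrib mult_ac flip: ennreal_mult)
    finally show ?thesis .
  qed
  have "\<exists>F\<subseteq>maximal_cubes \<Phi> R. finite F \<and>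
     (\<integral>\<^sup>+x\<in>S - (\<Union>P\<in>F. hcube P). ennreal ((norm (h x))\<^sup>2) \<partial>lebesgue) \<le> ennreal (l * I)"
  proof (cases "maximal_cubes \<Phi> R = {}")
    case True
    then show ?thesis by (intro exI[of _ "{}"]) (auto simp: SU)
  next
    case False
    define e where "e = from_nat_into (maximal_cubes \<Phi> R)"
    have e: "range e = maximal_cubes \<Phi> R" unfolding e_def by (rule range_from_nat_into[OF False countable_maximal_cubes])
    define \<nu> where "\<nu> = density lebesgue (\<lambda>x. ennreal ((norm (h x))\<^sup>2))"
    define A where "A N = S - (\<Union>j<N. hcube (e j))" for N
    have Am [measurable]: "A N \<in> sets lebesgue" for N unfolding A_def by measurable
    have \<nu>: "emeasure \<nu> X = (\<integral>\<^sup>+x\<in>X. ennreal ((norm (h x))\<^sup>2) \<partial>lebesgue)" if "X \<in> sets lebesgue" for X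
      unfolding \<nu>_def using that by (intro emeasure_density) auto
    have fin: "emeasure \<nu> (A N) \<noteq> \<infinity>" for N
    proof -
      have "emeasure \<nu> (A N) \<le> (\<integral>\<^sup>+x. ennreal ((norm (h x))\<^sup>2) \<partial>lebesgue)"
        unfolding \<nu>[OF Am] by (intro nn_integral_mono) (auto simp: indicator_def)
      also have "\<dots> < \<infinity>" by (simp add: L2_nn_integral[OF h])
      finally show ?thesis by simp
    qed
    have "(\<lambda>N. emeasure \<nu> (A N)) \<longlonglongrightarrow> emeasure \<nu> (\<Inter>N. A N)"
    proof (rule Lim_emeasure_decseq)
      show "range A \<subseteq> sets \<nu>" using Am by (auto simp: \<nu>_def)
      show "decseq A" unfolding decseq_def A_def by fastforce
    qed (rule fin)
    moreover have "(\<Inter>N. A N) = {}"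
    proof (rule equals0I)
      fix x assume x: "x \<in> (\<Inter>N. A N)"
      then have "x \<in> S" by (auto simp: A_def)
      then obtain P where P: "P \<in> maximal_cubes \<Phi> R" "x \<in> hcube P" unfolding SU by (rule UN_E)
      have "P \<in> range e" unfolding e by (rule P(1))
      then obtain j where "P = e j" by (rule rangeE)
      then have "x \<notin> A (Suc j)" using P(2) by (auto simp: A_def)
      then show False using x by auto
    qed
    ultimately have "(\<lambda>N. emeasure \<nu> (A N)) \<longlonglongrightarrow> 0" by simp
    then have "eventually (\<lambda>N. emeasure \<nu> (A N) < ennreal (l * I)) sequentially"
      by (rule order_tendstoD) (use l I in simp)
    then obtain N where N: "emeasure \<nu> (A N) < ennreal (l * I)" by (meson eventually_sequentially order_refl)
    have "A N = S - (\<Union>P\<in>e ` {..<N}. hcube P)" by (simp add: A_def)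
    then show ?thesis using N e unfolding \<nu>[OF Am] by (intro exI[of _ "e ` {..<N}"]) auto
  qed
  then obtain F where F: "F \<subseteq> maximal_cubes \<Phi> R" "finite F"
     "(\<integral>\<^sup>+x\<in>S - (\<Union>P\<in>F. hcube P). ennreal ((norm (h x))\<^sup>2) \<partial>lebesgue) \<le> ennreal (l * I)" by blast
  have disj: "disjoint_family_on hcube F"
    using disjoint_maximal_cubes[OF R] F(1) by (rule disjoint_family_on_mono[rotated])
  show ?thesis
  proof (rule that[OF F(2) _ disj])
    show "0 < snd P" if "P \<in> F" for P using maximal_cubes_snd_pos[OF R, of P] F(1) that by blast
    have "(\<Sum>P\<in>F. ?e (hcube P)) = ?e (\<Union>P\<in>F. hcube P)"
      using F(2) disj by (intro sum_emeasure) auto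
    also have "\<dots> \<le> ?e S"
    proof (rule emeasure_mono)
      show "(\<Union>P\<in>F. hcube P) \<subseteq> S" unfolding SU using F(1) by blast
    qed simp
    also have "\<dots> \<le> ennreal (5 * I / l)" by (rule eS)
    finally show "(\<Sum>P\<in>F. ?e (hcube P)) \<le> ennreal (5 * I / l)" .
    show "(\<integral>\<^sup>+x\<in>hcube P. ennreal (norm (h x)) \<partial>lebesgue) \<le> ennreal (2 ^ CARD('n) * l) * ?e (hcube P)" if "P \<in> F" for P
      using avg[of P] F(1) that by (auto simp: J_def)
    have Fm [measurable]: "(\<Union>P\<in>F. hcube P) \<in> sets lebesgue" using F(2) by auto
    have "(\<integral>\<^sup>+x\<in>- (\<Union>P\<in>F. hcube P). ennreal ((norm (h x))\<^sup>2) \<partial>lebesgue) \<le>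
       (\<integral>\<^sup>+x. ennreal l * ennreal (norm (h x)) + ennreal ((norm (h x))\<^sup>2) * indicator (S - (\<Union>P\<in>F. hcube P)) x \<partial>lebesgue)"
    proof (intro nn_integral_mono)
      fix x
      have "ennreal ((norm (h x))\<^sup>2) \<le> ennreal l * ennreal (norm (h x))" if "x \<notin> S"
        using small[OF that] l by (simp add: power2_eq_square mult_right_mono ennreal_leI flip: ennreal_mult)
      then show "ennreal ((norm (h x))\<^sup>2) * indicator (- (\<Union>P\<in>F. hcube P)) x \<le>
        ennreal l * ennreal (norm (h x)) + ennreal ((norm (h x))\<^sup>2) * indicator (S - (\<Union>P\<in>F. hcube P)) x"
        by (cases "x \<in> S") (auto simp: indicator_def)
    qed
    also have "\<dots> = ennreal l * ennreal I + (\<integral>\<^sup>+x\<in>S - (\<Union>P\<in>F. hcube P). ennreal ((norm (h x))\<^sup>2) \<partial>lebesgue)"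
      by (subst nn_integral_add) (auto simp: nn_integral_cmult I(1))
    also have "\<dots> \<le> ennreal l * ennreal I + ennreal (l * I)" by (intro add_left_mono F(3))
    also have "\<dots> = ennreal (2 * l * I)" using l I(2) by (simp flip: ennreal_mult ennreal_plus)
    finally show "(\<integral>\<^sup>+x\<in>- (\<Union>P\<in>F. hcube P). ennreal ((norm (h x))\<^sup>2) \<partial>lebesgue) \<le> ennreal (2 * l * I)" .
  qed
qed

lemma emeasure_superlevel_le:
  assumes F [measurable]: "F \<in> borel_measurable M" and c: "0 < c"
  shows "emeasure M {x\<in>space M. ennreal c < F x} \<le> ennreal (1 / c) * (\<integral>\<^sup>+x. F x \<partial>M)"
proof -
  have "ennreal c * emeasure M {x\<in>space M. ennreal c < F x} = (\<integral>\<^sup>+x. ennreal c * indicator {x\<in>space M. ennreal c < F x} x \<partial>M)"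
    by (simp add: nn_integral_cmult_indicator)
  also have "\<dots> \<le> (\<integral>\<^sup>+x. F x \<partial>M)" by (intro nn_integral_mono) (auto simp: indicator_def)
  finally have "ennreal (1 / c) * (ennreal c * emeasure M {x\<in>space M. ennreal c < F x}) \<le> ennreal (1 / c) * (\<integral>\<^sup>+x. F x \<partial>M)"
    by (rule mult_left_mono) simp
  moreover have "ennreal (1 / c) * (ennreal c * emeasure M {x\<in>space M. ennreal c < F x}) = emeasure M {x\<in>space M. ennreal c < F x}"
    using c by (simp add: mult.assoc[symmetric] flip: ennreal_mult)
  ultimately show ?thesis by simp
qed

context cz_operator begin

definition weak_constant :: real where
  "weak_constant = 4 * B\<^sup>2 * (2 + 2 ^ CARD('n)) + 5 * (4 * real CARD('n)) ^ CARD('n) + 4 * C * 4 ^ CARD('n) / (1 - q)"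

lemma weak_constant_nonneg: "0 \<le> weak_constant"
  unfolding weak_constant_def using C q by (intro add_nonneg_nonneg divide_nonneg_nonneg mult_nonneg_nonneg) auto

text \<open>On each cube of the decomposition replace \<open>h\<close> by its mean. The resulting good function has square
integral at most a multiple of \<open>l I\<close>, and boundedness on \<open>L\<^sup>2\<close> applies. The bad functions have mean zero;
outside the dilated cubes their images are controlled by \<open>T_mean_zero\<close>, and the union of these cubes is
small.\<close>

lemma weak_type:
  fixes h :: "real^'n \<Rightarrow> complex" and R0 :: "'n node"
  assumes h: "h \<in> L2" and R0: "0 < snd R0" and off: "\<And>y. y \<notin> hcube R0 \<Longrightarrow> h y = 0" and l: "0 < l"
  shows "emeasure lebesgue {x. l < norm (T h x)} \<le> ennreal (weak_constant / l) * (\<integral>\<^sup>+x. ennreal (norm (h x)) \<partial>lebesgue)"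
proof -
  let ?e = "emeasure (lebesgue :: (real^'n) measure)" and ?n = "CARD('n)"
  note [measurable] = L2_measurable[OF h] L2_measurable[OF T_L2[OF h]]
  have ih: "integrable lebesgue h"
    using R0 off by (intro L2_integrable_on_bounded[OF h hcube_lmeasurable[of R0]]) auto
  then have "(\<integral>\<^sup>+x. ennreal (norm (h x)) \<partial>lebesgue) < \<infinity>" by (simp add: integrable_iff_bounded)
  then obtain I where I: "(\<integral>\<^sup>+x. ennreal (norm (h x)) \<partial>lebesgue) = ennreal I" "0 \<le> I"
    by (cases "\<integral>\<^sup>+x. ennreal (norm (h x)) \<partial>lebesgue") auto
  have Tm: "{x. l < norm (T h x)} \<in> sets lebesgue"
  proof -
    have "{x. l < norm (T h x)} = {x\<in>space lebesgue. l < norm (T h x)}" by simp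
    also have "\<dots> \<in> sets lebesgue" by measurable
    finally show ?thesis .
  qed
  show ?thesis
  proof (cases "I = 0")
    case True
    then have "(\<integral>\<^sup>+x. ennreal (norm (h x)) \<partial>lebesgue) = 0" using I(1) by simp
    then have "AE x in lebesgue. ennreal (norm (h x)) = 0" by (subst (asm) nn_integral_0_iff_AE) auto
    then have "AE x in lebesgue. h x = 0" by eventually_elim simp
    then have "AE x in lebesgue. T h x = 0" by (rule T_null[OF h])
    then have "AE x in lebesgue. x \<notin> {x. l < norm (T h x)}" by eventually_elim (use l in simp)
    then have "{x. l < norm (T h x)} \<in> null_sets lebesgue" using Tm by (simp add: AE_iff_null_sets)
    then show ?thesis by (simp add: null_setsD1)
  next
    case False
    then have Ipos: "0 < I" using I by simp
    obtain F where F: "finite F" "\<And>P. P \<in> F \<Longrightarrow> 0 < snd P" "disjoint_family_on hcube F"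
      "(\<Sum>P\<in>F. ?e (hcube P)) \<le> ennreal (5 * I / l)"
      "\<And>P. P \<in> F \<Longrightarrow> (\<integral>\<^sup>+x\<in>hcube P. ennreal (norm (h x)) \<partial>lebesgue) \<le> ennreal (2 ^ ?n * l) * ?e (hcube P)"
      "(\<integral>\<^sup>+x\<in>- (\<Union>P\<in>F. hcube P). ennreal ((norm (h x))\<^sup>2) \<partial>lebesgue) \<le> ennreal (2 * l * I)"
    proof (rule calderon_zygmund_cubes[OF h R0 off l I(1) Ipos], goal_cases)
      case (2 F)
      from 2(2-) show ?thesis by (rule 2(1))
    qed
    define J where "J P = (\<integral>\<^sup>+x\<in>hcube P. ennreal (norm (h x)) \<partial>lebesgue)" for P
    define a where "a P = (LINT y|lebesgue. indicator (hcube P) y * h y) / of_real (measure lebesgue (hcube P))" for P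
    define bad where "bad P y = indicator (hcube P) y * (h y - a P)" for P y
    define good where "good y = h y - (\<Sum>P\<in>F. bad P y)" for y
    have iJ: "integrable lebesgue (\<lambda>y. indicator (hcube P) y * h y)" for P
      using integrable_mult_indicator[OF hcube_lebesgue ih, of P]
      by (rule Bochner_Integration.integrable_cong[THEN iffD1, rotated -1]) (auto simp: indicator_def)
    have m_pos: "0 < measure lebesgue (hcube P)" if "P \<in> F" for P using F(2)[OF that] by (simp add: measure_hcube)
    have e_m: "?e (hcube P) = ennreal (measure lebesgue (hcube P))" if "P \<in> F" for P
      using F(2)[OF that] by (simp add: measure_hcube emeasure_hcube)
    have a_le: "ennreal (norm (a P)) * ?e (hcube P) \<le> J P" if P: "P \<in> F" for P
    proof -
      have "norm (a P) * measure lebesgue (hcube P) = norm (LINT y|lebesgue. indicator (hcube P) y * h y)"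
        using m_pos[OF P] by (simp add: a_def norm_divide)
      then have "ennreal (norm (a P)) * ?e (hcube P) = ennreal (norm (LINT y|lebesgue. indicator (hcube P) y * h y))"
        by (simp add: e_m[OF P] flip: ennreal_mult)
      also have "\<dots> \<le> (\<integral>\<^sup>+y. ennreal (norm (indicator (hcube P) y * h y)) \<partial>lebesgue)"
        by (rule integral_norm_bound_ennreal[OF iJ])
      also have "\<dots> = J P" unfolding J_def by (intro nn_integral_cong) (auto simp: indicator_def)
      finally show ?thesis .
    qed
    have a_bound: "norm (a P) \<le> 2 ^ ?n * l" if P: "P \<in> F" for P
    proof -
      have "ennreal (norm (a P)) * ?e (hcube P) \<le> ennreal (2 ^ ?n * l) * ?e (hcube P)"
        using a_le[OF P] F(5)[OF P] unfolding J_def by (rule order_trans)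
      then have "norm (a P) * measure lebesgue (hcube P) \<le> 2 ^ ?n * l * measure lebesgue (hcube P)"
        using l by (simp add: e_m[OF P] ennreal_le_iff flip: ennreal_mult)
      then show ?thesis using m_pos[OF P] by simp
    qed
    have c_L2: "(\<lambda>y. indicator (hcube P) y * c) \<in> L2" if P: "P \<in> F" for P and c :: complex
    proof (rule L2_I)
      have "(\<integral>\<^sup>+y. ennreal ((norm (indicator (hcube P) y * c))\<^sup>2) \<partial>lebesgue) = (\<integral>\<^sup>+y. ennreal ((norm c)\<^sup>2) * indicator (hcube P) y \<partial>lebesgue)"
        by (intro nn_integral_cong) (auto simp: indicator_def)
      also have "\<dots> < \<infinity>" by (simp add: nn_integral_cmult_indicator e_m[OF P] ennreal_mult_less_top)
      finally show "(\<integral>\<^sup>+y. ennreal ((norm (indicator (hcube P) y * c))\<^sup>2) \<partial>lebesgue) < \<infinity>" .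
    qed measurable
    have bad_eq: "bad P = (\<lambda>y. indicator (hcube P) y * h y - indicator (hcube P) y * a P)" for P
      by (auto simp: bad_def algebra_simps)
    have bad_L2: "bad P \<in> L2" if P: "P \<in> F" for P
      unfolding bad_eq by (intro L2_diff L2_restrict h c_L2 P) measurable
    have bad_sum_L2: "(\<lambda>y. \<Sum>P\<in>F. bad P y) \<in> L2" using F(1) bad_L2 by (rule L2_sum)
    have good_L2: "good \<in> L2" unfolding good_def by (rule L2_diff[OF h bad_sum_L2])
    have bad_mean: "(LINT y|lebesgue. bad P y) = 0" if P: "P \<in> F" for P
    proof -
      have "integrable lebesgue (indicator (hcube P) :: real^'n \<Rightarrow> real)"
        using F(2)[OF P] by (intro integrable_real_indicator) (auto simp: emeasure_hcube)
      then have ic: "integrable lebesgue (\<lambda>y. indicator (hcube P) y *\<^sub>R a P)" by (rule integrable_scaleR_left)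
      have eq: "indicator (hcube P) y * a P = indicator (hcube P) y *\<^sub>R a P" for y by (auto simp: indicator_def)
      have "(LINT y|lebesgue. bad P y) = (LINT y|lebesgue. indicator (hcube P) y * h y) - (LINT y|lebesgue. indicator (hcube P) y *\<^sub>R a P)"
        unfolding bad_eq eq by (rule Bochner_Integration.integral_diff[OF iJ ic])
      also have "(LINT y|lebesgue. indicator (hcube P) y *\<^sub>R a P) = of_real (measure lebesgue (hcube P)) * a P"
        using F(2)[OF P] by (simp add: scaleR_conv_of_real emeasure_hcube)
      also have "\<dots> = (LINT y|lebesgue. indicator (hcube P) y * h y)" using m_pos[OF P] by (simp add: a_def)
      finally show ?thesis by simp
    qed
    have bad_L1: "(\<integral>\<^sup>+y. ennreal (norm (bad P y)) \<partial>lebesgue) \<le> 2 * J P" if P: "P \<in> F" for P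
    proof -
      have "(\<integral>\<^sup>+y. ennreal (norm (bad P y)) \<partial>lebesgue) \<le>
        (\<integral>\<^sup>+y. ennreal (norm (h y)) * indicator (hcube P) y + ennreal (norm (a P)) * indicator (hcube P) y \<partial>lebesgue)"
        using norm_triangle_ineq4[of "h _" "a P"]
        by (intro nn_integral_mono) (auto simp: bad_def indicator_def simp flip: ennreal_plus intro!: ennreal_leI)
      also have "\<dots> = J P + ennreal (norm (a P)) * ?e (hcube P)"
        unfolding J_def by (subst nn_integral_add) (auto simp: nn_integral_cmult_indicator)
      also have "\<dots> \<le> J P + J P" by (intro add_left_mono a_le P)
      finally show ?thesis by (simp add: mult_2)
    qed
    have sum_J: "(\<Sum>P\<in>F. J P) \<le> ennreal I"
    proof -
      have "(\<Sum>P\<in>F. J P) = (\<integral>\<^sup>+x. (\<Sum>P\<in>F. ennreal (norm (h x)) * indicator (hcube P) x) \<partial>lebesgue)"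
        unfolding J_def by (rule nn_integral_sum[symmetric]) measurable
      also have "\<dots> \<le> (\<integral>\<^sup>+x. ennreal (norm (h x)) \<partial>lebesgue)"
      proof (intro nn_integral_mono)
        fix x
        have "(\<Sum>P\<in>F. indicator (hcube P) x) = (indicator (\<Union>P\<in>F. hcube P) x :: ennreal)"
          by (rule indicator_UN_disjoint[OF F(1,3), symmetric])
        then have "(\<Sum>P\<in>F. ennreal (norm (h x)) * indicator (hcube P) x) = ennreal (norm (h x)) * indicator (\<Union>P\<in>F. hcube P) x"
          by (simp add: sum_distrib_left[symmetric])
        also have "\<dots> \<le> ennreal (norm (h x))" by (auto simp: indicator_def)
        finally show "(\<Sum>P\<in>F. ennreal (norm (h x)) * indicator (hcube P) x) \<le> ennreal (norm (h x))" .
      qed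
      finally show ?thesis by (simp add: I(1))
    qed
    have good_out: "good y = h y" if "y \<notin> (\<Union>P\<in>F. hcube P)" for y
      using that by (simp add: good_def bad_def)
    have good_in: "good y = a P" if P: "P \<in> F" "y \<in> hcube P" for y P
    proof -
      have "bad P' y = 0" if "P' \<in> F - {P}" for P'
        using that P F(3) by (auto simp: bad_def indicator_def disjoint_family_on_def)
      then have "(\<Sum>P\<in>F. bad P y) = bad P y" using F(1) P(1) by (simp add: sum.remove)
      then show ?thesis using P by (simp add: good_def bad_def)
    qed
    have good_norm: "(\<integral>\<^sup>+y. ennreal ((norm (good y))\<^sup>2) \<partial>lebesgue) \<le> ennreal ((2 + 2 ^ ?n) * l * I)"
    proof -
      have "(\<integral>\<^sup>+y. ennreal ((norm (good y))\<^sup>2) \<partial>lebesgue) \<le>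
        (\<integral>\<^sup>+y. ennreal ((norm (h y))\<^sup>2) * indicator (- (\<Union>P\<in>F. hcube P)) y +
             (\<Sum>P\<in>F. ennreal (2 ^ ?n * l * norm (a P)) * indicator (hcube P) y) \<partial>lebesgue)"
      proof (intro nn_integral_mono)
        fix y
        show "ennreal ((norm (good y))\<^sup>2) \<le> ennreal ((norm (h y))\<^sup>2) * indicator (- (\<Union>P\<in>F. hcube P)) y +
             (\<Sum>P\<in>F. ennreal (2 ^ ?n * l * norm (a P)) * indicator (hcube P) y)"
        proof (cases "y \<in> (\<Union>P\<in>F. hcube P)")
          case True
          then obtain P where P: "P \<in> F" "y \<in> hcube P" by (rule UN_E)
          have "ennreal ((norm (good y))\<^sup>2) \<le> ennreal (2 ^ ?n * l * norm (a P))"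
            unfolding good_in[OF P] power2_eq_square by (intro ennreal_leI mult_right_mono a_bound P) simp
          also have "\<dots> = ennreal (2 ^ ?n * l * norm (a P)) * indicator (hcube P) y" using P by simp
          also have "\<dots> \<le> (\<Sum>P\<in>F. ennreal (2 ^ ?n * l * norm (a P)) * indicator (hcube P) y)"
            using F(1) P(1) by (intro member_le_sum) auto
          finally show ?thesis by (simp add: add_increasing)
        next
          case False
          then show ?thesis using good_out[OF False] by simp
        qed
      qed
      also have "\<dots> = (\<integral>\<^sup>+y\<in>- (\<Union>P\<in>F. hcube P). ennreal ((norm (h y))\<^sup>2) \<partial>lebesgue) +
           (\<integral>\<^sup>+y. (\<Sum>P\<in>F. ennreal (2 ^ ?n * l * norm (a P)) * indicator (hcube P) y) \<partial>lebesgue)"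
        using F(1) by (intro nn_integral_add) measurable
      also have "(\<integral>\<^sup>+y. (\<Sum>P\<in>F. ennreal (2 ^ ?n * l * norm (a P)) * indicator (hcube P) y) \<partial>lebesgue) =
          (\<Sum>P\<in>F. ennreal (2 ^ ?n * l * norm (a P)) * ?e (hcube P))"
      proof -
        have "(\<integral>\<^sup>+y. (\<Sum>P\<in>F. ennreal (2 ^ ?n * l * norm (a P)) * indicator (hcube P) y) \<partial>lebesgue) =
          (\<Sum>P\<in>F. \<integral>\<^sup>+y. ennreal (2 ^ ?n * l * norm (a P)) * indicator (hcube P) y \<partial>lebesgue)"
          by (rule nn_integral_sum) measurable
        also have "\<dots> = (\<Sum>P\<in>F. ennreal (2 ^ ?n * l * norm (a P)) * ?e (hcube P))"
          by (intro sum.cong refl nn_integral_cmult_indicator) simp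
        finally show ?thesis .
      qed
      also have "(\<integral>\<^sup>+y\<in>- (\<Union>P\<in>F. hcube P). ennreal ((norm (h y))\<^sup>2) \<partial>lebesgue) +
           (\<Sum>P\<in>F. ennreal (2 ^ ?n * l * norm (a P)) * ?e (hcube P))
         \<le> ennreal (2 * l * I) + (\<Sum>P\<in>F. ennreal (2 ^ ?n * l) * J P)"
      proof (intro add_mono F(6) sum_mono)
        fix P assume P: "P \<in> F"
        have "ennreal (2 ^ ?n * l * norm (a P)) * ?e (hcube P) = ennreal (2 ^ ?n * l) * (ennreal (norm (a P)) * ?e (hcube P))"
          using l by (simp add: ennreal_mult mult.assoc)
        also have "\<dots> \<le> ennreal (2 ^ ?n * l) * J P" by (intro mult_left_mono a_le P) simp
        finally show "ennreal (2 ^ ?n * l * norm (a P)) * ?e (hcube P) \<le> ennreal (2 ^ ?n * l) * J P" .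
      qed
      also have "\<dots> \<le> ennreal (2 * l * I) + ennreal (2 ^ ?n * l) * ennreal I"
        unfolding sum_distrib_left[symmetric] by (intro add_left_mono mult_left_mono sum_J) simp
      also have "\<dots> = ennreal ((2 + 2 ^ ?n) * l * I)"
        using l Ipos by (simp add: algebra_simps flip: ennreal_mult ennreal_plus)
      finally show ?thesis .
    qed
    \<comment> \<open>Exceptional sets: the good part is large, the point lies in a dilated cube, the bad part is large.\<close>
    define E1 where "E1 = {x\<in>space lebesgue. ennreal ((l / 2)\<^sup>2) < ennreal ((norm (T good x))\<^sup>2)}"
    define E2 where "E2 = (\<Union>P\<in>F. closed_cube (concentric P 0))"
    define \<Psi> where "\<Psi> x = (\<Sum>P\<in>F. ennreal (C * 4 ^ ?n) * bump q P x * (\<integral>\<^sup>+y. ennreal (norm (bad P y)) \<partial>lebesgue))" for x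
    define E3 where "E3 = {x\<in>space lebesgue. ennreal (l / 2) < \<Psi> x}"
    note [measurable] = L2_measurable[OF T_L2[OF good_L2]]
    have E1m [measurable]: "E1 \<in> sets lebesgue" unfolding E1_def by measurable
    have E2m [measurable]: "E2 \<in> sets lebesgue" unfolding E2_def using F(1) by auto
    have \<Psi>m [measurable]: "\<Psi> \<in> borel_measurable lebesgue" unfolding \<Psi>_def by measurable
    have E3m [measurable]: "E3 \<in> sets lebesgue" unfolding E3_def by measurable
    have E1: "?e E1 \<le> ennreal (4 * B\<^sup>2 * (2 + 2 ^ ?n) * I / l)"
    proof -
      have "?e E1 \<le> ennreal (1 / (l / 2)\<^sup>2) * (\<integral>\<^sup>+x. ennreal ((norm (T good x))\<^sup>2) \<partial>lebesgue)"
        unfolding E1_def using l by (intro emeasure_superlevel_le) auto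
      also have "\<dots> \<le> ennreal (1 / (l / 2)\<^sup>2) * (ennreal (B\<^sup>2) * ennreal ((2 + 2 ^ ?n) * l * I))"
        by (intro mult_left_mono order_trans[OF T_norm_le[OF good_L2]] good_norm) auto
      also have "\<dots> = ennreal (1 / (l / 2)\<^sup>2 * (B\<^sup>2 * ((2 + 2 ^ ?n) * l * I)))"
        using l Ipos by (simp flip: ennreal_mult)
      also have "1 / (l / 2)\<^sup>2 * (B\<^sup>2 * ((2 + 2 ^ ?n) * l * I)) = 4 * B\<^sup>2 * (2 + 2 ^ ?n) * I / l"
        using l by (simp add: power2_eq_square field_simps)
      finally show ?thesis .
    qed
    have E2: "?e E2 \<le> ennreal (5 * (4 * real ?n) ^ ?n * I / l)"
    proof -
      have "?e E2 \<le> (\<Sum>P\<in>F. ?e (closed_cube (concentric P 0)))"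
        unfolding E2_def using F(1) by (intro emeasure_subadditive_finite) auto
      also have "\<dots> = (\<Sum>P\<in>F. ennreal ((4 * real ?n) ^ ?n) * ?e (hcube P))"
        using F(2) by (intro sum.cong) (auto simp: emeasure_closed_cube emeasure_hcube snd_concentric power_mult_distrib less_imp_le simp flip: ennreal_mult)
      also have "\<dots> \<le> ennreal ((4 * real ?n) ^ ?n) * ennreal (5 * I / l)"
        unfolding sum_distrib_left[symmetric] by (intro mult_left_mono F(4)) simp
      also have "\<dots> = ennreal (5 * (4 * real ?n) ^ ?n * I / l)"
        using l Ipos by (simp add: mult_ac flip: ennreal_mult)
      finally show ?thesis .
    qed
    have E3: "?e E3 \<le> ennreal (4 * C * 4 ^ ?n / (1 - q) * I / l)"
    proof -
      have "(\<integral>\<^sup>+x. \<Psi> x \<partial>lebesgue) = (\<Sum>P\<in>F. ennreal (C * 4 ^ ?n) * ennreal (1 / (1 - q)) * (\<integral>\<^sup>+y. ennreal (norm (bad P y)) \<partial>lebesgue))"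
        unfolding \<Psi>_def using F(2)
        by (subst nn_integral_sum) (auto simp: nn_integral_cmult nn_integral_multc nn_integral_bump_1[OF q] intro!: sum.cong)
      also have "\<dots> \<le> (\<Sum>P\<in>F. ennreal (C * 4 ^ ?n) * ennreal (1 / (1 - q)) * (2 * J P))"
        by (intro sum_mono mult_left_mono bad_L1) auto
      also have "\<dots> = ennreal (C * 4 ^ ?n) * ennreal (1 / (1 - q)) * (2 * (\<Sum>P\<in>F. J P))"
        by (simp add: sum_distrib_left)
      also have "\<dots> \<le> ennreal (C * 4 ^ ?n) * ennreal (1 / (1 - q)) * (2 * ennreal I)"
        by (intro mult_left_mono sum_J) auto
      also have "\<dots> = ennreal (2 * (C * 4 ^ ?n) / (1 - q) * I)"
        using C q Ipos by (simp add: mult_ac flip: ennreal_mult ennreal_numeral)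
      finally have 1: "(\<integral>\<^sup>+x. \<Psi> x \<partial>lebesgue) \<le> ennreal (2 * (C * 4 ^ ?n) / (1 - q) * I)" .
      have "?e E3 \<le> ennreal (1 / (l / 2)) * (\<integral>\<^sup>+x. \<Psi> x \<partial>lebesgue)"
        unfolding E3_def using l by (intro emeasure_superlevel_le) auto
      also have "\<dots> \<le> ennreal (1 / (l / 2)) * ennreal (2 * (C * 4 ^ ?n) / (1 - q) * I)"
        by (intro mult_left_mono 1) auto
      also have "\<dots> = ennreal (4 * C * 4 ^ ?n / (1 - q) * I / l)"
        using l C q Ipos by (simp add: mult_ac flip: ennreal_mult)
      finally show ?thesis .
    qed
    have heq: "h = (\<lambda>y. good y + (\<Sum>P\<in>F. bad P y))" by (simp add: good_def)
    have a1: "AE x in lebesgue. T h x = T good x + T (\<lambda>y. \<Sum>P\<in>F. bad P y) x"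
      using T_add[OF good_L2 bad_sum_L2] unfolding heq[symmetric] .
    have a2: "AE x in lebesgue. T (\<lambda>y. \<Sum>P\<in>F. bad P y) x = (\<Sum>P\<in>F. T (bad P) x)"
      using F(1) bad_L2 by (rule T_sum)
    have a3: "AE x in lebesgue. \<forall>P\<in>F. x \<notin> closed_cube (concentric P 0) \<longrightarrow>
       ennreal (norm (T (bad P) x)) \<le> ennreal (C * 4 ^ ?n) * bump q P x * (\<integral>\<^sup>+y. ennreal (norm (bad P y)) \<partial>lebesgue)"
      using F(1)
    proof (rule AE_finite_allI)
      fix P assume P: "P \<in> F"
      show "AE x in lebesgue. x \<notin> closed_cube (concentric P 0) \<longrightarrow>
       ennreal (norm (T (bad P) x)) \<le> ennreal (C * 4 ^ ?n) * bump q P x * (\<integral>\<^sup>+y. ennreal (norm (bad P y)) \<partial>lebesgue)"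
        by (rule T_mean_zero[OF bad_L2[OF P] F(2)[OF P] _ bad_mean[OF P]]) (simp add: bad_def)
    qed
    have "AE x in lebesgue. x \<in> {x. l < norm (T h x)} \<longrightarrow> x \<in> E1 \<union> E2 \<union> E3"
      using a1 a2 a3
    proof eventually_elim
      case (elim x)
      show ?case
      proof
        assume x: "x \<in> {x. l < norm (T h x)}"
        show "x \<in> E1 \<union> E2 \<union> E3"
        proof (rule ccontr)
          assume "x \<notin> E1 \<union> E2 \<union> E3"
          then have n: "x \<notin> E1" "x \<notin> E2" "x \<notin> E3" by auto
          have "(norm (T good x))\<^sup>2 \<le> (l / 2)\<^sup>2" using n(1) l by (simp add: E1_def not_less ennreal_le_iff)
          then have 1: "norm (T good x) \<le> l / 2" by (rule power2_le_imp_le) (use l in simp)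
          have "ennreal (\<Sum>P\<in>F. norm (T (bad P) x)) = (\<Sum>P\<in>F. ennreal (norm (T (bad P) x)))" by simp
          also have "\<dots> \<le> \<Psi> x"
            unfolding \<Psi>_def using elim(3) n(2) by (intro sum_mono) (auto simp: E2_def)
          also have "\<dots> \<le> ennreal (l / 2)" using n(3) by (simp add: E3_def not_less)
          finally have "(\<Sum>P\<in>F. norm (T (bad P) x)) \<le> l / 2" using l by (simp add: ennreal_le_iff)
          then have 2: "norm (\<Sum>P\<in>F. T (bad P) x) \<le> l / 2" by (rule order_trans[OF norm_sum])
          have "T h x = T good x + (\<Sum>P\<in>F. T (bad P) x)" using elim(1,2) by (simp only:)
          then have "norm (T h x) \<le> norm (T good x) + norm (\<Sum>P\<in>F. T (bad P) x)"
            by (simp only: norm_triangle_ineq)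
          moreover have "l < norm (T h x)" using x by (simp only: mem_Collect_eq)
          ultimately show False using 1 2 by linarith
        qed
      qed
    qed
    then have "?e {x. l < norm (T h x)} \<le> ?e (E1 \<union> E2 \<union> E3)"
      by (intro emeasure_mono_AE) auto
    also have "\<dots> \<le> ?e E1 + ?e E2 + ?e E3"
      by (intro order_trans[OF emeasure_subadditive] add_right_mono emeasure_subadditive) auto
    also have "\<dots> \<le> ennreal (4 * B\<^sup>2 * (2 + 2 ^ ?n) * I / l) + ennreal (5 * (4 * real ?n) ^ ?n * I / l) + ennreal (4 * C * 4 ^ ?n / (1 - q) * I / l)"
      by (intro add_mono E1 E2 E3)
    also have "\<dots> = ennreal (weak_constant / l) * ennreal I"
    proof -
      have "weak_constant / l * I = 4 * B\<^sup>2 * (2 + 2 ^ ?n) * I / l + 5 * (4 * real ?n) ^ ?n * I / l + 4 * C * 4 ^ ?n / (1 - q) * I / l"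
        unfolding weak_constant_def by (simp add: add_divide_distrib distrib_right)
      moreover have "0 \<le> 4 * B\<^sup>2 * (2 + 2 ^ ?n) * I / l" "0 \<le> 5 * (4 * real ?n) ^ ?n * I / l" "0 \<le> 4 * C * 4 ^ ?n / (1 - q) * I / l"
        using l Ipos C q by auto
      ultimately show ?thesis using l Ipos weak_constant_nonneg by (simp flip: ennreal_mult ennreal_plus)
    qed
    finally show ?thesis by (simp add: I(1))
  qed
qed

end

section \<open>Local oscillation of the image of a function\<close>

lemma center_mem: "0 < snd Q \<Longrightarrow> center Q \<in> hcube Q"
  by (simp add: center_def hcube_def)

lemma ennreal_inverse_antimono: "a \<le> b \<Longrightarrow> inverse b \<le> inverse (a :: ennreal)"
  unfolding less_eq_ennreal.rep_eq inverse_ennreal.rep_eq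
  by (intro ereal_inverse_antimono) (auto simp: enn2ereal_nonneg)

lemma tail_average_finite:
  fixes Q :: "'n::finite node"
  assumes q: "0 \<le> q" "q < 1" and Q: "0 < snd Q" and F: "(\<integral>\<^sup>+x. F x \<partial>lebesgue) < \<infinity>"
  shows "tail_average q Q F < \<infinity>"
proof -
  let ?v = "ennreal (snd Q ^ CARD('n))"
  have v: "0 < snd Q ^ CARD('n)" using Q by simp
  have "average (closed_cube (concentric Q m)) F \<le> (\<integral>\<^sup>+x. F x \<partial>lebesgue) / ?v" for m
  proof -
    have "snd Q \<le> snd (concentric Q m)"
      using mult_right_mono[OF concentric_factor[where 'n='n, of m], of "snd Q"] Q by (simp add: snd_concentric)
    then have "?v \<le> emeasure lebesgue (closed_cube (concentric Q m))"
      using Q concentric_pos[OF Q, of m] by (simp add: emeasure_closed_cube ennreal_leI power_mono)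
    moreover have "(\<integral>\<^sup>+x\<in>closed_cube (concentric Q m). F x \<partial>lebesgue) \<le> (\<integral>\<^sup>+x. F x \<partial>lebesgue)"
      by (intro nn_integral_mono) (auto simp: indicator_def)
    ultimately show ?thesis
      unfolding average_def divide_ennreal_def by (intro mult_mono ennreal_inverse_antimono) auto
  qed
  then have "tail_average q Q F \<le> (\<Sum>m. ennreal (q ^ m) * ((\<integral>\<^sup>+x. F x \<partial>lebesgue) / ?v))"
    unfolding tail_average_def by (intro suminf_le summableI mult_left_mono) auto
  also have "\<dots> = ennreal (1 / (1 - q)) * ((\<integral>\<^sup>+x. F x \<partial>lebesgue) / ?v)"
    unfolding ennreal_suminf_multc geometric_ennreal[OF q] ..
  also have "\<dots> < \<infinity>"
  proof -
    obtain r where "(\<integral>\<^sup>+x. F x \<partial>lebesgue) = ennreal r" "0 \<le> r" using F by (cases "\<integral>\<^sup>+x. F x \<partial>lebesgue") auto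
    then show ?thesis using v by (simp add: divide_ennreal ennreal_mult_less_top)
  qed
  finally show ?thesis .
qed

context cz_operator begin

lemma weak_type_scaled:
  fixes h :: "real^'n \<Rightarrow> complex" and R0 :: "'n node"
  assumes h: "h \<in> L2" and R0: "0 < snd R0" and off: "\<And>y. y \<notin> hcube R0 \<Longrightarrow> h y = 0"
    and c: "0 \<le> c" and V: "0 \<le> V" and A: "0 < A"
    and le: "(\<integral>\<^sup>+x. ennreal (norm (h x)) \<partial>lebesgue) \<le> ennreal (c * V)"
  shows "emeasure lebesgue {x. A * c < norm (T h x)} \<le> ennreal (weak_constant / A * V)"
proof (cases "c = 0")
  case True
  note [measurable] = L2_measurable[OF h] L2_measurable[OF T_L2[OF h]]
  have "(\<integral>\<^sup>+x. ennreal (norm (h x)) \<partial>lebesgue) = 0" using le True by simp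
  then have "AE x in lebesgue. ennreal (norm (h x)) = 0" by (subst (asm) nn_integral_0_iff_AE) auto
  then have "AE x in lebesgue. h x = 0" by eventually_elim simp
  then have "AE x in lebesgue. T h x = 0" by (rule T_null[OF h])
  then have "AE x in lebesgue. x \<in> {x. A * c < norm (T h x)} \<longrightarrow> x \<in> {}"
    by eventually_elim (simp add: True)
  from emeasure_mono_AE[OF this] show ?thesis by simp
next
  case False
  then have cA: "0 < A * c" using c A by simp
  have "emeasure lebesgue {x. A * c < norm (T h x)} \<le> ennreal (weak_constant / (A * c)) * (\<integral>\<^sup>+x. ennreal (norm (h x)) \<partial>lebesgue)"
    by (rule weak_type[OF h R0 off cA])
  also have "\<dots> \<le> ennreal (weak_constant / (A * c)) * ennreal (c * V)" by (intro mult_left_mono le) simp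
  also have "\<dots> = ennreal (weak_constant / (A * c) * (c * V))"
    using weak_constant_nonneg cA c V by (simp flip: ennreal_mult)
  also have "weak_constant / (A * c) * (c * V) = weak_constant / A * V" using False by simp
  finally show ?thesis .
qed

text \<open>The value at the center of \<open>Q\<close> of the image of the part of \<open>h\<close> away from \<open>Q\<close>; the number close to
which \<open>T h\<close> stays on \<open>Q\<close>.\<close>

definition far_value :: "(real^'n \<Rightarrow> complex) \<Rightarrow> 'n node \<Rightarrow> complex" where
  "far_value h Q = (LINT y|lebesgue. K (center Q) y * (indicator (- closed_cube (concentric Q 0)) y * h y))"

lemma far_value_zero:
  assumes Q: "0 < snd Q" and off: "\<And>y. y \<notin> hcube Q \<Longrightarrow> h y = 0"
  shows "far_value h Q = 0"
proof -
  have eq: "indicator (- closed_cube (concentric Q 0)) y * h y = 0" for y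
    using off[of y] hcube_subset_concentric[OF Q, of 0] by (auto simp: indicator_def)
  show ?thesis unfolding far_value_def eq by simp
qed

lemma far_part:
  fixes h :: "real^'n \<Rightarrow> complex" and R0 Q :: "'n node"
  assumes h: "h \<in> L2" and R0: "0 < snd R0" and off: "\<And>y. y \<notin> hcube R0 \<Longrightarrow> h y = 0" and Q: "0 < snd Q"
  shows "AE x in lebesgue. x \<in> hcube Q \<longrightarrow>
    ennreal (norm (T (\<lambda>y. indicator (- closed_cube (concentric Q 0)) y * h y) x - far_value h Q))
      \<le> ennreal (C * 4 ^ CARD('n)) * tail_average q Q (\<lambda>y. ennreal (norm (h y)))"
proof -
  define k where "k y = indicator (- closed_cube (concentric Q 0)) y * h y" for y
  note [measurable] = L2_measurable[OF h]
  have "- closed_cube (concentric Q 0) \<in> sets lebesgue"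
    using sets.compl_sets[OF closed_cube_sets[of "concentric Q 0"]] by (simp add: Compl_eq_Diff_UNIV)
  then have kL2: "k \<in> L2" unfolding k_def by (intro L2_restrict h)
  have koff: "k y = 0" if "y \<notin> hcube R0" for y using off[OF that] by (simp add: k_def)
  have kin: "k y = 0" if "y \<in> closed_cube (concentric Q 0)" for y using that by (simp add: k_def)
  have comp: "compact (support k)" using koff by (rule support_subset_closed_cube(2))
  have ik: "integrable lebesgue k"
    using R0 koff by (intro L2_integrable_on_bounded[OF kL2 hcube_lmeasurable[of R0]]) auto
  have out: "x \<notin> support k" if x: "x \<in> hcube Q" for x
  proof -
    define r where "r = 2 * real CARD('n) * snd Q"
    define O' where "O' = box (center Q - vec r) (center Q + vec r)"
    have memO: "z \<in> O' \<longleftrightarrow> (\<forall>i. \<bar>z $ i - center Q $ i\<bar> < r)" for z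
      unfolding O'_def mem_box_cart vector_minus_component vector_add_component vec_component by (smt (verit))
    have sub: "O' \<subseteq> closed_cube (concentric Q 0)"
    proof
      fix z assume "z \<in> O'"
      then have "\<forall>i. \<bar>z $ i - center Q $ i\<bar> < r" using memO by blast
      then show "z \<in> closed_cube (concentric Q 0)"
        unfolding concentric_def mem_closed_cube_dilate r_def
      proof (intro allI)
        fix i assume "\<forall>i. \<bar>z $ i - center Q $ i\<bar> < 2 * real CARD('n) * snd Q"
        from spec[OF this, of i] show "\<bar>z $ i - center Q $ i\<bar> \<le> 4 * real CARD('n) * 2 ^ 0 * snd Q / 2" by (simp add: mult_ac)
      qed
    qed
    then have "O' \<inter> {y. k y \<noteq> 0} = {}" using kin by blast
    moreover have "open O'" unfolding O'_def by (rule open_box)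
    ultimately have "O' \<inter> support k = {}" unfolding support_def by (simp add: open_Int_closure_eq_empty)
    moreover have "x \<in> O'"
    proof -
      have "snd Q / 2 < r"
      proof -
        have "1 * snd Q \<le> real CARD('n) * snd Q" using card_pos_real[where 'n='n] Q by (intro mult_right_mono) auto
        then show ?thesis using Q unfolding r_def by linarith
      qed
      then show ?thesis unfolding memO using mem_hcube_center[OF x] le_less_trans by blast
    qed
    ultimately show ?thesis by blast
  qed
  have int: "integrable lebesgue (\<lambda>y. K x y * k y)" if x: "x \<in> hcube Q" for x
  proof (rule kernel_times_integrable[OF ik Q])
    fix y assume "k y \<noteq> 0"
    then have "y \<notin> closed_cube (concentric Q 0)" using kin by blast
    then show "snd Q \<le> dist x y" by (rule concentric_separation(2)[OF Q x])
  qed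
  show ?thesis
    using kernel[OF kL2 comp]
  proof eventually_elim
    fix x assume ker: "x \<notin> support k \<longrightarrow> T k x = (LINT y|lebesgue. K x y * k y)"
    show "x \<in> hcube Q \<longrightarrow> ennreal (norm (T (\<lambda>y. indicator (- closed_cube (concentric Q 0)) y * h y) x - far_value h Q))
      \<le> ennreal (C * 4 ^ CARD('n)) * tail_average q Q (\<lambda>y. ennreal (norm (h y)))"
    proof
      assume x: "x \<in> hcube Q"
      have "T k x - far_value h Q = (LINT y|lebesgue. K x y * k y) - (LINT y|lebesgue. K (center Q) y * k y)"
        using ker out[OF x] by (simp add: far_value_def k_def)
      also have "\<dots> = (LINT y|lebesgue. K x y * k y - K (center Q) y * k y)"
        by (rule Bochner_Integration.integral_diff[OF int[OF x] int[OF center_mem[OF Q]], symmetric])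
      finally have "ennreal (norm (T k x - far_value h Q)) \<le> (\<integral>\<^sup>+y. ennreal (norm (K x y * k y - K (center Q) y * k y)) \<partial>lebesgue)"
        using integral_norm_bound_ennreal[OF Bochner_Integration.integrable_diff[OF int[OF x] int[OF center_mem[OF Q]]]] by simp
      also have "\<dots> \<le> (\<integral>\<^sup>+y. ennreal (C * 4 ^ CARD('n)) * (ennreal (norm (h y)) * bump q Q y) \<partial>lebesgue)"
      proof (intro nn_integral_mono)
        fix y
        show "ennreal (norm (K x y * k y - K (center Q) y * k y)) \<le> ennreal (C * 4 ^ CARD('n)) * (ennreal (norm (h y)) * bump q Q y)"
        proof (cases "y \<in> closed_cube (concentric Q 0)")
          case False
          then have "k y = h y" by (simp add: k_def)
          then have "ennreal (norm (K x y * k y - K (center Q) y * k y)) = ennreal (norm (K x y - K (center Q) y)) * ennreal (norm (h y))"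
            by (simp add: norm_mult ennreal_mult flip: left_diff_distrib)
          also have "\<dots> \<le> ennreal (C * 4 ^ CARD('n)) * bump q Q y * ennreal (norm (h y))"
            by (intro mult_right_mono kernel_difference1[OF Q x False]) simp
          finally show ?thesis by (simp add: mult_ac)
        qed (simp add: kin)
      qed
      also have "\<dots> = ennreal (C * 4 ^ CARD('n)) * tail_average q Q (\<lambda>y. ennreal (norm (h y)))"
        by (simp add: nn_integral_cmult nn_integral_bump)
      finally show "ennreal (norm (T (\<lambda>y. indicator (- closed_cube (concentric Q 0)) y * h y) x - far_value h Q))
        \<le> ennreal (C * 4 ^ CARD('n)) * tail_average q Q (\<lambda>y. ennreal (norm (h y)))"
        unfolding k_def .
    qed
  qed
qed

definition tail_norm :: "(real^'n \<Rightarrow> complex) \<Rightarrow> 'n node \<Rightarrow> real" where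
  "tail_norm h Q = enn2real (tail_average q Q (\<lambda>y. ennreal (norm (h y))))"

lemma tail_norm_nonneg: "0 \<le> tail_norm h Q"
  by (simp add: tail_norm_def)

lemma tail_norm:
  assumes h: "h \<in> L2" and R0: "0 < snd (R0 :: 'n node)" and off: "\<And>y. y \<notin> hcube R0 \<Longrightarrow> h y = 0" and Q: "0 < snd Q"
  shows "tail_average q Q (\<lambda>y. ennreal (norm (h y))) = ennreal (tail_norm h Q)"
proof -
  have "integrable lebesgue h"
    using R0 off by (intro L2_integrable_on_bounded[OF h hcube_lmeasurable[of R0]]) auto
  then have "(\<integral>\<^sup>+x. ennreal (norm (h x)) \<partial>lebesgue) < \<infinity>" by (simp add: integrable_iff_bounded)
  from tail_average_finite[OF q Q this] show ?thesis by (simp add: tail_norm_def)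
qed

text \<open>The near part of \<open>h\<close> exceeds half of the threshold only on a small set, by the weak type bound; the far
part differs from \<open>far_value h Q\<close> by at most half of the threshold, by regularity of the kernel. The
operator is only determined almost everywhere, hence the function \<open>v\<close>.\<close>

lemma local_oscillation:
  fixes h :: "real^'n \<Rightarrow> complex" and R0 Q :: "'n node"
  assumes h: "h \<in> L2" and R0: "0 < snd R0" and off: "\<And>y. y \<notin> hcube R0 \<Longrightarrow> h y = 0" and Q: "0 < snd Q"
    and A: "0 < A" "2 * (C * 4 ^ CARD('n)) \<le> A"
    and v: "v \<in> borel_measurable lebesgue" "AE x in lebesgue. v x = T h x"
  shows "measure lebesgue {x\<in>hcube Q. A * tail_norm h Q < norm (v x - far_value h Q)}
    \<le> 2 * weak_constant * (4 * real CARD('n)) ^ CARD('n) / A * measure lebesgue (hcube Q)"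
proof -
  let ?n = "CARD('n)" and ?N = "tail_norm h Q"
  note [measurable] = v(1) L2_measurable[OF h]
  have tn: "tail_average q Q (\<lambda>y. ennreal (norm (h y))) = ennreal ?N" by (rule tail_norm[OF h R0 off Q])
  \<comment> \<open>The parts of \<open>h\<close> near and far from \<open>Q\<close>.\<close>
  define nr where "nr y = indicator (closed_cube (concentric Q 0)) y * h y" for y
  define fr where "fr y = indicator (- closed_cube (concentric Q 0)) y * h y" for y
  have cs: "- closed_cube (concentric Q 0) \<in> sets lebesgue"
    using sets.compl_sets[OF closed_cube_sets[of "concentric Q 0"]] by (simp add: Compl_eq_Diff_UNIV)
  have L: "nr \<in> L2" "fr \<in> L2" unfolding nr_def fr_def using cs by (auto intro!: L2_restrict h)
  have split: "h = (\<lambda>y. nr y + fr y)" by (auto simp: nr_def fr_def indicator_def)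
  define V where "V = (4 * real ?n) ^ ?n * measure lebesgue (hcube Q)"
  have V: "0 \<le> V" by (simp add: V_def)
  have nr_L1: "(\<integral>\<^sup>+x. ennreal (norm (nr x)) \<partial>lebesgue) \<le> ennreal (?N * V)"
  proof -
    have "(\<integral>\<^sup>+x. ennreal (norm (nr x)) \<partial>lebesgue) = (\<integral>\<^sup>+x\<in>closed_cube (concentric Q 0). ennreal (norm (h x)) \<partial>lebesgue)"
      by (intro nn_integral_cong) (auto simp: nr_def indicator_def)
    also have "\<dots> = (\<integral>\<^sup>+x\<in>hcube (concentric Q 0). ennreal (norm (h x)) \<partial>lebesgue)"
      using concentric_pos[OF Q, of 0] by (intro nn_integral_closed_cube) simp
    also have "\<dots> = average (closed_cube (concentric Q 0)) (\<lambda>x. ennreal (norm (h x))) * emeasure lebesgue (hcube (concentric Q 0))"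
      by (rule average_mult_emeasure[OF concentric_pos[OF Q], symmetric])
    also have "\<dots> \<le> ennreal ?N * emeasure lebesgue (hcube (concentric Q 0))"
      using average_le_tail_average[of Q "\<lambda>x. ennreal (norm (h x))" q] tn
      by (intro mult_right_mono) simp_all
    also have "emeasure lebesgue (hcube (concentric Q 0)) = ennreal V"
      using concentric_pos[OF Q, of 0] Q by (simp add: emeasure_hcube V_def measure_hcube snd_concentric power_mult_distrib)
    finally show ?thesis using V tail_norm_nonneg by (simp add: ennreal_mult)
  qed
  have nr_off: "nr y = 0" if "y \<notin> hcube R0" for y using off[OF that] by (simp add: nr_def)
  have weak: "emeasure lebesgue {x. A / 2 * ?N < norm (T nr x)} \<le> ennreal (weak_constant / (A / 2) * V)"
    using A by (intro weak_type_scaled[OF L(1) R0 nr_off tail_norm_nonneg V _ nr_L1]) auto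
  have Tnr: "T nr \<in> borel_measurable lebesgue" by (rule L2_measurable[OF T_L2[OF L(1)]])
  have ms: "{x. A / 2 * ?N < norm (T nr x)} \<in> sets lebesgue"
  proof -
    note [measurable] = Tnr
    have "{x. A / 2 * ?N < norm (T nr x)} = {x\<in>space lebesgue. A / 2 * ?N < norm (T nr x)}" by simp
    also have "\<dots> \<in> sets lebesgue" by measurable
    finally show ?thesis .
  qed
  have "AE x in lebesgue. T h x = T nr x + T fr x"
    using T_add[OF L] unfolding split[symmetric] .
  moreover have "AE x in lebesgue. x \<in> hcube Q \<longrightarrow>
    ennreal (norm (T (\<lambda>y. indicator (- closed_cube (concentric Q 0)) y * h y) x - far_value h Q))
      \<le> ennreal (C * 4 ^ CARD('n)) * tail_average q Q (\<lambda>y. ennreal (norm (h y)))"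
    by (rule far_part[OF h R0 off Q])
  ultimately have "AE x in lebesgue. x \<in> {x\<in>hcube Q. A * ?N < norm (v x - far_value h Q)} \<longrightarrow> x \<in> {x. A / 2 * ?N < norm (T nr x)}"
    using v(2)
  proof eventually_elim
    fix x assume x: "T h x = T nr x + T fr x" and vx: "v x = T h x"
      and far: "x \<in> hcube Q \<longrightarrow> ennreal (norm (T (\<lambda>y. indicator (- closed_cube (concentric Q 0)) y * h y) x - far_value h Q))
      \<le> ennreal (C * 4 ^ ?n) * tail_average q Q (\<lambda>y. ennreal (norm (h y)))"
    show "x \<in> {x\<in>hcube Q. A * ?N < norm (v x - far_value h Q)} \<longrightarrow> x \<in> {x. A / 2 * ?N < norm (T nr x)}"
    proof
      assume "x \<in> {x\<in>hcube Q. A * ?N < norm (v x - far_value h Q)}"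
      then have xQ: "x \<in> hcube Q" and big: "A * ?N < norm (v x - far_value h Q)" by auto
      have "ennreal (norm (T fr x - far_value h Q)) \<le> ennreal (C * 4 ^ ?n * ?N)"
        using far xQ C tail_norm_nonneg[of h Q] unfolding tn fr_def by (simp add: ennreal_mult)
      then have "norm (T fr x - far_value h Q) \<le> C * 4 ^ ?n * ?N"
        using C tail_norm_nonneg[of h Q] by (subst (asm) ennreal_le_iff) auto
      also have "\<dots> \<le> A / 2 * ?N" using A tail_norm_nonneg[of h Q] by (intro mult_right_mono) auto
      finally have f: "norm (T fr x - far_value h Q) \<le> A / 2 * ?N" .
      have "v x - far_value h Q = T nr x + (T fr x - far_value h Q)" using x vx by simp
      then have "norm (v x - far_value h Q) \<le> norm (T nr x) + norm (T fr x - far_value h Q)"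
        by (simp only: norm_triangle_ineq)
      then show "x \<in> {x. A / 2 * ?N < norm (T nr x)}" using big f by (simp add: field_simps)
    qed
  qed
  then have "emeasure lebesgue {x\<in>hcube Q. A * ?N < norm (v x - far_value h Q)} \<le> emeasure lebesgue {x. A / 2 * ?N < norm (T nr x)}"
    by (rule emeasure_mono_AE) (rule ms)
  also note weak
  finally have "measure lebesgue {x\<in>hcube Q. A * ?N < norm (v x - far_value h Q)} \<le> weak_constant / (A / 2) * V"
    using weak_constant_nonneg A V by (simp add: measure_def enn2real_leI)
  also have "\<dots> = 2 * weak_constant * (4 * real ?n) ^ ?n / A * measure lebesgue (hcube Q)"
    by (simp add: V_def)
  finally show ?thesis .
qed

end

section \<open>Sparse domination of the commutator\<close>

primrec running_max :: "(nat \<Rightarrow> real) \<Rightarrow> nat \<Rightarrow> real" where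
  "running_max u 0 = u 0"
| "running_max u (Suc k) = max (running_max u k) (u (Suc k))"

lemma running_max_upper: "j \<le> k \<Longrightarrow> u j \<le> running_max u k"
  by (induction k) (auto simp: le_Suc_eq)

lemma running_max_cong: "(\<And>j. j \<le> k \<Longrightarrow> u j = v j) \<Longrightarrow> running_max u k = running_max v k"
  by (induction k) auto

lemma running_max_least: "(\<And>j. P (u j)) \<Longrightarrow> P (running_max u k)"
  by (induction k) (auto simp: max_def)

lemma sparse_chain_running_max_adapted:
  assumes "sparse_chain R ch" and G: "\<And>Q. 0 \<le> G Q"
  shows "sparse_chain.adapted ch (\<lambda>k x. running_max (\<lambda>j. case ch j x of None \<Rightarrow> 0 | Some Q \<Rightarrow> G Q) k)"
proof -
  interpret sparse_chain R ch by fact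
  define g where "g j x = (case ch j x of None \<Rightarrow> 0 | Some Q \<Rightarrow> G Q)" for j x
  have gm [measurable]: "g j \<in> borel_measurable lebesgue" for j
    unfolding g_def by (rule borel_measurable_chain)
  have g0: "0 \<le> g j x" for j x using G by (auto simp: g_def split: option.splits)
  have "adapted (\<lambda>k x. running_max (\<lambda>j. g j x) k)"
    unfolding adapted_def
  proof (intro conjI allI impI)
    fix k x
    show "(\<lambda>x. running_max (\<lambda>j. g j x) k) \<in> borel_measurable lebesgue"
      by (induction k) simp_all
    show "0 \<le> running_max (\<lambda>j. g j x) k" by (rule running_max_least[where P="\<lambda>r. 0 \<le> r"]) (rule g0)
    show "running_max (\<lambda>j. g j x) k \<le> running_max (\<lambda>j. g j x) (Suc k)" by simp
    fix Q y assume Q: "ch k x = Some Q" and y: "y \<in> hcube Q"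
    show "running_max (\<lambda>j. g j y) k = running_max (\<lambda>j. g j x) k"
    proof (rule running_max_cong)
      fix j assume "j \<le> k"
      then have "ch j y = ch j x" by (rule chain_eq[OF Q y])
      then show "g j y = g j x" by (simp add: g_def)
    qed
  qed
  then show ?thesis by (simp add: g_def)
qed

context cz_operator begin

text \<open>Large enough for the three exceptional sets of a cube, for \<open>f\<close>, for \<open>b\<close> and for \<open>(b - \<beta>\<^sub>Q) f\<close>, to have
total relative measure at most \<open>2 powr -(n+4)\<close>.\<close>

definition oscillation_constant :: real where
  "oscillation_constant = 2 ^ (CARD('n) + 4) * (4 * weak_constant * (4 * real CARD('n)) ^ CARD('n) + 1) + 2 * (C * 4 ^ CARD('n))"

definition size_constant :: real where
  "size_constant = 1 / (1 - q) + (2 ^ (CARD('n) + 6) + (4 * real CARD('n)) ^ CARD('n)) / (1 - q)\<^sup>2"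

definition domination_constant :: real where
  "domination_constant = 9 * oscillation_constant\<^sup>2 + 3 * oscillation_constant"

lemma oscillation_constant_pos: "0 < oscillation_constant"
proof -
  have "0 \<le> 4 * weak_constant * (4 * real CARD('n)) ^ CARD('n)"
    using weak_constant_nonneg by (intro mult_nonneg_nonneg) auto
  then have "0 < 4 * weak_constant * (4 * real CARD('n)) ^ CARD('n) + 1" by linarith
  from mult_pos_pos[OF _ this, of "2 ^ (CARD('n) + 4)"]
  have "0 < 2 ^ (CARD('n) + 4) * (4 * weak_constant * (4 * real CARD('n)) ^ CARD('n) + 1)" by simp
  then show ?thesis unfolding oscillation_constant_def by (rule add_pos_nonneg) (use C in simp)
qed

lemma domination_constant_pos: "0 < domination_constant"
  using oscillation_constant_pos by (simp add: domination_constant_def add_nonneg_pos)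

lemma size_constant_pos: "0 < size_constant"
  unfolding size_constant_def using q by (intro add_pos_nonneg) (auto intro!: divide_nonneg_nonneg add_nonneg_nonneg)

text \<open>Attach to each cube \<open>Q\<close> of the chain the numbers \<open>t Q\<close>, the mean of \<open>b\<close>, and \<open>s Q\<close>, close to which
\<open>v = T f\<close>, \<open>b\<close> and \<open>u - \<beta>\<^sub>Q v = T ((b - \<beta>\<^sub>Q) f)\<close> stay on the good part of \<open>Q\<close>. Comparison at a common good point shows
that \<open>\<parallel>b\<parallel> t\<close> changes by \<open>O(a)\<close> in each step, and that \<open>s\<close> changes by \<open>O(a)\<close> plus the jump of the mean
of \<open>b\<close> times \<open>|v|\<close>. Thus \<open>\<parallel>b\<parallel> |t|\<close> is bounded by the partial sums of \<open>a\<close>, and \<open>|s|\<close> by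
the partial sums of these. At the root both numbers vanish, as \<open>f\<close> has no far part there.\<close>

lemma commutator_sparse_domination:
  fixes b f :: "real^'n \<Rightarrow> complex" and R :: "'n node"
  assumes b: "b \<in> BMO" and f: "f \<in> L2" and bf: "(\<lambda>y. b y * f y) \<in> L2" and R: "0 < snd R"
    and off: "\<And>y. y \<notin> hcube R \<Longrightarrow> f y = 0"
  obtains ch a where "sparse_chain R ch" "sparse_chain.adapted ch a"
    "\<And>k x. x \<in> hcube R \<Longrightarrow>
       ennreal (a k x) \<le> ennreal size_constant * BMO_norm b * hl_maximal (hl_maximal (\<lambda>y. ennreal (norm (f y)))) x"
    "\<And>k x. x \<in> sparse_chain.level ch k \<Longrightarrow> x \<notin> sparse_chain.level ch (Suc k) \<Longrightarrow>
       norm (commutator b T f x) \<le>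
         domination_constant * sparse_chain.cumulative ch (sparse_chain.cumulative ch a) k x"
proof -
  let ?n = "CARD('n)"
  define A where "A = oscillation_constant"
  have A: "0 < A" using oscillation_constant_pos by (simp add: A_def)
  define \<beta> where "\<beta> = enn2real (BMO_norm b)"
  have \<beta>: "0 \<le> \<beta>" "BMO_norm b = ennreal \<beta>" using BMO_D(4)[OF b] by (auto simp: \<beta>_def)
  define v where "v = T f"
  define u where "u = T (\<lambda>y. b y * f y)"
  define H where "H Q y = (b y - cube_mean b Q) * f y" for Q y
  note [measurable] = BMO_D(1)[OF b] L2_measurable[OF f]
  have vm [measurable]: "v \<in> borel_measurable lebesgue" unfolding v_def by (rule L2_measurable[OF T_L2[OF f]])
  have um [measurable]: "u \<in> borel_measurable lebesgue" unfolding u_def by (rule L2_measurable[OF T_L2[OF bf]])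
  have H_eq: "H Q = (\<lambda>y. b y * f y - cube_mean b Q * f y)" for Q by (auto simp: H_def algebra_simps)
  have H_L2: "H Q \<in> L2" for Q unfolding H_eq by (rule L2_diff[OF bf L2_cmult[OF f]])
  have H_off: "H Q y = 0" if "y \<notin> hcube R" for Q y using off[OF that] by (simp add: H_def)
  have TH: "AE x in lebesgue. u x - cube_mean b Q * v x = T (H Q) x" for Q
    using T_diff[OF bf L2_cmult[OF f, of "cube_mean b Q"]] T_scale[OF f, of "cube_mean b Q"]
    unfolding H_eq u_def v_def by eventually_elim simp
  define t where "t Q = far_value f Q" for Q
  define s where "s Q = far_value (H Q) Q" for Q
  define n1 where "n1 Q = tail_norm f Q" for Q
  define n2 where "n2 Q = tail_norm (H Q) Q" for Q
  have n0: "0 \<le> n1 Q" "0 \<le> n2 Q" for Q by (auto simp: n1_def n2_def tail_norm_nonneg)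
  define B1 where "B1 Q = {x\<in>hcube Q. A * n1 Q < norm (v x - t Q)}" for Q
  define B2 where "B2 Q = {x\<in>hcube Q. A * \<beta> < norm (b x - cube_mean b Q)}" for Q
  define B3 where "B3 Q = {x\<in>hcube Q. A * n2 Q < norm (u x - cube_mean b Q * v x - s Q)}" for Q
  define Bad where "Bad Q = B1 Q \<union> B2 Q \<union> B3 Q" for Q
  have superlevel: "{x\<in>hcube Q. c < norm (w x)} \<in> sets lebesgue" if "w \<in> borel_measurable lebesgue"
    for Q c and w :: "real^'n \<Rightarrow> complex"
  proof -
    note [measurable] = that
    have "{x\<in>hcube Q. c < norm (w x)} = hcube Q \<inter> {x\<in>space lebesgue. c < norm (w x)}" by auto
    also have "\<dots> \<in> sets lebesgue" by measurable
    finally show ?thesis .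
  qed
  have Bm: "B1 Q \<in> sets lebesgue" "B2 Q \<in> sets lebesgue" "B3 Q \<in> sets lebesgue" for Q
    unfolding B1_def B2_def B3_def by (rule superlevel, measurable)+
  obtain ch where ch: "sparse_chain R ch"
    and stop: "\<And>k x Q. ch k x = Some Q \<Longrightarrow> ch (Suc k) x = None \<Longrightarrow> x \<notin> Bad Q"
    and child: "\<And>k x Q P. ch k x = Some Q \<Longrightarrow> ch (Suc k) x = Some P \<Longrightarrow> \<exists>y\<in>hcube P. y \<notin> Bad Q \<and> y \<notin> Bad P"
  proof (rule sparse_chain_exists[OF R, of Bad])
    fix Q :: "'n node" assume Q: "0 < snd Q"
    show "Bad Q \<in> sets lebesgue" unfolding Bad_def by (intro sets.Un Bm)
    show "Bad Q \<subseteq> hcube Q" by (auto simp: Bad_def B1_def B2_def B3_def)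
    let ?m = "measure lebesgue (hcube Q)"
    \<comment> \<open>The relative measure of each of the two exceptional sets of the operator is at most \<open>W / A\<close>.\<close>
    define W where "W = 2 * weak_constant * (4 * real ?n) ^ ?n"
    have W: "0 \<le> W" unfolding W_def using weak_constant_nonneg by (intro mult_nonneg_nonneg) auto
    have A2: "2 * (C * 4 ^ ?n) \<le> A"
      unfolding A_def oscillation_constant_def using W unfolding W_def by simp
    have "measure lebesgue (B1 Q) \<le> W / A * ?m"
      unfolding B1_def n1_def t_def W_def
      by (rule local_oscillation[OF f R off Q A A2 vm]) (simp_all add: v_def)
    moreover have "measure lebesgue (B2 Q) \<le> ?m / A"
      unfolding B2_def \<beta>_def by (rule BMO_oscillation_measure[OF b Q A])
    moreover have "measure lebesgue (B3 Q) \<le> W / A * ?m"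
      unfolding B3_def n2_def s_def W_def
      by (rule local_oscillation[OF H_L2 R H_off Q A A2 _ TH]) measurable
    moreover have "measure lebesgue (Bad Q) \<le> measure lebesgue (B1 Q) + measure lebesgue (B2 Q) + measure lebesgue (B3 Q)"
    proof -
      have fm: "B1 Q \<in> lmeasurable" "B2 Q \<in> lmeasurable" "B3 Q \<in> lmeasurable"
        using Q by (auto intro!: fmeasurableI2[OF hcube_lmeasurable[of Q]] Bm simp: B1_def[of Q] B2_def[of Q] B3_def[of Q] superlevel)
      have "measure lebesgue (Bad Q) \<le> measure lebesgue (B1 Q \<union> B2 Q) + measure lebesgue (B3 Q)"
        unfolding Bad_def using fm by (intro measure_Un_le) auto
      also have "\<dots> \<le> measure lebesgue (B1 Q) + measure lebesgue (B2 Q) + measure lebesgue (B3 Q)"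
        using fm by (intro add_right_mono measure_Un_le) auto
      finally show ?thesis .
    qed
    ultimately have "measure lebesgue (Bad Q) \<le> (2 * W + 1) / A * ?m"
      by (simp add: add_divide_distrib distrib_right)
    also have "\<dots> \<le> 1 / 2 ^ (?n + 4) * ?m"
    proof (rule mult_right_mono)
      have "A = 2 ^ (?n + 4) * (2 * W + 1) + 2 * (C * 4 ^ ?n)"
        unfolding A_def oscillation_constant_def W_def by (simp only: mult.assoc) simp
      then have "2 ^ (?n + 4) * (2 * W + 1) \<le> A" using C by simp
      then show "(2 * W + 1) / A \<le> 1 / 2 ^ (?n + 4)" using A by (simp add: field_simps)
    qed simp
    finally show "measure lebesgue (Bad Q) \<le> ?m / 2 ^ (?n + 4)" by simp
  qed (rule that)
  interpret sparse_chain R ch by (rule ch)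
  have good: "norm (v x - t Q) \<le> A * n1 Q" "norm (b x - cube_mean b Q) \<le> A * \<beta>"
    "norm (u x - cube_mean b Q * v x - s Q) \<le> A * n2 Q" if "x \<in> hcube Q" "x \<notin> Bad Q" for x Q
    using that by (auto simp: Bad_def B1_def B2_def B3_def not_less)
  define G where "G Q = \<beta> * n1 Q + n2 Q" for Q
  have G0: "0 \<le> G Q" for Q using \<beta> n0 by (simp add: G_def)
  define g where "g j x = (case ch j x of None \<Rightarrow> 0 | Some Q \<Rightarrow> G Q)" for j x
  define a where "a k x = running_max (\<lambda>j. g j x) k" for k x
  have a: "adapted a"
    using sparse_chain_running_max_adapted[OF ch G0] unfolding a_def g_def .
  define D where "D = cumulative a"
  define E where "E = cumulative D"
  have Dad: "adapted D" unfolding D_def by (rule adapted_cumulative[OF a])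
  have Ead: "adapted E" unfolding E_def by (rule adapted_cumulative[OF Dad])
  have a0: "0 \<le> a k x" and D0: "0 \<le> D k x" and E0: "0 \<le> E k x" for k x
    using adapted_nonneg a Dad Ead by auto
  have n_le: "\<beta> * n1 Q \<le> a k x" "n2 Q \<le> a k x" if "ch k x = Some Q" for k x Q
  proof -
    have "G Q \<le> a k x" using running_max_upper[of k k "\<lambda>j. g j x"] that by (simp add: a_def g_def)
    moreover have "0 \<le> \<beta> * n1 Q" using \<beta> n0 by simp
    ultimately show "\<beta> * n1 Q \<le> a k x" "n2 Q \<le> a k x" using n0(2)[of Q] by (auto simp: G_def)
  qed
  have a_le_D: "a k x \<le> D k x" and D_le_E: "D k x \<le> E k x" if "x \<in> level k" for k x
  proof -
    show "a k x \<le> D k x"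
    proof (cases k)
      case 0 then show ?thesis using that by (simp add: D_def cumulative_0)
    next
      case (Suc j) then show ?thesis using that D0[of j x] by (simp add: D_def cumulative_Suc)
    qed
    show "D k x \<le> E k x"
    proof (cases k)
      case 0 then show ?thesis using that by (simp add: E_def cumulative_0)
    next
      case (Suc j) then show ?thesis using that E0[of j x] by (simp add: E_def cumulative_Suc)
    qed
  qed
  have step: "\<beta> * norm (t P - t Q) \<le> 2 * A * a (Suc k) x \<and>
     norm (s P - s Q) \<le> 2 * A * a (Suc k) x + 2 * A * (\<beta> * norm (t P) + A * a (Suc k) x)"
    if Q: "ch k x = Some Q" and P: "ch (Suc k) x = Some P" for k x P Q
  proof -
    obtain y where y: "y \<in> hcube P" "y \<notin> Bad Q" "y \<notin> Bad P" using child[OF Q P] by blast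
    have yQ: "y \<in> hcube Q" using nested[OF Q P] y(1) by blast
    note gQ = good[OF yQ y(2)] and gP = good[OF y(1) y(3)]
    have aa: "a k x \<le> a (Suc k) x" using adapted_mono[OF a, of k "Suc k" x] by simp
    note nQ = n_le[OF Q] and nP = n_le[OF P]
    have "norm (t P - t Q) \<le> norm (v y - t Q) + norm (v y - t P)"
      using norm_triangle_ineq4[of "v y - t Q" "v y - t P"] by simp
    then have "norm (t P - t Q) \<le> A * n1 Q + A * n1 P" using gQ(1) gP(1) by linarith
    then have "\<beta> * norm (t P - t Q) \<le> \<beta> * (A * n1 Q + A * n1 P)" using \<beta>(1) by (rule mult_left_mono)
    also have "\<dots> = A * (\<beta> * n1 Q + \<beta> * n1 P)" by (simp add: algebra_simps)
    also have "\<dots> \<le> A * (a (Suc k) x + a (Suc k) x)" using A nQ(1) nP(1) aa by (intro mult_left_mono) auto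
    finally have 1: "\<beta> * norm (t P - t Q) \<le> 2 * A * a (Suc k) x" by simp
    have "norm (cube_mean b Q - cube_mean b P) \<le> norm (b y - cube_mean b P) + norm (b y - cube_mean b Q)"
      using norm_triangle_ineq4[of "b y - cube_mean b P" "b y - cube_mean b Q"] by simp
    then have m: "norm (cube_mean b Q - cube_mean b P) \<le> 2 * A * \<beta>" using gQ(2) gP(2) by simp
    have "norm (v y) \<le> norm (v y - t P) + norm (t P)" using norm_triangle_ineq[of "v y - t P" "t P"] by simp
    then have vy: "norm (v y) \<le> A * n1 P + norm (t P)" using gP(1) by simp
    have "norm ((cube_mean b Q - cube_mean b P) * v y) \<le> 2 * A * \<beta> * (A * n1 P + norm (t P))"
      unfolding norm_mult using m vy A \<beta>(1) by (intro mult_mono) auto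
    also have "\<dots> = 2 * A * (\<beta> * norm (t P) + A * (\<beta> * n1 P))" by (simp add: algebra_simps)
    also have "\<dots> \<le> 2 * A * (\<beta> * norm (t P) + A * a (Suc k) x)"
      using A nP(1) by (intro mult_left_mono add_left_mono) auto
    finally have mv: "norm ((cube_mean b Q - cube_mean b P) * v y) \<le> 2 * A * (\<beta> * norm (t P) + A * a (Suc k) x)" .
    define zQ where "zQ = u y - cube_mean b Q * v y - s Q"
    define zP where "zP = u y - cube_mean b P * v y - s P"
    have "s P - s Q = zQ - zP + (cube_mean b Q - cube_mean b P) * v y"
      by (simp add: zQ_def zP_def algebra_simps)
    then have "norm (s P - s Q) \<le> norm zQ + norm zP + norm ((cube_mean b Q - cube_mean b P) * v y)"
      using norm_triangle_ineq[of "zQ - zP" "(cube_mean b Q - cube_mean b P) * v y"] norm_triangle_ineq4[of zQ zP] by simp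
    moreover have "norm zQ \<le> A * a (Suc k) x" "norm zP \<le> A * a (Suc k) x"
      unfolding zQ_def zP_def
      by (rule order_trans[OF gQ(3) mult_left_mono], use nQ(2) aa A in linarith, use A in linarith)
         (rule order_trans[OF gP(3) mult_left_mono], use nP(2) A in linarith, use A in linarith)
    ultimately have "norm (s P - s Q) \<le> 2 * A * a (Suc k) x + 2 * A * (\<beta> * norm (t P) + A * a (Suc k) x)"
      using mv by simp
    with 1 show ?thesis by blast
  qed
  have t_bound: "\<beta> * norm (t Q) \<le> 2 * A * D k x" if "ch k x = Some Q" for k x Q
    using that
  proof (induction k arbitrary: Q)
    case 0
    then have "Q = R" by (simp add: root split: if_splits)
    then have "t Q = 0" unfolding t_def using far_value_zero[OF R off] by simp
    then show ?case using A D0 by simp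
  next
    case (Suc k)
    have "ch k x \<noteq> None"
    proof
      assume "ch k x = None"
      from stopped[OF this] Suc.prems show False by simp
    qed
    then obtain Q' where Q': "ch k x = Some Q'" unfolding not_None_eq by blast
    have "x \<in> level (Suc k)" using Suc.prems by (simp add: level_def)
    then have D: "D (Suc k) x = D k x + a (Suc k) x" by (simp add: D_def cumulative_Suc)
    have "norm (t Q) \<le> norm (t Q - t Q') + norm (t Q')" using norm_triangle_ineq[of "t Q - t Q'" "t Q'"] by simp
    then have "\<beta> * norm (t Q) \<le> \<beta> * (norm (t Q - t Q') + norm (t Q'))" using \<beta>(1) by (rule mult_left_mono)
    also have "\<dots> \<le> 2 * A * a (Suc k) x + 2 * A * D k x"
      using step[OF Q' Suc.prems] Suc.IH[OF Q'] by (simp add: distrib_left)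
    finally show ?case by (simp add: D algebra_simps)
  qed
  define M where "M = 2 * A + 6 * A\<^sup>2"
  have M0: "0 \<le> M" using A by (simp add: M_def)
  have s_bound: "norm (s Q) \<le> M * E k x" if "ch k x = Some Q" for k x Q
    using that
  proof (induction k arbitrary: Q)
    case 0
    then have "Q = R" by (simp add: root split: if_splits)
    then have "s Q = 0" unfolding s_def using far_value_zero[OF R H_off] by simp
    then show ?case using M0 E0 by simp
  next
    case (Suc k)
    have "ch k x \<noteq> None"
    proof
      assume "ch k x = None"
      from stopped[OF this] Suc.prems show False by simp
    qed
    then obtain Q' where Q': "ch k x = Some Q'" unfolding not_None_eq by blast
    have lev: "x \<in> level (Suc k)" using Suc.prems by (simp add: level_def)
    then have E: "E (Suc k) x = E k x + D (Suc k) x" by (simp add: E_def cumulative_Suc)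
    have aD: "a (Suc k) x \<le> D (Suc k) x" by (rule a_le_D[OF lev])
    have "norm (s Q) \<le> norm (s Q - s Q') + norm (s Q')" using norm_triangle_ineq[of "s Q - s Q'" "s Q'"] by simp
    also have "\<dots> \<le> 2 * A * a (Suc k) x + 2 * A * (\<beta> * norm (t Q) + A * a (Suc k) x) + M * E k x"
      using step[OF Q' Suc.prems] Suc.IH[OF Q'] by (intro add_mono) auto
    also have "\<dots> \<le> 2 * A * D (Suc k) x + 2 * A * (2 * A * D (Suc k) x + A * D (Suc k) x) + M * E k x"
      using A M0 aD t_bound[OF Suc.prems] by (intro add_mono mult_left_mono) auto
    also have "\<dots> = M * E (Suc k) x" by (simp add: E M_def algebra_simps power2_eq_square)
    finally show ?case .
  qed
  show ?thesis
  proof (rule that[OF ch a])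
    fix k x assume x: "x \<in> hcube R"
    let ?F = "\<lambda>y. ennreal (norm (f y))"
    let ?X = "ennreal size_constant * BMO_norm b * hl_maximal (hl_maximal ?F) x"
    show "ennreal (a k x) \<le> ?X"
      unfolding a_def
    proof (rule running_max_least[where P="\<lambda>r. ennreal r \<le> ?X"])
      fix j
      show "ennreal (g j x) \<le> ?X"
      proof (cases "ch j x")
        case None then show ?thesis by (simp add: g_def)
      next
        case (Some Q)
        have Q: "0 < snd Q" "x \<in> hcube Q" using chain_pos[OF Some] chain_mem[OF Some] by auto
        have "ennreal (n1 Q) = tail_average q Q ?F"
          unfolding n1_def by (rule tail_norm[OF f R off Q(1), symmetric])
        also have "\<dots> \<le> ennreal (1 / (1 - q)) * hl_maximal (hl_maximal ?F) x"
          by (rule tail_average_le_maximal2[OF q Q]) 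
        finally have 1: "ennreal (n1 Q) \<le> ennreal (1 / (1 - q)) * hl_maximal (hl_maximal ?F) x" .
        have "ennreal (n2 Q) = tail_average q Q (\<lambda>y. ennreal (norm (H Q y)))"
          unfolding n2_def by (rule tail_norm[OF H_L2 R H_off Q(1), symmetric])
        also have "\<dots> = tail_average q Q (\<lambda>y. ennreal (norm (b y - cube_mean b Q)) * ?F y)"
          by (simp add: H_def norm_mult ennreal_mult)
        also have "\<dots> \<le> ennreal ((2 ^ (?n + 6) + (4 * real ?n) ^ ?n) / (1 - q)\<^sup>2) * BMO_norm b * hl_maximal (hl_maximal ?F) x"
          by (rule tail_average_BMO[OF b q Q]) measurable
        finally have 2: "ennreal (n2 Q) \<le> ennreal ((2 ^ (?n + 6) + (4 * real ?n) ^ ?n) / (1 - q)\<^sup>2) * BMO_norm b * hl_maximal (hl_maximal ?F) x" .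
        have "ennreal (g j x) = ennreal \<beta> * ennreal (n1 Q) + ennreal (n2 Q)"
          using Some \<beta> n0 by (simp add: g_def G_def ennreal_mult)
        also have "\<dots> \<le> ennreal \<beta> * (ennreal (1 / (1 - q)) * hl_maximal (hl_maximal ?F) x) +
           ennreal ((2 ^ (?n + 6) + (4 * real ?n) ^ ?n) / (1 - q)\<^sup>2) * BMO_norm b * hl_maximal (hl_maximal ?F) x"
          by (intro add_mono mult_left_mono 1 2) simp
        also have "\<dots> = (ennreal (1 / (1 - q)) + ennreal ((2 ^ (?n + 6) + (4 * real ?n) ^ ?n) / (1 - q)\<^sup>2)) * BMO_norm b * hl_maximal (hl_maximal ?F) x"
          unfolding \<beta>(2) by (simp add: distrib_right distrib_left mult_ac)
        also have "\<dots> = ?X"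
          unfolding size_constant_def using q by (subst ennreal_plus) (auto intro!: divide_nonneg_nonneg add_nonneg_nonneg)
        finally show ?thesis .
      qed
    qed
  next
    fix k x assume x: "x \<in> level k" "x \<notin> level (Suc k)"
    obtain Q where Q: "ch k x = Some Q" using x(1) by (auto simp: level_def)
    have "ch (Suc k) x = None" using x(2) unfolding level_def by simp
    then have nb: "x \<notin> Bad Q" by (rule stop[OF Q])
    note go = good[OF chain_mem[OF Q] nb]
    have "norm (v x) \<le> norm (v x - t Q) + norm (t Q)" using norm_triangle_ineq[of "v x - t Q" "t Q"] by simp
    then have vx: "norm (v x) \<le> A * n1 Q + norm (t Q)" using go(1) by simp
    have aD: "a k x \<le> D k x" by (rule a_le_D[OF x(1)])
    have "norm ((b x - cube_mean b Q) * v x) \<le> A * \<beta> * (A * n1 Q + norm (t Q))"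
      unfolding norm_mult using go(2) vx A \<beta>(1) by (intro mult_mono) auto
    also have "\<dots> = A * (A * (\<beta> * n1 Q) + \<beta> * norm (t Q))" by (simp add: algebra_simps)
    also have "\<dots> \<le> A * (A * D k x + 2 * A * D k x)"
      using A aD n_le(1)[OF Q] t_bound[OF Q] by (intro mult_left_mono add_mono) auto
    finally have 1: "norm ((b x - cube_mean b Q) * v x) \<le> 3 * A\<^sup>2 * D k x" by (simp add: power2_eq_square algebra_simps)
    have "norm (u x - cube_mean b Q * v x) \<le> norm (u x - cube_mean b Q * v x - s Q) + norm (s Q)"
      using norm_triangle_ineq[of "u x - cube_mean b Q * v x - s Q" "s Q"] by simp
    also have "\<dots> \<le> A * D k x + M * E k x"
      using go(3) s_bound[OF Q] n_le(2)[OF Q] aD A order_trans[OF go(3) mult_left_mono[of "n2 Q" "D k x" A]] by (intro add_mono) auto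
    finally have 2: "norm (u x - cube_mean b Q * v x) \<le> A * D k x + M * E k x" .
    have "commutator b T f x = (b x - cube_mean b Q) * v x - (u x - cube_mean b Q * v x)"
      by (simp add: commutator_def u_def v_def algebra_simps)
    then have "norm (commutator b T f x) \<le> norm ((b x - cube_mean b Q) * v x) + norm (u x - cube_mean b Q * v x)"
      by (simp only: norm_triangle_ineq4)
    also have "\<dots> \<le> 3 * A\<^sup>2 * D k x + (A * D k x + M * E k x)" by (rule add_mono[OF 1 2])
    also have "\<dots> \<le> 3 * A\<^sup>2 * E k x + (A * E k x + M * E k x)"
      using A M0 D_le_E[OF x(1)] by (intro add_mono mult_left_mono) auto
    also have "\<dots> = domination_constant * E k x"
      by (simp add: domination_constant_def M_def A_def algebra_simps)
    finally show "norm (commutator b T f x) \<le> domination_constant * cumulative (cumulative a) k x"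
      by (simp add: E_def D_def)
  qed
qed

end

section \<open>The weighted inequality\<close>

lemma ennreal_powr_ennreal: "0 \<le> r \<Longrightarrow> 0 < p \<Longrightarrow> ennreal_powr (ennreal r) p = ennreal (r powr p)"
  by (auto simp: ennreal_powr_def ennreal_eq_0_iff)

lemma ennreal_powr_top: "0 < p \<Longrightarrow> ennreal_powr top p = top"
  by (simp add: ennreal_powr_def)

lemma ennreal_powr_zero: "0 < p \<Longrightarrow> ennreal_powr 0 p = 0"
  by (simp add: ennreal_powr_def)

lemma ennreal_powr_eq_0D: "0 < p \<Longrightarrow> ennreal_powr x p = 0 \<Longrightarrow> x = 0"
  by (cases x) (auto simp: ennreal_powr_ennreal ennreal_powr_top ennreal_eq_0_iff)

lemma ennreal_powr_mono:
  assumes "0 < p" "x \<le> y"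
  shows "ennreal_powr x p \<le> ennreal_powr y p"
proof (cases y)
  case (real s)
  then obtain r where r: "x = ennreal r" "0 \<le> r" using assms(2) by (cases x) (auto simp: top_unique)
  then have "r \<le> s" using assms(2) real by simp
  then show ?thesis using r real assms(1) by (simp add: ennreal_powr_ennreal ennreal_leI powr_mono2)
qed (use assms in \<open>simp add: ennreal_powr_top\<close>)

text \<open>The value \<open>\<infinity>\<close> of \<open>X\<close> needs care only for \<open>c = 0\<close>, where it forces \<open>r = 0\<close>.\<close>

lemma powr_le_ennreal_powr:
  assumes "ennreal r \<le> ennreal c * X" "0 \<le> r" "0 \<le> c" "0 < p"
  shows "ennreal (r powr p) \<le> ennreal (c powr p) * ennreal_powr X p"
proof (cases X)
  case (real x)
  then have "r \<le> c * x" using assms by (simp add: ennreal_le_iff flip: ennreal_mult)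
  then have "r powr p \<le> (c * x) powr p" using assms by (intro powr_mono2) auto
  then show ?thesis using real assms by (simp add: ennreal_powr_ennreal powr_mult ennreal_leI flip: ennreal_mult)
next
  case top
  then show ?thesis using assms by (cases "c = 0") (auto simp: ennreal_powr_top ennreal_mult_top)
qed

lemma ennreal_powr_root_le:
  assumes "N \<le> ennreal (D powr p) * X" "0 \<le> D" "0 < p"
  shows "ennreal_powr N (1 / p) \<le> ennreal D * ennreal_powr X (1 / p)"
proof (cases "D = 0")
  case True
  then have "N = 0" using assms by simp
  then show ?thesis using assms(3) by (simp add: ennreal_powr_zero)
next
  case False
  then have D: "0 < D" using assms by simp
  have "ennreal_powr N (1 / p) \<le> ennreal_powr (ennreal (D powr p) * X) (1 / p)"
    using assms by (intro ennreal_powr_mono) auto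
  also have "\<dots> = ennreal D * ennreal_powr X (1 / p)"
  proof (cases X)
    case (real x)
    then show ?thesis using D assms(3)
      by (simp add: ennreal_powr_ennreal powr_mult powr_powr flip: ennreal_mult)
  next
    case top
    then show ?thesis using D assms(3) by (simp add: ennreal_powr_top ennreal_mult_top)
  qed
  finally show ?thesis .
qed

text \<open>The function \<open>g\<close> may be nonmeasurable, as powers of maximal functions are used here; the constant is
therefore moved to the side of \<open>f\<close>.\<close>

lemma nn_integral_le_cmult:
  assumes f: "f \<in> borel_measurable M" and le: "\<And>x. f x \<le> ennreal c * g x" and c: "0 \<le> c"
  shows "(\<integral>\<^sup>+x. f x \<partial>M) \<le> ennreal c * (\<integral>\<^sup>+x. g x \<partial>M)"
proof (cases "c = 0")
  case True
  then have "f = (\<lambda>x. 0)" using le by (auto simp: fun_eq_iff)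
  then show ?thesis by simp
next
  case False
  then have c: "0 < c" using c by simp
  have one: "ennreal c * (ennreal (1 / c) * t) = t" "ennreal (1 / c) * (ennreal c * t) = t" for t
    using c by (simp_all add: mult.assoc[symmetric] flip: ennreal_mult)
  have "(\<integral>\<^sup>+x. f x \<partial>M) = ennreal c * (\<integral>\<^sup>+x. ennreal (1 / c) * f x \<partial>M)"
    using f by (simp add: nn_integral_cmult one)
  also have "\<dots> \<le> ennreal c * (\<integral>\<^sup>+x. g x \<partial>M)"
  proof (intro mult_left_mono nn_integral_mono)
    fix x
    show "ennreal (1 / c) * f x \<le> g x" using mult_left_mono[OF le[of x], of "ennreal (1 / c)"] by (simp add: one)
  qed simp
  finally show ?thesis .
qed

definition big_cube :: "nat \<Rightarrow> 'n::finite node" where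
  "big_cube j = (- vec (real (Suc j)), 2 * real (Suc j))"

lemma big_cube_pos: "0 < snd (big_cube j)"
  by (simp add: big_cube_def)

lemma mem_big_cube: "x \<in> hcube (big_cube j) \<longleftrightarrow> (\<forall>i. - real (Suc j) \<le> x $ i \<and> x $ i < real (Suc j))"
  by (simp add: hcube_def big_cube_def)

lemma eventually_mem_big_cube:
  fixes x :: "real^'n"
  shows "\<exists>j. \<forall>k\<ge>j. x \<in> hcube (big_cube k)"
proof -
  obtain j where j: "norm x \<le> real j" using real_arch_simple by blast
  have "x \<in> hcube (big_cube k)" if "j \<le> k" for k
    unfolding mem_big_cube
  proof
    fix i
    have "\<bar>x $ i\<bar> \<le> norm x" by (rule component_le_norm_cart)
    also have "\<dots> < real (Suc k)" using j that by simp
    finally show "- real (Suc k) \<le> x $ i \<and> x $ i < real (Suc k)" by (auto simp: abs_less_iff)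
  qed
  then show ?thesis by blast
qed

context cz_operator begin

text \<open>The partial-sum bound is applied twice, to \<open>a\<close> and to its partial sums, on the part of the cube where
the chain has at most \<open>K\<close> steps; then \<open>K\<close> tends to infinity.\<close>

lemma commutator_weighted_on_cube:
  fixes b f :: "real^'n \<Rightarrow> complex" and R :: "'n node"
  assumes b: "b \<in> BMO" and f: "f \<in> L2" and bf: "(\<lambda>y. b y * f y) \<in> L2" and R: "0 < snd R"
    and off: "\<And>y. y \<notin> hcube R \<Longrightarrow> f y = 0"
    and g [measurable]: "g \<in> borel_measurable lebesgue" and p: "0 < p" and L: "0 < L"
    and A_inf: "\<And>Q. 0 < snd Q \<Longrightarrow> 2 * (\<integral>\<^sup>+x\<in>hcube Q. hl_maximal (\<lambda>y. g y * indicator (hcube Q) y) x \<partial>lebesgue)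
       \<le> ennreal L * (\<integral>\<^sup>+x\<in>hcube Q. g x \<partial>lebesgue)"
  shows "(\<integral>\<^sup>+x\<in>hcube R. ennreal (norm (commutator b T f x) powr p) * g x \<partial>lebesgue) \<le>
    ennreal ((domination_constant * (4 * L * max 1 p)\<^sup>2 * (size_constant * enn2real (BMO_norm b))) powr p) *
     (\<integral>\<^sup>+x. ennreal_powr (hl_maximal (hl_maximal (\<lambda>y. ennreal (norm (f y)))) x) p * g x \<partial>lebesgue)"
proof -
  let ?M = "hl_maximal (hl_maximal (\<lambda>y. ennreal (norm (f y))))"
  define \<beta> where "\<beta> = enn2real (BMO_norm b)"
  have \<beta>: "0 \<le> \<beta>" "BMO_norm b = ennreal \<beta>" using BMO_D(4)[OF b] by (auto simp: \<beta>_def)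
  define s where "s = size_constant * \<beta>"
  have s: "0 \<le> s" using size_constant_pos \<beta>(1) by (simp add: s_def)
  define X where "X = (\<integral>\<^sup>+x. ennreal_powr (?M x) p * g x \<partial>lebesgue)"
  define k where "k = 4 * L * max 1 p"
  have k: "0 < k" using L by (simp add: k_def)
  have dc: "0 < domination_constant" by (rule domination_constant_pos)
  note [measurable] = BMO_D(1)[OF b] L2_measurable[OF f] L2_measurable[OF T_L2[OF f]] L2_measurable[OF T_L2[OF bf]]
  have cm [measurable]: "commutator b T f \<in> borel_measurable lebesgue" unfolding commutator_def by measurable
  obtain ch a where ch: "sparse_chain R ch" and a: "sparse_chain.adapted ch a"
    and a_le: "\<And>k x. x \<in> hcube R \<Longrightarrow> ennreal (a k x) \<le> ennreal size_constant * BMO_norm b * ?M x"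
    and dom: "\<And>k x. x \<in> sparse_chain.level ch k \<Longrightarrow> x \<notin> sparse_chain.level ch (Suc k) \<Longrightarrow>
       norm (commutator b T f x) \<le> domination_constant * sparse_chain.cumulative ch (sparse_chain.cumulative ch a) k x"
  proof (rule commutator_sparse_domination[OF b f bf R off], goal_cases)
    case (2 ch a)
    from 2(2-) show ?thesis by (rule 2(1))
  qed
  interpret sparse_chain R ch by (rule ch)
  define D where "D = cumulative a"
  define E where "E = cumulative D"
  have Dad: "adapted D" unfolding D_def by (rule adapted_cumulative[OF a])
  have Ead: "adapted E" unfolding E_def by (rule adapted_cumulative[OF Dad])
  note [measurable] = adapted_measurable[OF a] adapted_measurable[OF Dad] adapted_measurable[OF Ead]
  have carleson: "(\<Sum>j\<in>{i..<m}. \<integral>\<^sup>+x\<in>hcube Q \<inter> level j. g x \<partial>lebesgue) \<le> ennreal L * (\<integral>\<^sup>+x\<in>hcube Q. g x \<partial>lebesgue)"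
    if "Q \<in> nodes i" for i m Q
    using carleson_maximal[OF g that, of m] A_inf[OF node_pos[OF that]] by (rule order_trans)
  show ?thesis
  proof (cases "ennreal (s powr p) * X < \<infinity>")
    case False
    then have X: "X = \<infinity>" and s0: "s \<noteq> 0" by (auto simp: ennreal_mult_less_top not_less top_unique)
    then have "0 < (domination_constant * k\<^sup>2 * s) powr p" using s k dc by simp
    then have "ennreal ((domination_constant * k\<^sup>2 * s) powr p) * X = \<infinity>" using X by (simp add: ennreal_mult_top)
    then show ?thesis unfolding X_def[symmetric] k_def[symmetric] \<beta>_def[symmetric] s_def[symmetric] by simp
  next
    case True
    have Ia: "(\<integral>\<^sup>+x\<in>level 0. ennreal (a K x powr p) * g x \<partial>lebesgue) \<le> ennreal (s powr p) * X" for K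
      unfolding X_def
    proof (rule nn_integral_le_cmult)
      fix x
      show "ennreal (a K x powr p) * g x * indicator (level 0) x \<le> ennreal (s powr p) * (ennreal_powr (?M x) p * g x)"
      proof (cases "x \<in> level 0")
        case True
        then have "ennreal (a K x) \<le> ennreal s * ?M x"
          using a_le[of x K] \<beta> size_constant_pos by (simp add: level_0 s_def ennreal_mult)
        then have "ennreal (a K x powr p) \<le> ennreal (s powr p) * ennreal_powr (?M x) p"
          using adapted_nonneg[OF a] s p by (rule powr_le_ennreal_powr)
        then have "ennreal (a K x powr p) * g x \<le> ennreal (s powr p) * ennreal_powr (?M x) p * g x"
          by (rule mult_right_mono) simp
        then show ?thesis using True by (simp add: mult.assoc)
      qed simp
    qed simp_all
    have fin_a: "(\<integral>\<^sup>+x\<in>level 0. ennreal (a K x powr p) * g x \<partial>lebesgue) < \<infinity>" for K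
      using Ia True by (rule le_less_trans)
    have ID: "(\<integral>\<^sup>+x\<in>level 0. ennreal (D K x powr p) * g x \<partial>lebesgue) \<le> ennreal (k powr p) * (ennreal (s powr p) * X)" for K
    proof -
      have "(\<integral>\<^sup>+x\<in>level 0. ennreal (D K x powr p) * g x \<partial>lebesgue) \<le>
          ennreal (k powr p) * (\<integral>\<^sup>+x\<in>level 0. ennreal (a K x powr p) * g x \<partial>lebesgue)"
        unfolding D_def k_def by (rule cumulative_weighted_bound[OF a g L p carleson fin_a])
      also have "\<dots> \<le> ennreal (k powr p) * (ennreal (s powr p) * X)" by (intro mult_left_mono Ia) simp
      finally show ?thesis .
    qed
    have fin_D: "(\<integral>\<^sup>+x\<in>level 0. ennreal (D K x powr p) * g x \<partial>lebesgue) < \<infinity>" for K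
      using ID by (rule le_less_trans) (use True in \<open>simp add: ennreal_mult_less_top\<close>)
    have IE: "(\<integral>\<^sup>+x\<in>level 0. ennreal (E K x powr p) * g x \<partial>lebesgue) \<le> ennreal (k powr p) * (ennreal (k powr p) * (ennreal (s powr p) * X))" for K
    proof -
      have "(\<integral>\<^sup>+x\<in>level 0. ennreal (E K x powr p) * g x \<partial>lebesgue) \<le>
          ennreal (k powr p) * (\<integral>\<^sup>+x\<in>level 0. ennreal (D K x powr p) * g x \<partial>lebesgue)"
        unfolding E_def k_def by (rule cumulative_weighted_bound[OF Dad g L p carleson fin_D])
      also have "\<dots> \<le> ennreal (k powr p) * (ennreal (k powr p) * (ennreal (s powr p) * X))" by (intro mult_left_mono ID) simp
      finally show ?thesis .
    qed
    let ?Z = "ennreal ((domination_constant * k\<^sup>2 * s) powr p) * X"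
    let ?c = "\<lambda>x. ennreal (norm (commutator b T f x) powr p) * g x"
    have part: "(\<integral>\<^sup>+x\<in>level 0 - level (Suc K). ?c x \<partial>lebesgue) \<le> ?Z" for K
    proof -
      have "(\<integral>\<^sup>+x\<in>level 0 - level (Suc K). ?c x \<partial>lebesgue) \<le>
         ennreal (domination_constant powr p) * (\<integral>\<^sup>+x\<in>level 0. ennreal (E K x powr p) * g x \<partial>lebesgue)"
      proof (rule nn_integral_le_cmult)
        fix x
        show "?c x * indicator (level 0 - level (Suc K)) x \<le>
          ennreal (domination_constant powr p) * (ennreal (E K x powr p) * g x * indicator (level 0) x)"
        proof (cases "x \<in> level 0 - level (Suc K)")
          case True
          define m where "m = (LEAST j. x \<notin> level j)"
          have m: "x \<notin> level m" unfolding m_def by (rule LeastI[of _ "Suc K"]) (use True in simp)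
          have mK: "m \<le> Suc K" unfolding m_def by (rule Least_le) (use True in simp)
          have "m \<noteq> 0"
          proof
            assume "m = 0"
            with m True show False by simp
          qed
          then obtain j where j: "m = Suc j" by (cases m) auto
          have xj: "x \<in> level j" using not_less_Least[of j "\<lambda>j. x \<notin> level j"] j m_def by auto
          have "norm (commutator b T f x) \<le> domination_constant * E j x"
            unfolding E_def D_def using xj m unfolding j by (rule dom)
          also have "\<dots> \<le> domination_constant * E K x"
            using mK j dc by (intro mult_left_mono adapted_mono[OF Ead]) auto
          finally have "norm (commutator b T f x) powr p \<le> (domination_constant * E K x) powr p"
            using p by (intro powr_mono2) auto
          also have "\<dots> = domination_constant powr p * E K x powr p"
            using dc adapted_nonneg[OF Ead] by (simp add: powr_mult)
          finally have "ennreal (norm (commutator b T f x) powr p) \<le> ennreal (domination_constant powr p) * ennreal (E K x powr p)"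
            by (simp add: ennreal_leI flip: ennreal_mult)
          then have "?c x \<le> ennreal (domination_constant powr p) * ennreal (E K x powr p) * g x"
            by (rule mult_right_mono) simp
          then show ?thesis using True by (simp add: mult.assoc)
        qed simp
      qed simp_all
      also have "\<dots> \<le> ennreal (domination_constant powr p) * (ennreal (k powr p) * (ennreal (k powr p) * (ennreal (s powr p) * X)))"
        by (intro mult_left_mono IE) simp
      also have "\<dots> = ?Z"
      proof -
        have "(domination_constant * k\<^sup>2 * s) powr p = domination_constant powr p * (k powr p * (k powr p * s powr p))"
          using dc k s by (simp add: powr_mult power2_eq_square mult_ac)
        then show ?thesis by (simp add: ennreal_mult mult.assoc)
      qed
      finally show ?thesis .
    qed
    have "(\<integral>\<^sup>+x\<in>hcube R. ?c x \<partial>lebesgue) = (\<integral>\<^sup>+x. (SUP K. ?c x * indicator (level 0 - level (Suc K)) x) \<partial>lebesgue)"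
    proof (rule nn_integral_cong_AE)
      show "AE x in lebesgue. ?c x * indicator (hcube R) x = (SUP K. ?c x * indicator (level 0 - level (Suc K)) x)"
        using AE_chain_finite
      proof eventually_elim
        fix x assume "\<exists>K. x \<notin> level K"
        then obtain K where "x \<notin> level K" by blast
        then have K: "x \<notin> level (Suc K)" using level_Suc by blast
        show "?c x * indicator (hcube R) x = (SUP K. ?c x * indicator (level 0 - level (Suc K)) x)"
        proof (rule antisym)
          have "?c x * indicator (hcube R) x = ?c x * indicator (level 0 - level (Suc K)) x"
            using K by (simp add: level_0 indicator_def)
          also have "\<dots> \<le> (SUP K. ?c x * indicator (level 0 - level (Suc K)) x)" by (rule SUP_upper) simp
          finally show "?c x * indicator (hcube R) x \<le> (SUP K. ?c x * indicator (level 0 - level (Suc K)) x)" .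
          show "(SUP K. ?c x * indicator (level 0 - level (Suc K)) x) \<le> ?c x * indicator (hcube R) x"
            by (rule SUP_least) (auto simp: level_0 indicator_def)
        qed
      qed
    qed
    also have "\<dots> = (SUP K. \<integral>\<^sup>+x\<in>level 0 - level (Suc K). ?c x \<partial>lebesgue)"
    proof (rule nn_integral_monotone_convergence_SUP)
      show "incseq (\<lambda>K x. ?c x * indicator (level 0 - level (Suc K)) x)"
      proof (intro incseq_SucI le_funI)
        fix K x
        show "?c x * indicator (level 0 - level (Suc K)) x \<le> ?c x * indicator (level 0 - level (Suc (Suc K))) x"
          using level_Suc[of "Suc K"] by (auto simp: indicator_def)
      qed
    qed measurable
    also have "\<dots> \<le> ?Z" by (intro SUP_least part)
    finally show ?thesis unfolding X_def[symmetric] k_def[symmetric] \<beta>_def[symmetric] s_def[symmetric] .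
  qed
qed

text \<open>Truncations converge in \<open>L\<^sup>2\<close> by dominated convergence, and \<open>T\<close> is bounded there.\<close>

lemma T_truncation_L2:
  fixes h :: "real^'n \<Rightarrow> complex"
  assumes h: "h \<in> L2"
  shows "(\<lambda>j. LINT x|lebesgue. (norm (T (\<lambda>y. indicator (hcube (big_cube j)) y * h y) x - T h x))\<^sup>2) \<longlonglongrightarrow> 0"
    and "integrable lebesgue (\<lambda>x. (norm (T (\<lambda>y. indicator (hcube (big_cube j)) y * h y) x - T h x))\<^sup>2)"
proof -
  define hj where "hj j y = indicator (hcube (big_cube j)) y * h y" for j y
  have hj: "hj j \<in> L2" for j unfolding hj_def by (rule L2_restrict[OF h]) simp
  have d: "(\<lambda>y. hj j y - h y) \<in> L2" for j by (rule L2_diff[OF hj h])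
  have Td: "(\<lambda>x. T (hj j) x - T h x) \<in> L2" for j by (rule L2_diff[OF T_L2[OF hj] T_L2[OF h]])
  then show "integrable lebesgue (\<lambda>x. (norm (T (\<lambda>y. indicator (hcube (big_cube j)) y * h y) x - T h x))\<^sup>2)"
    unfolding hj_def L2_def by blast
  note [measurable] = L2_measurable[OF h] L2_measurable[OF hj] L2_measurable[OF Td] L2_measurable[OF T_L2[OF d]]
  have sq: "(L2_norm k)\<^sup>2 = (LINT x|lebesgue. (norm (k x))\<^sup>2)" for k :: "real^'n \<Rightarrow> complex"
    by (simp add: L2_norm_def)
  have le: "(LINT x|lebesgue. (norm (T (hj j) x - T h x))\<^sup>2) \<le> B\<^sup>2 * (LINT x|lebesgue. (norm (hj j x - h x))\<^sup>2)" for j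
  proof -
    have "(LINT x|lebesgue. (norm (T (hj j) x - T h x))\<^sup>2) = (LINT x|lebesgue. (norm (T (\<lambda>y. hj j y - h y) x))\<^sup>2)"
      by (rule integral_cong_AE) (measurable, use T_diff[OF hj[of j] h] in \<open>auto elim!: eventually_mono\<close>)
    also have "\<dots> = (L2_norm (T (\<lambda>y. hj j y - h y)))\<^sup>2" by (rule sq[symmetric])
    also have "\<dots> \<le> (B * L2_norm (\<lambda>y. hj j y - h y))\<^sup>2"
      by (rule power_mono[OF T_bound[OF d]]) (simp add: L2_norm_def)
    finally show ?thesis by (simp add: power_mult_distrib sq)
  qed
  have "(\<lambda>j. LINT x|lebesgue. (norm (hj j x - h x))\<^sup>2) \<longlonglongrightarrow> (LINT (x::real^'n)|lebesgue. 0)"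
  proof (rule integral_dominated_convergence[where w="\<lambda>x. (norm (h x))\<^sup>2"])
    show "integrable lebesgue (\<lambda>x. (norm (h x))\<^sup>2)" using h by (simp add: L2_def)
    show "AE x in lebesgue. (\<lambda>j. (norm (hj j x - h x))\<^sup>2) \<longlonglongrightarrow> 0"
    proof (rule AE_I2)
      fix x :: "real^'n"
      obtain j where "\<forall>k\<ge>j. x \<in> hcube (big_cube k)" using eventually_mem_big_cube by blast
      then have "eventually (\<lambda>k. (norm (hj k x - h x))\<^sup>2 = 0) sequentially"
        unfolding eventually_sequentially by (intro exI[of _ j]) (simp add: hj_def)
      then show "(\<lambda>j. (norm (hj j x - h x))\<^sup>2) \<longlonglongrightarrow> 0" by (rule tendsto_eventually)
    qed
    show "AE x in lebesgue. norm ((norm (hj j x - h x))\<^sup>2) \<le> (norm (h x))\<^sup>2" for j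
      by (rule AE_I2) (auto simp: hj_def indicator_def)
  qed measurable
  then have "(\<lambda>j. B\<^sup>2 * (LINT x|lebesgue. (norm (hj j x - h x))\<^sup>2)) \<longlonglongrightarrow> B\<^sup>2 * 0"
    by (intro tendsto_mult tendsto_const) simp
  then have lim: "(\<lambda>j. B\<^sup>2 * (LINT x|lebesgue. (norm (hj j x - h x))\<^sup>2)) \<longlonglongrightarrow> 0" by simp
  have "(\<lambda>j. LINT x|lebesgue. (norm (T (hj j) x - T h x))\<^sup>2) \<longlonglongrightarrow> 0"
    by (rule tendsto_sandwich[OF _ _ tendsto_const lim]) (auto intro!: always_eventually le)
  then show "(\<lambda>j. LINT x|lebesgue. (norm (T (\<lambda>y. indicator (hcube (big_cube j)) y * h y) x - T h x))\<^sup>2) \<longlonglongrightarrow> 0"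
    by (simp add: hj_def[abs_def])
qed

text \<open>Both \<open>T f\<close> and \<open>T (b f)\<close> are limits almost everywhere of the images of truncations, along a common
subsequence, so Fatou's lemma transfers the bound from large cubes.\<close>

lemma commutator_weighted:
  fixes b f :: "real^'n \<Rightarrow> complex"
  assumes b: "b \<in> BMO" and f: "f \<in> L2" and bf: "(\<lambda>y. b y * f y) \<in> L2"
    and g [measurable]: "g \<in> borel_measurable lebesgue" and p: "0 < p" and L: "0 < L"
    and A_inf: "\<And>Q. 0 < snd Q \<Longrightarrow> 2 * (\<integral>\<^sup>+x\<in>hcube Q. hl_maximal (\<lambda>y. g y * indicator (hcube Q) y) x \<partial>lebesgue)
       \<le> ennreal L * (\<integral>\<^sup>+x\<in>hcube Q. g x \<partial>lebesgue)"
  shows "(\<integral>\<^sup>+x. ennreal (norm (commutator b T f x) powr p) * g x \<partial>lebesgue) \<le>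
    ennreal ((domination_constant * (4 * L * max 1 p)\<^sup>2 * (size_constant * enn2real (BMO_norm b))) powr p) *
     (\<integral>\<^sup>+x. ennreal_powr (hl_maximal (hl_maximal (\<lambda>y. ennreal (norm (f y)))) x) p * g x \<partial>lebesgue)"
    (is "_ \<le> ?Z")
proof -
  define fj where "fj j y = indicator (hcube (big_cube j)) y * f y" for j y
  have fj: "fj j \<in> L2" for j unfolding fj_def by (rule L2_restrict[OF f]) simp
  have bfj_eq: "(\<lambda>y. b y * fj j y) = (\<lambda>y. indicator (hcube (big_cube j)) y * (b y * f y))" for j
    by (auto simp: fj_def)
  have bfj: "(\<lambda>y. b y * fj j y) \<in> L2" for j unfolding bfj_eq by (rule L2_restrict[OF bf]) simp
  note [measurable] = BMO_D(1)[OF b] L2_measurable[OF T_L2[OF fj]] L2_measurable[OF T_L2[OF bfj]]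
    L2_measurable[OF T_L2[OF f]] L2_measurable[OF T_L2[OF bf]]
  have cm [measurable]: "commutator b T (fj j) \<in> borel_measurable lebesgue" for j unfolding commutator_def by measurable
  define d where "d j x = (norm (T (fj j) x - T f x))\<^sup>2 + (norm (T (\<lambda>y. b y * fj j y) x - T (\<lambda>y. b y * f y) x))\<^sup>2" for j x
  have i1: "integrable lebesgue (\<lambda>x. (norm (T (fj j) x - T f x))\<^sup>2)" for j
    using T_truncation_L2(2)[OF f, of j] by (simp add: fj_def[abs_def])
  have i2: "integrable lebesgue (\<lambda>x. (norm (T (\<lambda>y. b y * fj j y) x - T (\<lambda>y. b y * f y) x))\<^sup>2)" for j
    unfolding bfj_eq by (rule T_truncation_L2(2)[OF bf])
  have "(\<lambda>j. (LINT x|lebesgue. (norm (T (fj j) x - T f x))\<^sup>2) +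
      (LINT x|lebesgue. (norm (T (\<lambda>y. b y * fj j y) x - T (\<lambda>y. b y * f y) x))\<^sup>2)) \<longlonglongrightarrow> 0 + 0"
    using T_truncation_L2(1)[OF f] T_truncation_L2(1)[OF bf]
    unfolding bfj_eq fj_def[symmetric] by (intro tendsto_add)
  then have "(\<lambda>j. LINT x|lebesgue. norm (d j x)) \<longlonglongrightarrow> 0"
    unfolding d_def by (simp add: Bochner_Integration.integral_add[OF i1 i2])
  then obtain r :: "nat \<Rightarrow> nat" where r: "strict_mono r" "AE x in lebesgue. (\<lambda>n. d (r n) x) \<longlonglongrightarrow> 0"
    using tendsto_L1_AE_subseq[of lebesgue d] i1 i2 unfolding d_def by auto
  let ?c = "\<lambda>x. ennreal (norm (commutator b T f x) powr p) * g x"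
  let ?cn = "\<lambda>n x. ennreal (norm (commutator b T (fj (r n)) x) powr p) * g x * indicator (hcube (big_cube (r n))) x"
  have ae: "AE x in lebesgue. ?c x \<le> liminf (\<lambda>n. ?cn n x)"
    using r(2)
  proof eventually_elim
    fix x assume dx: "(\<lambda>n. d (r n) x) \<longlonglongrightarrow> 0"
    have sq: "(\<lambda>n. z n) \<longlonglongrightarrow> l" if le: "\<And>n. (norm (z n - l))\<^sup>2 \<le> d (r n) x" for z :: "nat \<Rightarrow> complex" and l
    proof -
      have "(\<lambda>n. (norm (z n - l))\<^sup>2) \<longlonglongrightarrow> 0"
        by (rule tendsto_sandwich[OF _ _ tendsto_const dx]) (auto intro!: always_eventually le)
      from tendsto_real_sqrt[OF this] have "(\<lambda>n. norm (z n - l)) \<longlonglongrightarrow> 0" by simp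
      then show ?thesis by (simp add: LIM_zero_iff tendsto_norm_zero_iff)
    qed
    have l1: "(\<lambda>n. T (fj (r n)) x) \<longlonglongrightarrow> T f x" by (rule sq) (simp add: d_def)
    have l2: "(\<lambda>n. T (\<lambda>y. b y * fj (r n) y) x) \<longlonglongrightarrow> T (\<lambda>y. b y * f y) x" by (rule sq) (simp add: d_def)
    have "(\<lambda>n. commutator b T (fj (r n)) x) \<longlonglongrightarrow> commutator b T f x"
      unfolding commutator_def by (intro tendsto_diff tendsto_mult tendsto_const l1 l2)
    then have "(\<lambda>n. norm (commutator b T (fj (r n)) x) powr p) \<longlonglongrightarrow> norm (commutator b T f x) powr p"
      using p by (intro tendsto_powr' tendsto_norm tendsto_const) auto
    then have "(\<lambda>n. ennreal (norm (commutator b T (fj (r n)) x) powr p)) \<longlonglongrightarrow> ennreal (norm (commutator b T f x) powr p)"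
      by (rule tendsto_ennrealI)
    then have 1: "ennreal (norm (commutator b T f x) powr p) = liminf (\<lambda>n. ennreal (norm (commutator b T (fj (r n)) x) powr p))"
      by (rule lim_imp_Liminf[OF sequentially_bot, symmetric])
    obtain j where j: "\<forall>k\<ge>j. x \<in> hcube (big_cube k)" using eventually_mem_big_cube by blast
    have ev: "eventually (\<lambda>n. ennreal (norm (commutator b T (fj (r n)) x) powr p) * g x = ?cn n x) sequentially"
      unfolding eventually_sequentially
    proof (intro exI[of _ j] allI impI)
      fix n assume "j \<le> n"
      also have "n \<le> r n" by (rule seq_suble[OF r(1)])
      finally show "ennreal (norm (commutator b T (fj (r n)) x) powr p) * g x = ?cn n x" using j by simp
    qed
    have "?c x \<le> liminf (\<lambda>n. ennreal (norm (commutator b T (fj (r n)) x) powr p) * g x)"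
    \<comment> \<open>Multiplication by \<open>\<infinity>\<close> is discontinuous at zero, so this value of the weight is treated apart.\<close>
    proof (cases "g x = top")
      case False
      then have "(\<lambda>n. ennreal (norm (commutator b T (fj (r n)) x) powr p) * g x) \<longlonglongrightarrow> ?c x"
        using \<open>(\<lambda>n. ennreal (norm (commutator b T (fj (r n)) x) powr p)) \<longlonglongrightarrow> ennreal (norm (commutator b T f x) powr p)\<close>
        by (intro tendsto_mult_ennreal) (auto simp: less_top)
      then show ?thesis by (simp add: lim_imp_Liminf)
    next
      case True
      show ?thesis
      proof (cases "norm (commutator b T f x) powr p = 0")
        case False
        then have "0 < norm (commutator b T f x) powr p" by simp
        then have "eventually (\<lambda>n. 0 < norm (commutator b T (fj (r n)) x) powr p) sequentially"
          using \<open>(\<lambda>n. norm (commutator b T (fj (r n)) x) powr p) \<longlonglongrightarrow> norm (commutator b T f x) powr p\<close>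
          by (rule order_tendstoD(1)[rotated])
        then have "eventually (\<lambda>n. ?c x \<le> ennreal (norm (commutator b T (fj (r n)) x) powr p) * g x) sequentially"
          by eventually_elim (simp add: True ennreal_mult_top)
        then show ?thesis by (rule Liminf_bounded)
      qed simp
    qed
    also have "\<dots> = liminf (\<lambda>n. ?cn n x)" by (rule Liminf_eq[OF ev])
    finally show "?c x \<le> liminf (\<lambda>n. ?cn n x)" .
  qed
  have one: "(\<integral>\<^sup>+x. ?cn n x \<partial>lebesgue) \<le> ?Z" for n
  proof -
    have "(\<integral>\<^sup>+x. ?cn n x \<partial>lebesgue) \<le>
      ennreal ((domination_constant * (4 * L * max 1 p)\<^sup>2 * (size_constant * enn2real (BMO_norm b))) powr p) *
      (\<integral>\<^sup>+x. ennreal_powr (hl_maximal (hl_maximal (\<lambda>y. ennreal (norm (fj (r n) y)))) x) p * g x \<partial>lebesgue)"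
    proof (rule commutator_weighted_on_cube[OF b fj bfj big_cube_pos _ g p L A_inf])
      show "fj (r n) y = 0" if "y \<notin> hcube (big_cube (r n))" for y using that by (simp add: fj_def)
    qed
    also have "\<dots> \<le> ?Z"
      by (intro mult_left_mono nn_integral_mono mult_right_mono ennreal_powr_mono p maximal_mono)
         (auto simp: fj_def indicator_def)
    finally show ?thesis .
  qed
  have "(\<integral>\<^sup>+x. ?c x \<partial>lebesgue) \<le> (\<integral>\<^sup>+x. liminf (\<lambda>n. ?cn n x) \<partial>lebesgue)" by (rule nn_integral_mono_AE[OF ae])
  also have "\<dots> \<le> liminf (\<lambda>n. \<integral>\<^sup>+x. ?cn n x \<partial>lebesgue)" by (rule nn_integral_liminf) measurable
  also have "\<dots> \<le> ?Z"
  proof -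
    have "liminf (\<lambda>n. \<integral>\<^sup>+x. ?cn n x \<partial>lebesgue) \<le> liminf (\<lambda>n. ?Z)"
      by (intro Liminf_mono always_eventually allI one)
    then show ?thesis by (simp add: Liminf_const)
  qed
  finally show ?thesis .
qed

end

section \<open>Weights of class \<open>A\<^sub>\<infinity>\<close> and the commutator estimate\<close>

text \<open>If the average of \<open>w\<close> over a cube were infinite, the \<open>A\<^sub>p\<close> product would be infinite too: \<open>w\<close> has finite
values, so its negative power is positive everywhere and has positive average.\<close>

lemma Muckenhoupt_A_infinity_locally_finite:
  fixes w :: "real^'n \<Rightarrow> real"
  assumes "w \<in> Muckenhoupt_A_infinity"
  shows "weight w" "\<And>Q. Q \<in> cubes \<Longrightarrow> (\<integral>\<^sup>+x\<in>Q. ennreal (w x) \<partial>lebesgue) < \<infinity>"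
proof -
  obtain p where p: "1 < p" "w \<in> Muckenhoupt_A p" using assms by (auto simp: Muckenhoupt_A_infinity_def)
  then show w: "weight w" by (simp add: Muckenhoupt_A_def)
  then have wm [measurable]: "w \<in> borel_measurable lebesgue" and w0: "\<And>x. 0 \<le> w x" by (auto simp: weight_def)
  define a where "a = 1 - conjugate_exponent p"
  have a: "a < 0" using p(1) by (simp add: a_def conjugate_exponent_def field_simps)
  let ?s = "\<lambda>x. ennreal_powr (ennreal (w x)) a"
  have s_eq: "?s x = (if w x = 0 then top else ennreal (w x powr a))" for x
    using a w0[of x] by (auto simp: ennreal_powr_def ennreal_eq_0_iff)
  have sm [measurable]: "?s \<in> borel_measurable lebesgue" unfolding s_eq by measurable
  have spos: "0 < ?s x" for x unfolding s_eq using w0[of x] by (simp add: zero_less_iff_neq_zero ennreal_eq_0_iff)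
  fix Q :: "(real^'n) set" assume Q: "Q \<in> cubes"
  note cQ = cubes_measure[OF Q]
  have fin: "average Q (\<lambda>x. ennreal (w x)) * ennreal_powr (average Q ?s) (p - 1) < \<infinity>"
  proof -
    have "average Q (\<lambda>x. ennreal (w x)) * ennreal_powr (average Q ?s) (p - 1) \<le>
      (SUP Q\<in>cubes. average Q (\<lambda>x. ennreal (w x)) * ennreal_powr (average Q ?s) (p - 1))"
      by (rule SUP_upper[OF Q])
    also have "\<dots> < \<infinity>" using p(2) by (simp add: Muckenhoupt_A_def a_def)
    finally show ?thesis .
  qed
  have "average Q ?s \<noteq> 0"
  proof
    assume "average Q ?s = 0"
    then have "(\<integral>\<^sup>+x\<in>Q. ?s x \<partial>lebesgue) = 0" using cQ by (auto simp: average_def divide_ennreal_def)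
    then have "AE x in lebesgue. ?s x * indicator Q x = 0" using cQ(1) by (subst (asm) nn_integral_0_iff_AE) auto
    then have "AE x in lebesgue. x \<notin> Q" by eventually_elim (use spos in \<open>auto simp: indicator_def zero_less_iff_neq_zero\<close>)
    then have "emeasure lebesgue Q = 0" using cQ(1) by (simp add: AE_iff_null_sets null_setsD1)
    then show False using cQ(2) by simp
  qed
  then have "ennreal_powr (average Q ?s) (p - 1) \<noteq> 0" using p(1) ennreal_powr_eq_0D[of "p - 1"] by auto
  then have "average Q (\<lambda>x. ennreal (w x)) < \<infinity>" using fin by (auto simp: ennreal_mult_less_top)
  then show "(\<integral>\<^sup>+x\<in>Q. ennreal (w x) \<partial>lebesgue) < \<infinity>"
    using cQ(2,3) unfolding average_def by (auto simp: divide_ennreal_def ennreal_mult_less_top)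
qed

text \<open>The quotient in the constant may be cleared: if \<open>w\<close> vanishes almost everywhere on \<open>Q\<close>, then so does the
maximal function of its restriction.\<close>

lemma A_infinity_constant_bound:
  fixes w :: "real^'n \<Rightarrow> real" and Q :: "'n node"
  assumes w [measurable]: "w \<in> borel_measurable lebesgue"
    and fin: "\<And>Q. Q \<in> cubes \<Longrightarrow> (\<integral>\<^sup>+x\<in>Q. ennreal (w x) \<partial>lebesgue) < \<infinity>" and Q: "0 < snd Q"
  shows "(\<integral>\<^sup>+x\<in>hcube Q. hl_maximal (\<lambda>y. ennreal (w y) * indicator (hcube Q) y) x \<partial>lebesgue)
    \<le> A_infinity_constant w * (\<integral>\<^sup>+x\<in>hcube Q. ennreal (w x) \<partial>lebesgue)"
proof -
  let ?C = "closed_cube Q"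
  let ?I = "\<integral>\<^sup>+x\<in>?C. ennreal (w x) \<partial>lebesgue"
  let ?X = "\<integral>\<^sup>+x\<in>?C. hl_maximal (\<lambda>y. ennreal (w y) * indicator ?C y) x \<partial>lebesgue"
  have C: "?C \<in> cubes" by (rule closed_cube_in_cubes[OF Q])
  have I: "?I = (\<integral>\<^sup>+x\<in>hcube Q. ennreal (w x) \<partial>lebesgue)" using Q by (intro nn_integral_closed_cube) simp
  have "?X \<le> A_infinity_constant w * ?I"
  proof (cases "?I = 0")
    case True
    then have "AE x in lebesgue. ennreal (w x) * indicator ?C x = 0" by (subst (asm) nn_integral_0_iff_AE) auto
    then have "(\<integral>\<^sup>+x\<in>P. ennreal (w x) * indicator ?C x \<partial>lebesgue) = (\<integral>\<^sup>+(x::real^'n). 0 \<partial>lebesgue)" for P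
      by (intro nn_integral_cong_AE) (auto elim!: eventually_mono)
    then have "average P (\<lambda>y. ennreal (w y) * indicator ?C y) = 0" for P by (simp add: average_def)
    then have "hl_maximal (\<lambda>y. ennreal (w y) * indicator ?C y) x = 0" for x
      unfolding hl_maximal_def by (intro antisym SUP_least) auto
    then show ?thesis by simp
  next
    case False
    have "?X / ?I \<le> A_infinity_constant w" unfolding A_infinity_constant_def by (rule SUP_upper[OF C])
    then have "?X / ?I * ?I \<le> A_infinity_constant w * ?I" by (rule mult_right_mono) simp
    moreover have "?X / ?I * ?I = ?X" using False fin[OF C] by (simp add: ennreal_divide_times ennreal_divide_self)
    ultimately show ?thesis by simp
  qed
  moreover have "(\<integral>\<^sup>+x\<in>hcube Q. hl_maximal (\<lambda>y. ennreal (w y) * indicator (hcube Q) y) x \<partial>lebesgue) \<le> ?X"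
  proof (intro nn_integral_mono mult_mono maximal_mono)
    fix x show "(indicator (hcube Q) x :: ennreal) \<le> indicator ?C x"
      using hcube_subset_cbox[of Q] by (auto simp: indicator_def closed_cube_def)
    show "(indicator (hcube Q) x :: ennreal) \<le> indicator ?C x"
      using hcube_subset_cbox[of Q] by (auto simp: indicator_def closed_cube_def)
  qed auto
  ultimately show ?thesis unfolding I by (rule order_trans[rotated])
qed

lemma integral_le_integral_maximal:
  fixes Q :: "'n::finite node"
  assumes Q: "0 < snd Q"
  shows "(\<integral>\<^sup>+x\<in>hcube Q. g x \<partial>lebesgue) \<le> (\<integral>\<^sup>+x\<in>hcube Q. hl_maximal (\<lambda>y. g y * indicator (hcube Q) y) x \<partial>lebesgue)"
proof -
  have eq: "g x * indicator (hcube Q) x = g x * indicator (hcube Q) x * indicator (hcube Q) x" for x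
    by (simp add: indicator_def)
  have "(\<integral>\<^sup>+x\<in>hcube Q. g x \<partial>lebesgue) = average (closed_cube Q) (\<lambda>y. g y * indicator (hcube Q) y) * emeasure lebesgue (hcube Q)"
    unfolding average_mult_emeasure[OF Q] by (subst eq) simp
  also have "\<dots> \<le> average (closed_cube Q) (hl_maximal (\<lambda>y. g y * indicator (hcube Q) y)) * emeasure lebesgue (hcube Q)"
    by (intro mult_right_mono average_le_average_maximal closed_cube_in_cubes Q) simp
  also have "\<dots> = (\<integral>\<^sup>+x\<in>hcube Q. hl_maximal (\<lambda>y. g y * indicator (hcube Q) y) x \<partial>lebesgue)"
    by (rule average_mult_emeasure[OF Q])
  finally show ?thesis .
qed

lemma AE_all_big_cubes:
  fixes P :: "real^'n \<Rightarrow> bool"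
  assumes "\<And>j. k \<le> j \<Longrightarrow> AE x in lebesgue. x \<in> hcube (big_cube j) \<longrightarrow> P x"
  shows "AE x in lebesgue. P x"
proof -
  have "AE x in lebesgue. \<forall>j. k \<le> j \<longrightarrow> x \<in> hcube (big_cube j) \<longrightarrow> P x"
    unfolding AE_all_countable using assms by (auto intro: AE_I2)
  then show ?thesis
  proof eventually_elim
    fix x assume *: "\<forall>j. k \<le> j \<longrightarrow> x \<in> hcube (big_cube j) \<longrightarrow> P x"
    obtain j where "\<forall>i\<ge>j. x \<in> hcube (big_cube i)" using eventually_mem_big_cube by blast
    then show "P x" using *[rule_format, of "max j k"] by simp
  qed
qed

lemma AE_zero_of_integrals_big_cubes:
  fixes g :: "real^'n \<Rightarrow> ennreal"
  assumes g [measurable]: "g \<in> borel_measurable lebesgue"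
    and 0: "\<And>j. k \<le> j \<Longrightarrow> (\<integral>\<^sup>+x\<in>hcube (big_cube j). g x \<partial>lebesgue) = 0"
  shows "AE x in lebesgue. g x = 0"
proof (rule AE_all_big_cubes[of k])
  fix j assume "k \<le> j"
  have "AE x in lebesgue. g x * indicator (hcube (big_cube j)) x = 0"
    using 0[OF \<open>k \<le> j\<close>] by (subst (asm) nn_integral_0_iff_AE) auto
  then show "AE x in lebesgue. x \<in> hcube (big_cube j) \<longrightarrow> g x = 0" by eventually_elim auto
qed

text \<open>The case of vanishing norm of \<open>b\<close> is the weighted inequality for Lebesgue measure and \<open>p = 1\<close>.\<close>

lemma (in cz_operator) commutator_null:
  fixes b f :: "real^'n \<Rightarrow> complex"
  assumes b: "b \<in> BMO" and f: "f \<in> L2" and bf: "(\<lambda>y. b y * f y) \<in> L2"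
    and 0: "BMO_norm b = 0 \<or> (AE x in lebesgue. f x = 0)"
  shows "AE x in lebesgue. commutator b T f x = 0"
  using 0
proof
  assume "BMO_norm b = 0"
  have "2 * (\<integral>\<^sup>+x\<in>hcube Q. hl_maximal (\<lambda>y. 1 * indicator (hcube Q) y) x \<partial>lebesgue) \<le> ennreal 2 * (\<integral>\<^sup>+x\<in>hcube Q. 1 \<partial>lebesgue)"
    for Q :: "'n node"
  proof -
    have "hl_maximal (\<lambda>y. 1 * indicator (hcube Q) y) x \<le> 1" for x
      unfolding hl_maximal_def
    proof (rule SUP_least)
      fix P :: "(real^'n) set" assume "P \<in> {Q \<in> cubes. x \<in> Q}"
      then have P: "P \<in> cubes" by simp
      have "average P (\<lambda>y. 1 * indicator (hcube Q) y) \<le> average P (\<lambda>y. 1)"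
        by (rule average_mono) (simp add: indicator_def)
      then show "average P (\<lambda>y. 1 * indicator (hcube Q) y) \<le> 1" by (simp add: average_const[OF P])
    qed
    then show ?thesis by (auto intro!: mult_left_mono nn_integral_mono mult_right_mono simp del: mult_1)
  qed
  then have "(\<integral>\<^sup>+x. ennreal (norm (commutator b T f x) powr 1) * 1 \<partial>lebesgue) \<le>
    ennreal ((domination_constant * (4 * 2 * max 1 1)\<^sup>2 * (size_constant * enn2real (BMO_norm b))) powr 1) *
     (\<integral>\<^sup>+x. ennreal_powr (hl_maximal (hl_maximal (\<lambda>y. ennreal (norm (f y)))) x) 1 * 1 \<partial>lebesgue)"
    by (intro commutator_weighted[OF b f bf]) auto
  then have "(\<integral>\<^sup>+x. ennreal (norm (commutator b T f x)) \<partial>lebesgue) = 0" using \<open>BMO_norm b = 0\<close> by simp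
  moreover have "commutator b T f \<in> borel_measurable lebesgue"
    using BMO_D(1)[OF b] L2_measurable[OF T_L2[OF f]] L2_measurable[OF T_L2[OF bf]] unfolding commutator_def by measurable
  ultimately have "AE x in lebesgue. ennreal (norm (commutator b T f x)) = 0" by (subst (asm) nn_integral_0_iff_AE) auto
  then show ?thesis by eventually_elim simp
next
  assume f0: "AE x in lebesgue. f x = 0"
  then have "AE x in lebesgue. b x * f x = 0" by eventually_elim simp
  with T_null[OF bf] T_null[OF f f0] show ?thesis
    unfolding commutator_def by auto
qed

theorem theorem2p4:
  fixes T :: "(real^'n \<Rightarrow> complex) \<Rightarrow> (real^'n \<Rightarrow> complex)"
  assumes "Calderon_Zygmund_operator T"
  shows "\<exists>c::real. 0 < c \<and>
    (\<forall>b \<in> BMO. \<forall>w \<in> Muckenhoupt_A_infinity. \<forall>p::real. 0 < p \<longrightarrow>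
      (\<forall>f \<in> commutator_domain b.
        weighted_Lp_norm p w (\<lambda>x. ennreal (norm (commutator b T f x)))
        \<le> ennreal c * BMO_norm b * ennreal (max 1 (p\<^sup>2)) * (A_infinity_constant w)\<^sup>2 *
           weighted_Lp_norm p w (hl_maximal (hl_maximal (\<lambda>x. ennreal (norm (f x)))))))"
proof -
  obtain K B C \<delta> where "cz_operator T K B C \<delta>" using assms by (rule Calderon_Zygmund_operatorE)
  then interpret cz_operator T K B C \<delta> .
  define c where "c = 64 * domination_constant * size_constant"
  have c: "0 < c" using domination_constant_pos size_constant_pos by (simp add: c_def)
  show ?thesis
  proof (intro exI[of _ c] conjI ballI allI impI c)
    fix b :: "real^'n \<Rightarrow> complex" and w :: "real^'n \<Rightarrow> real" and p :: real and f :: "real^'n \<Rightarrow> complex"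
    assume b: "b \<in> BMO" and w: "w \<in> Muckenhoupt_A_infinity" and p: "0 < p" and f: "f \<in> commutator_domain b"
    let ?M = "hl_maximal (hl_maximal (\<lambda>x. ennreal (norm (f x))))"
    have fL: "f \<in> L2" and bfL: "(\<lambda>y. b y * f y) \<in> L2" using f by (auto simp: commutator_domain_def)
    note lf = Muckenhoupt_A_infinity_locally_finite[OF w]
    have wm [measurable]: "w \<in> borel_measurable lebesgue" using lf(1) by (simp add: weight_def)
    define N where "N = (\<integral>\<^sup>+x. ennreal (norm (commutator b T f x) powr p) * ennreal (w x) \<partial>lebesgue)"
    define X where "X = (\<integral>\<^sup>+x. ennreal_powr (?M x) p * ennreal (w x) \<partial>lebesgue)"
    have lhs: "weighted_Lp_norm p w (\<lambda>x. ennreal (norm (commutator b T f x))) = ennreal_powr N (1 / p)"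
      using p by (simp add: weighted_Lp_norm_def N_def ennreal_powr_ennreal)
    have rhs: "weighted_Lp_norm p w ?M = ennreal_powr X (1 / p)" by (simp add: weighted_Lp_norm_def X_def)
    let ?A = "A_infinity_constant w"
    have A_bound: "(\<integral>\<^sup>+x\<in>hcube Q. hl_maximal (\<lambda>y. ennreal (w y) * indicator (hcube Q) y) x \<partial>lebesgue)
       \<le> ?A * (\<integral>\<^sup>+x\<in>hcube Q. ennreal (w x) \<partial>lebesgue)" if "0 < snd Q" for Q
      using wm lf(2) that by (rule A_infinity_constant_bound)
    define \<beta> where "\<beta> = enn2real (BMO_norm b)"
    have \<beta>: "0 \<le> \<beta>" "BMO_norm b = ennreal \<beta>" using BMO_D(4)[OF b] by (auto simp: \<beta>_def)
    show "weighted_Lp_norm p w (\<lambda>x. ennreal (norm (commutator b T f x)))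
        \<le> ennreal c * BMO_norm b * ennreal (max 1 (p\<^sup>2)) * ?A\<^sup>2 * weighted_Lp_norm p w ?M"
    proof (cases "N = 0")
      case True
      then show ?thesis unfolding lhs using p by (simp add: ennreal_powr_zero)
    next
      case False
      have w_nonzero: "\<not> (AE x in lebesgue. ennreal (w x) = 0)"
      proof
        assume "AE x in lebesgue. ennreal (w x) = 0"
        then have "N = (\<integral>\<^sup>+(x::real^'n). 0 \<partial>lebesgue)"
          unfolding N_def by (intro nn_integral_cong_AE) (auto elim!: eventually_mono)
        then show False using False by simp
      qed
      have A_pos: "?A \<noteq> 0"
      proof
        assume A0: "?A = 0"
        have "(\<integral>\<^sup>+x\<in>hcube (big_cube j). ennreal (w x) \<partial>lebesgue) = 0" for j
          using integral_le_integral_maximal[OF big_cube_pos[of j], of "\<lambda>x. ennreal (w x)"] A_bound[OF big_cube_pos[of j]] A0 by simp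
        then have "AE x in lebesgue. ennreal (w x) = 0" by (intro AE_zero_of_integrals_big_cubes) auto
        then show False using w_nonzero by simp
      qed
      have comm_nonzero: "\<not> (AE x in lebesgue. commutator b T f x = 0)"
      proof
        assume "AE x in lebesgue. commutator b T f x = 0"
        then have "N = (\<integral>\<^sup>+(x::real^'n). 0 \<partial>lebesgue)"
          unfolding N_def using p by (intro nn_integral_cong_AE) (auto elim!: eventually_mono)
        then show False using False by simp
      qed
      then have b_pos: "BMO_norm b \<noteq> 0" and f_nonzero: "\<not> (AE x in lebesgue. f x = 0)"
        using commutator_null[OF b fL bfL] by auto
      show ?thesis
      proof (cases "?A = \<infinity>")
        case True
        \<comment> \<open>An infinite constant makes the right-hand side infinite, provided that its other factors do not
vanish. If \<open>M\<^sup>2 f\<close> had norm zero, then its positive lower bound on a large cube would force \<open>w = 0\<close>.\<close>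
        have "X \<noteq> 0"
        proof
          assume X0: "X = 0"
          define m where "m j = average (closed_cube (big_cube j)) (\<lambda>x. ennreal (norm (f x)))" for j
          note [measurable] = L2_measurable[OF fL]
          have avg: "m j * emeasure lebesgue (hcube (big_cube j :: 'n node)) = (\<integral>\<^sup>+x\<in>hcube (big_cube j). ennreal (norm (f x)) \<partial>lebesgue)" for j
            unfolding m_def by (rule average_mult_emeasure[OF big_cube_pos])
          have "\<exists>k. m k \<noteq> 0"
          proof (rule ccontr)
            assume "\<nexists>k. m k \<noteq> 0"
            then have "(\<integral>\<^sup>+x\<in>hcube (big_cube j). ennreal (norm (f x)) \<partial>lebesgue) = 0" for j using avg[of j] by simp
            then have "AE x in lebesgue. ennreal (norm (f x)) = 0" by (intro AE_zero_of_integrals_big_cubes) auto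
            then have "AE x in lebesgue. f x = 0" by eventually_elim simp
            then show False using f_nonzero by simp
          qed
          then obtain k where k: "m k \<noteq> 0" by blast
          have "(\<integral>\<^sup>+x\<in>hcube (big_cube j). ennreal (w x) \<partial>lebesgue) = 0" if "k \<le> j" for j
          proof -
            have "hcube (big_cube k) \<subseteq> hcube (big_cube j :: 'n node)"
            proof
              fix x :: "real^'n" assume x: "x \<in> hcube (big_cube k)"
              show "x \<in> hcube (big_cube j)" unfolding mem_big_cube
              proof
                fix i
                have "- real (Suc k) \<le> x $ i \<and> x $ i < real (Suc k)" using x unfolding mem_big_cube by blast
                then show "- real (Suc j) \<le> x $ i \<and> x $ i < real (Suc j)" using that by simp
              qed
            qed
            then have "m k * emeasure lebesgue (hcube (big_cube k :: 'n node)) \<le> m j * emeasure lebesgue (hcube (big_cube j :: 'n node))"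
              unfolding avg by (intro nn_integral_mono) (auto simp: indicator_def)
            moreover have "emeasure lebesgue (hcube (big_cube k :: 'n node)) \<noteq> 0"
              by (simp add: emeasure_hcube big_cube_def)
            ultimately have mj: "m j \<noteq> 0" using k by auto
            have "ennreal_powr (m j) p * (\<integral>\<^sup>+x\<in>hcube (big_cube j). ennreal (w x) \<partial>lebesgue) =
               (\<integral>\<^sup>+x. ennreal_powr (m j) p * (ennreal (w x) * indicator (hcube (big_cube j)) x) \<partial>lebesgue)"
              by (simp add: nn_integral_cmult)
            also have "\<dots> \<le> X" unfolding X_def
            proof (intro nn_integral_mono)
              fix x
              show "ennreal_powr (m j) p * (ennreal (w x) * indicator (hcube (big_cube j)) x) \<le> ennreal_powr (?M x) p * ennreal (w x)"
              proof (cases "x \<in> hcube (big_cube j)")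
                case True
                have "x \<in> closed_cube (big_cube j)" using True hcube_subset_cbox[of "big_cube j"] by (auto simp: closed_cube_def)
                then have "m j \<le> ?M x" unfolding m_def
                  by (intro average_le_maximal2 closed_cube_in_cubes big_cube_pos)
                then show ?thesis using True by (simp add: mult_right_mono ennreal_powr_mono[OF p])
              qed simp
            qed
            finally have "ennreal_powr (m j) p * (\<integral>\<^sup>+x\<in>hcube (big_cube j). ennreal (w x) \<partial>lebesgue) = 0" using X0 by simp
            then show ?thesis using ennreal_powr_eq_0D[OF p] mj by auto
          qed
          then have "AE x in lebesgue. ennreal (w x) = 0" by (intro AE_zero_of_integrals_big_cubes[of _ k]) auto
          then show False using w_nonzero by simp
        qed
        then have "ennreal_powr X (1 / p) \<noteq> 0" using ennreal_powr_eq_0D[of "1 / p" X] p by auto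
        moreover have "ennreal c * BMO_norm b * ennreal (max 1 (p\<^sup>2)) \<noteq> 0" using c b_pos by (simp add: ennreal_eq_0_iff)
        ultimately have "ennreal c * BMO_norm b * ennreal (max 1 (p\<^sup>2)) * ?A\<^sup>2 * ennreal_powr X (1 / p) = \<infinity>"
          unfolding True by (simp add: ennreal_mult_eq_top_iff power2_eq_square)
        then show ?thesis unfolding rhs by simp
      next
        case False
        then obtain a where a: "?A = ennreal a" "0 \<le> a" by (cases ?A) auto
        then have apos: "0 < a" using A_pos by (cases "a = 0") auto
        have "N \<le> ennreal ((domination_constant * (4 * (2 * a) * max 1 p)\<^sup>2 * (size_constant * \<beta>)) powr p) * X"
          unfolding N_def X_def \<beta>_def
        proof (rule commutator_weighted[OF b fL bfL _ p])
          fix Q :: "'n node" assume "0 < snd Q"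
          from mult_left_mono[OF A_bound[OF this], of 2]
          show "2 * (\<integral>\<^sup>+x\<in>hcube Q. hl_maximal (\<lambda>y. ennreal (w y) * indicator (hcube Q) y) x \<partial>lebesgue)
            \<le> ennreal (2 * a) * (\<integral>\<^sup>+x\<in>hcube Q. ennreal (w x) \<partial>lebesgue)"
            using a by (simp add: ennreal_mult mult.assoc)
        qed (use apos in auto)
        then have "ennreal_powr N (1 / p) \<le> ennreal (domination_constant * (4 * (2 * a) * max 1 p)\<^sup>2 * (size_constant * \<beta>)) * ennreal_powr X (1 / p)"
          using domination_constant_pos size_constant_pos \<beta>(1) p by (intro ennreal_powr_root_le) auto
        also have "domination_constant * (4 * (2 * a) * max 1 p)\<^sup>2 * (size_constant * \<beta>) = c * \<beta> * max 1 (p\<^sup>2) * a\<^sup>2"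
        proof -
          have "(max 1 p)\<^sup>2 = max 1 (p\<^sup>2)"
          proof (cases "1 \<le> p")
            case True
            then have "1 \<le> p\<^sup>2" by (rule one_le_power)
            then show ?thesis using True by simp
          next
            case False
            then have "p\<^sup>2 \<le> 1" using p by (intro power_le_one) auto
            then show ?thesis using False by simp
          qed
          then show ?thesis by (simp add: c_def power_mult_distrib mult_ac)
        qed
        also have "ennreal (c * \<beta> * max 1 (p\<^sup>2) * a\<^sup>2) = ennreal c * BMO_norm b * ennreal (max 1 (p\<^sup>2)) * ?A\<^sup>2"
          using c \<beta> a by (simp add: ennreal_mult ennreal_power)
        finally show ?thesis unfolding lhs rhs .
      qed
    qed
  qed
qed

end
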